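(* Let $\lambda<0$ and let $B^{\lambda,br}$ be a Brownian bridge of length $1$ from $0$ to $\lambda$. Then its Vervaat transform $(V(B^{\lambda,br})_t; 0 \leq t \leq 1)$ is not a Markov process with respect to its induced filtration.
   Context: For a continuous $f:[0,1]\to\mathbb{R}$ with $f(0)=0$, let $\tau(f)$ be the first time at which the minimum of $f$ on $[0,1]$ is attained. The Vervaat transform of $f$ is $V(f)(t):=f(\tau(f)+t \bmod 1)+f(1)1_{\{t+\tau(f) \geq 1\}}-f(\tau(f))$, $t\in[0,1]$. Markov processes are not assumed to be time-homogeneous. *)

theory Defs
  imports "HOL-Probability.Probability"
begin

text \<open>Normal laws may be degenerate: constants count as Gaussian with variance zero.\<close>

definition gaussian_rv :: "'a measure \<Rightarrow> ('a \<Rightarrow> real) \<Rightarrow> bool" where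
  "gaussian_rv M X \<longleftrightarrow>
     (\<exists>m s. s > 0 \<and> distributed M lborel X (normal_density m s)) \<or>
     (X \<in> borel_measurable M \<and> (\<exists>m. AE w in M. X w = m))"

definition gaussian_process :: "'a measure \<Rightarrow> real set \<Rightarrow> (real \<Rightarrow> 'a \<Rightarrow> real) \<Rightarrow> bool" where
  "gaussian_process M T X \<longleftrightarrow>
     (\<forall>J c. finite J \<and> J \<subseteq> T \<longrightarrow> gaussian_rv M (\<lambda>w. \<Sum>t\<in>J. c t * X t w))"

text \<open>
  The bridge of length \<open>1\<close> from \<open>0\<close> to \<open>b\<close>: every path is continuous and starts at \<open>0\<close>,
  so that the Vervaat transform below is meaningful for every path. The value at time \<open>1\<close> is
  almost surely \<open>b\<close>, because it has mean \<open>b\<close> and variance zero.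
\<close>

definition brownian_bridge :: "'a measure \<Rightarrow> real \<Rightarrow> (real \<Rightarrow> 'a \<Rightarrow> real) \<Rightarrow> bool" where
  "brownian_bridge M b X \<longleftrightarrow>
     prob_space M \<and>
     (\<forall>w\<in>space M. continuous_on {0..1} (\<lambda>t. X t w) \<and> X 0 w = 0) \<and>
     gaussian_process M {0..1} X \<and>
     (\<forall>t\<in>{0..1}. (\<integral>w. X t w \<partial>M) = b * t) \<and>
     (\<forall>s\<in>{0..1}. \<forall>t\<in>{0..1}. s \<le> t \<longrightarrow>
        (\<integral>w. (X s w - b * s) * (X t w - b * t) \<partial>M) = s * (1 - t))"

text \<open>For continuous \<open>f\<close> the infimum is attained, so it is the first time of the minimum.\<close>

definition first_argmin :: "(real \<Rightarrow> real) \<Rightarrow> real" where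
  "first_argmin f = Inf {t \<in> {0..1}. \<forall>s\<in>{0..1}. f t \<le> f s}"

text \<open>Reduction modulo \<open>1\<close> is the fractional part; only \<open>t \<in> {0..1}\<close> is relevant.\<close>

definition vervaat :: "(real \<Rightarrow> real) \<Rightarrow> real \<Rightarrow> real" where
  "vervaat f t =
     f (frac (first_argmin f + t))
     + f 1 * (if t + first_argmin f \<ge> 1 then 1 else 0)
     - f (first_argmin f)"

definition natural_filtration ::
    "'a measure \<Rightarrow> real set \<Rightarrow> (real \<Rightarrow> 'a \<Rightarrow> real) \<Rightarrow> real \<Rightarrow> 'a measure" where
  "natural_filtration M T X s =
     sigma (space M) {X u -` A \<inter> space M | u A. u \<in> T \<and> u \<le> s \<and> A \<in> sets borel}"

text \<open>The process is not assumed to be time-homogeneous.\<close>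

definition markov_process ::
    "'a measure \<Rightarrow> real set \<Rightarrow> (real \<Rightarrow> 'a measure) \<Rightarrow> (real \<Rightarrow> 'a \<Rightarrow> real) \<Rightarrow> bool" where
  "markov_process M T F X \<longleftrightarrow>
     prob_space M \<and>
     filtration (space M) F \<and>
     (\<forall>t\<in>T. subalgebra M (F t) \<and> X t \<in> borel_measurable (F t)) \<and>
     (\<forall>s\<in>T. \<forall>t\<in>T. \<forall>A\<in>sets borel. s \<le> t \<longrightarrow>
        (AE w in M.
           real_cond_exp M (F s) (\<lambda>w. indicator A (X t w)) w =
           real_cond_exp M (vimage_algebra (space M) (X s) borel) (\<lambda>w. indicator A (X t w)) w))"

end

theory Submission
  imports Defs
begin

text \<open>
  Let \<open>tau\<close> be the first time at which the bridge \<open>B\<close> attains its minimum. The path \<open>V\<close> starts with an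
  excursion at or above \<open>0\<close>, which lasts at least until time \<open>1 - tau\<close>, and then travels down to \<open>lam\<close>. The
  two regimes are incompatible with the Markov property, because a Markov process that sits near \<open>0\<close>
  at an early time cannot know in which of them it is.

  Fix small times \<open>r < s < t < T\<close>, each much smaller than the next. If \<open>V r < 0\<close>, then the first regime
  is over at time \<open>r\<close>. After \<open>s\<close> the path is then a piece of the bridge that has to stay above \<open>lam\<close>,
  and over short times it looks like Brownian motion: given \<open>V s\<close> near \<open>0\<close> and \<open>V T\<close> of moderate size,
  \<open>V t\<close> is negative with conditional probability at least \<open>1/4\<close> (\<open>negative_after_restart\<close>). If \<open>V\<close> were
  Markov, then this bound would hold given \<open>V s = x\<close> alone, for almost every \<open>x\<close> near \<open>0\<close> at which
  \<open>V r < 0\<close> has positive conditional probability. These are almost all \<open>x\<close> near \<open>0\<close>: the law of \<open>V s\<close> on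
  the event \<open>V r < 0\<close> has a density that is bounded below near \<open>0\<close> (\<open>density_minorant\<close>), while on the
  event \<open>tau \<le> 1 - 2 * s\<close>, which is nearly certain, the law of \<open>V s\<close> has no mass on Lebesgue null sets
  (\<open>density_majorant_on_cell\<close>). As \<open>V s\<close> is close to \<open>0\<close> with high probability, \<open>V t < 0\<close> would have a
  probability that is bounded away from \<open>0\<close> as \<open>t\<close> tends to \<open>0\<close>. But \<open>V t < 0\<close> forces \<open>tau \<ge> 1 - t\<close>, and
  this has small probability because \<open>tau < 1\<close> almost surely (\<open>tau_less_1\<close>).

  All estimates rest on one property of the bridge: inside a time window, the deviation of the path from
  its chord is Gaussian and independent of the path outside the window (\<open>window_independent\<close>). It
  follows from the uniqueness theorem for characteristic functions, since uncorrelated jointly Gaussian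
  families are independent (\<open>gaussian_families_independent\<close>). The windows have to be placed relative to
  the random time \<open>tau\<close>. On the event \<open>V r < 0\<close> this time lies in the last piece \<open>{1-r..1}\<close> of the path
  and is a function of that piece, which lies outside all windows; so \<open>tau\<close> can be frozen at
  deterministic values that approximate it (\<open>random_time_substitution\<close>).
\<close>

section \<open>Characteristic functions determine joint laws\<close>

definition generated_algebra :: "'a measure \<Rightarrow> 'i set \<Rightarrow> ('i \<Rightarrow> 'a \<Rightarrow> real) \<Rightarrow> 'a measure" where
  "generated_algebra M I X =
     sigma (space M) {X i -` A \<inter> space M | i A. i \<in> I \<and> A \<in> sets borel}"

lemma space_generated_algebra [simp]: "space (generated_algebra M I X) = space M"
  unfolding generated_algebra_def by (rule space_measure_of_conv)

lemma sets_generated_algebra: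
  "sets (generated_algebra M I X) =
     sigma_sets (space M) {X i -` A \<inter> space M | i A. i \<in> I \<and> A \<in> sets borel}"
  unfolding generated_algebra_def by (rule sets_measure_of) auto

lemma measurable_generated_algebra:
  assumes "i \<in> I"
  shows "X i \<in> borel_measurable (generated_algebra M I X)"
proof (rule measurableI)
  fix A :: "real set" assume "A \<in> sets borel"
  then show "X i -` A \<inter> space (generated_algebra M I X) \<in> sets (generated_algebra M I X)"
    using assms by (auto simp: sets_generated_algebra)
qed auto

lemma subalgebra_generated_algebra:
  assumes "\<And>i. i \<in> I \<Longrightarrow> X i \<in> borel_measurable N" "space N = space M"
  shows "subalgebra N (generated_algebra M I X)"
  unfolding subalgebra_def sets_generated_algebra
proof (intro conjI)
  show "sigma_sets (space M) {X i -` A \<inter> space M |i A. i \<in> I \<and> A \<in> sets borel} \<subseteq> sets N"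
    unfolding assms(2)[symmetric]
    by (rule sets.sigma_sets_subset) (use assms(1) measurable_sets in blast)
qed (simp add: assms)

context prob_space
begin

lemma integrable_bounded_rv:
  fixes f :: "'a \<Rightarrow> real"
  assumes "f \<in> borel_measurable M" "\<And>x. x \<in> space M \<Longrightarrow> \<bar>f x\<bar> \<le> C"
  shows "integrable M f"
  by (rule integrable_const_bound[where B=C]) (use assms in auto)

text \<open>
  Adding a constant makes both weights positive without changing the hypothesis. After normalisation
  the laws of \<open>Y\<close> under the two weights are then probability measures with the same characteristic
  function: the phases \<open>0\<close> and \<open>- pi / 2\<close> give its real and imaginary parts.
\<close>

lemma cos_determines_weighted_law:
  fixes w1 w2 Y :: "'a \<Rightarrow> real"
  assumes [measurable]: "w1 \<in> borel_measurable M" "w2 \<in> borel_measurable M" "Y \<in> borel_measurable M"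
    and bd: "\<And>x. x \<in> space M \<Longrightarrow> \<bar>w1 x\<bar> \<le> C" "\<And>x. x \<in> space M \<Longrightarrow> \<bar>w2 x\<bar> \<le> C"
    and eq: "\<And>th al. (\<integral>x. w1 x * cos (th * Y x + al) \<partial>M) = (\<integral>x. w2 x * cos (th * Y x + al) \<partial>M)"
    and [measurable]: "A \<in> sets borel"
  shows "(\<integral>x. w1 x * indicator A (Y x) \<partial>M) = (\<integral>x. w2 x * indicator A (Y x) \<partial>M)"
proof -
  define v where "v w x = w x + C + 1" for w :: "'a \<Rightarrow> real" and x
  have v_eq: "v w = (\<lambda>x. w x + C + 1)" for w by (auto simp: v_def)
  have int: "integrable M (\<lambda>x. w x * g x)"
    if [measurable]: "w \<in> borel_measurable M" "g \<in> borel_measurable M"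
      and "\<And>x. x \<in> space M \<Longrightarrow> \<bar>w x\<bar> \<le> C" "\<And>x. \<bar>g x\<bar> \<le> 1" for w g
  proof (rule integrable_bounded_rv[where C=C])
    fix x assume "x \<in> space M"
    then have "\<bar>w x\<bar> \<le> C" "\<bar>g x\<bar> \<le> 1" using that by auto
    then show "\<bar>w x * g x\<bar> \<le> C" using mult_mono[of "\<bar>w x\<bar>" C "\<bar>g x\<bar>" 1] by (simp add: abs_mult)
  qed measurable
  have intg: "integrable M g" if "g \<in> borel_measurable M" "\<And>x. \<bar>g x\<bar> \<le> 1" for g :: "'a \<Rightarrow> real"
    by (rule integrable_bounded_rv[where C=1]) (use that in auto)
  have split: "(\<integral>x. v w x * g x \<partial>M) = (\<integral>x. w x * g x \<partial>M) + (C + 1) * (\<integral>x. g x \<partial>M)"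
    if "w \<in> borel_measurable M" "g \<in> borel_measurable M"
      and "\<And>x. x \<in> space M \<Longrightarrow> \<bar>w x\<bar> \<le> C" "\<And>x. \<bar>g x\<bar> \<le> 1" for w g
  proof -
    have "(\<integral>x. v w x * g x \<partial>M) = (\<integral>x. w x * g x + (C + 1) * g x \<partial>M)"
      by (rule Bochner_Integration.integral_cong) (simp_all add: v_eq algebra_simps)
    also have "\<dots> = (\<integral>x. w x * g x \<partial>M) + (C + 1) * (\<integral>x. g x \<partial>M)"
      using int[OF that] intg[OF that(2,4)] by (subst Bochner_Integration.integral_add) auto
    finally show ?thesis .
  qed
  define m where "m = (\<integral>x. v w1 x \<partial>M)"
  have iv: "integrable M (v w)" if "w \<in> {w1, w2}" for w
  proof -
    have "integrable M w" using that bd by (auto intro!: integrable_bounded_rv[where C=C])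
    then show ?thesis by (simp add: v_eq)
  qed
  have v_ge: "1 \<le> v w1 x" "1 \<le> v w2 x" if "x \<in> space M" for x
    using bd[OF that] by (auto simp: v_def)
  have m2: "m = (\<integral>x. v w2 x \<partial>M)"
    unfolding m_def using split[of w1 "\<lambda>_. 1"] split[of w2 "\<lambda>_. 1"] eq[of 0 0]
    by (simp add: bd)
  have m_ge: "1 \<le> m"
  proof -
    have "(\<integral>x. 1 \<partial>M) \<le> m" unfolding m_def
      by (rule integral_mono) (use v_ge iv[of w1] in auto)
    then show ?thesis by (simp add: prob_space)
  qed
  define N where "N w = distr (density M (\<lambda>x. v w x / m)) borel Y" for w
  have N: "real_distribution (N w)" "(\<integral>y. h y \<partial>N w) = (\<integral>x. v w x * h (Y x) \<partial>M) / m"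
    if w: "w \<in> {w1, w2}" and [measurable]: "h \<in> borel_measurable borel" for h :: "real \<Rightarrow> real" and w
  proof -
    have [measurable]: "w \<in> borel_measurable M" using w by auto
    have [measurable]: "v w \<in> borel_measurable M" unfolding v_eq by measurable
    have nn: "AE x in M. 0 \<le> v w x / m"
      by (rule AE_I2) (use w m_ge v_ge in \<open>auto intro!: divide_nonneg_nonneg intro: order_trans[of 0 1]\<close>)
    have "integrable M (v w)" using w by (rule iv)
    then have "prob_space (density M (\<lambda>x. v w x / m))"
      using m_def m2 w m_ge nn
      by (intro prob_spaceI) (auto simp: emeasure_density nn_integral_eq_integral)
    then interpret D: prob_space "density M (\<lambda>x. v w x / m)" .
    show "real_distribution (N w)" unfolding N_def by (rule D.real_distribution_distr) simp
    have "(\<integral>y. h y \<partial>N w) = (\<integral>x. h (Y x) \<partial>density M (\<lambda>x. v w x / m))"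
      unfolding N_def by (subst integral_distr) auto
    also have "\<dots> = (\<integral>x. v w x / m * h (Y x) \<partial>M)"
      using nn by (subst integral_real_density) auto
    finally show "(\<integral>y. h y \<partial>N w) = (\<integral>x. v w x * h (Y x) \<partial>M) / m" by simp
  qed
  have eqv: "(\<integral>x. v w1 x * cos (th * Y x + al) \<partial>M) = (\<integral>x. v w2 x * cos (th * Y x + al) \<partial>M)" for th al
    using bd eq by (subst (1 2) split) auto
  interpret N1: real_distribution "N w1" using N(1)[of w1 "\<lambda>_. 0"] by simp
  interpret N2: real_distribution "N w2" using N(1)[of w2 "\<lambda>_. 0"] by simp
  have "char (N w1) th = char (N w2) th" for th
  proof -
    have c: "(\<integral>y. cos (th * y) \<partial>N w1) = (\<integral>y. cos (th * y) \<partial>N w2)"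
      using eqv[of th 0] by (simp add: N(2))
    have s: "(\<integral>y. sin (th * y) \<partial>N w1) = (\<integral>y. sin (th * y) \<partial>N w2)"
      using eqv[of th "- pi/2"] by (simp add: N(2) cos_diff)
    have "Re (char (N w1) th) = Re (char (N w2) th)"
      unfolding char_def
      by (subst (1 2) integral_Re[symmetric]) (use c in \<open>auto intro!: N1.integrable_iexp N2.integrable_iexp simp: Re_exp Im_exp\<close>)
    moreover have "Im (char (N w1) th) = Im (char (N w2) th)"
      unfolding char_def
      by (subst (1 2) integral_Im[symmetric]) (use s in \<open>auto intro!: N1.integrable_iexp N2.integrable_iexp simp: Re_exp Im_exp\<close>)
    ultimately show ?thesis by (rule complex_eqI)
  qed
  then have "N w1 = N w2"
    by (intro Levy_uniqueness N1.real_distribution_axioms N2.real_distribution_axioms ext)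
  then have "(\<integral>x. v w1 x * indicator A (Y x) \<partial>M) = (\<integral>x. v w2 x * indicator A (Y x) \<partial>M)"
    using N(2)[of w1 "indicator A"] N(2)[of w2 "indicator A"] m_ge by auto
  then show ?thesis using bd by (subst (asm) (1 2) split) auto
qed

text \<open>
  Uniqueness for joint laws is reduced to dimension one by turning the coordinates into indicators one
  at a time. The weights for the next coordinate contain a cosine of the remaining ones; multiplied by a
  cosine of the next coordinate it becomes a sum of two such cosines, to which the induction hypothesis
  applies.
\<close>

lemma cos_determines_cylinders:
  fixes X :: "'i \<Rightarrow> 'a \<Rightarrow> real" and W :: "'a \<Rightarrow> real"
  assumes X: "\<And>i. i \<in> I \<Longrightarrow> X i \<in> borel_measurable M"
    and [measurable]: "W \<in> borel_measurable M"
    and bd: "\<And>x. x \<in> space M \<Longrightarrow> \<bar>W x\<bar> \<le> C"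
    and eq: "\<And>K c al. finite K \<Longrightarrow> K \<subseteq> I \<Longrightarrow>
      expectation (\<lambda>x. W x * cos ((\<Sum>k\<in>K. c k * X k x) + al)) =
      expectation W * expectation (\<lambda>x. cos ((\<Sum>k\<in>K. c k * X k x) + al))"
    and "finite J" "J \<subseteq> I" "\<And>j. A j \<in> sets borel" "finite K" "K \<subseteq> I"
  shows "expectation (\<lambda>x. W x * (\<Prod>j\<in>J. indicator (A j) (X j x)) * cos ((\<Sum>k\<in>K. c k * X k x) + al)) =
    expectation W * expectation (\<lambda>x. (\<Prod>j\<in>J. indicator (A j) (X j x)) * cos ((\<Sum>k\<in>K. c k * X k x) + al))"
  using assms(5-)
proof (induction J arbitrary: K c al rule: finite_induct)
  case empty
  then show ?case using eq by simp
next
  case (insert j J)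
  define g where "g x = (\<Prod>j\<in>J. indicator (A j) (X j x) :: real)" for x
  define T where "T x = (\<Sum>k\<in>K. c k * X k x) + al" for x
  have C0: "0 \<le> C" using bd not_empty by fastforce
  have EW: "\<bar>expectation W\<bar> \<le> C"
  proof -
    have "\<bar>expectation W\<bar> \<le> expectation (\<lambda>x. \<bar>W x\<bar>)" by (rule integral_abs_bound)
    also have "\<dots> \<le> expectation (\<lambda>_. C)"
      by (rule integral_mono) (use bd in \<open>auto intro: integrable_abs integrable_bounded_rv[where C=C]\<close>)
    finally show ?thesis by (simp add: prob_space)
  qed
  have A[measurable]: "A j \<in> sets borel" for j using insert by simp
  have XJ: "X j \<in> borel_measurable M" using insert X by auto
  have gm[measurable]: "g \<in> borel_measurable M" unfolding g_def
    by (intro borel_measurable_prod measurable_compose[OF X borel_measurable_indicator[OF A]]) (use insert in auto)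
  have Tm[measurable]: "T \<in> borel_measurable M" unfolding T_def using insert X by (intro borel_measurable_add borel_measurable_sum) auto
  have g1: "\<bar>g x\<bar> \<le> 1" for x unfolding g_def abs_prod by (rule prod_le_1) (auto simp: indicator_def)
  have gc: "\<bar>g x * cos (T x)\<bar> \<le> 1" for x
    using mult_mono[OF g1[of x] abs_cos_le_one[of "T x"]] by (simp add: abs_mult)
  have "expectation (\<lambda>x. (W x * (g x * cos (T x))) * indicator (A j) (X j x)) =
        expectation (\<lambda>x. (expectation W * (g x * cos (T x))) * indicator (A j) (X j x))"
  proof (rule cos_determines_weighted_law[where C=C])
    fix th be
    define K' where "K' = Set.insert j K"
    define cc where "cc s k = (if k \<in> K then c k else 0) + (if k = j then s * th else 0)" for s k
    have sumK: "(\<Sum>k\<in>K'. cc s k * X k x) = (\<Sum>k\<in>K. c k * X k x) + s * th * X j x" for s x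
    proof -
      have "(\<Sum>k\<in>K'. cc s k * X k x) = (\<Sum>k\<in>K'. (if k \<in> K then c k * X k x else 0)) + (\<Sum>k\<in>K'. if k = j then s * th * X k x else 0)"
        by (subst sum.distrib[symmetric], rule sum.cong) (auto simp: cc_def algebra_simps)
      also have "(\<Sum>k\<in>K'. (if k \<in> K then c k * X k x else 0)) = (\<Sum>k\<in>K. c k * X k x)"
        using insert.prems by (intro sum.mono_neutral_cong_right) (auto simp: K'_def)
      also have "(\<Sum>k\<in>K'. if k = j then s * th * X k x else 0) = s * th * X j x"
        using insert.prems by (subst sum.delta) (auto simp: K'_def)
      finally show ?thesis .
    qed
    have K': "finite K'" "K' \<subseteq> I" using insert.prems by (auto simp: K'_def)
    have prod: "cos (T x) * cos (th * X j x + be) =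
        (cos ((\<Sum>k\<in>K'. cc 1 k * X k x) + (al + be)) + cos ((\<Sum>k\<in>K'. cc (-1) k * X k x) + (al - be))) / 2" for x
      unfolding sumK T_def cos_times_cos by (simp add: algebra_simps)
    define H where "H s be x = g x * cos ((\<Sum>k\<in>K'. cc s k * X k x) + (al + be))" for s be x
    have H_eq: "H s be = (\<lambda>x. g x * cos ((\<Sum>k\<in>K'. cc s k * X k x) + (al + be)))" for s be
      by (auto simp: H_def)
    have Hm[measurable]: "H s be \<in> borel_measurable M" for s be
      unfolding H_def
      by (intro borel_measurable_times borel_measurable_const borel_measurable_add borel_measurable_sum gm
          measurable_compose[of "\<lambda>x. _ x + _" M borel cos] X) (use K' in auto)
    have H1: "\<bar>H s be x\<bar> \<le> 1" for s be x
      unfolding H_def using mult_mono[OF g1[of x] abs_cos_le_one] by (simp add: abs_mult)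
    have iH: "integrable M (H s be)" for s be by (rule integrable_bounded_rv[OF Hm H1])
    have iWH: "integrable M (\<lambda>x. W x * H s be x)" for s be
      by (rule integrable_bounded_rv[where C="C * 1"]) (use bd H1 C0 in \<open>auto simp: abs_mult intro!: mult_mono[of _ C _ 1, simplified]\<close>)
    have IH: "expectation (\<lambda>x. W x * H s be x) = expectation W * expectation (H s be)" for s be
      using insert.IH[OF _ _ K', of "cc s" "al + be"] insert.prems by (simp add: H_eq g_def mult.assoc)
    have "expectation (\<lambda>x. W x * (g x * cos (T x)) * cos (th * X j x + be)) =
      expectation (\<lambda>x. W x * H 1 be x / 2 + W x * H (-1) (-be) x / 2)"
      by (rule Bochner_Integration.integral_cong[OF refl]) (simp only: mult.assoc prod, simp add: H_def field_simps)
    also have "\<dots> = expectation W * (expectation (\<lambda>x. H 1 be x / 2 + H (-1) (-be) x / 2))"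
      using iH iWH by (simp add: IH algebra_simps)
    also have "\<dots> = expectation W * (expectation (\<lambda>x. g x * cos (T x) * cos (th * X j x + be)))"
      by (intro arg_cong2[where f="(*)"] refl Bochner_Integration.integral_cong[OF refl]) (simp only: mult.assoc prod, simp add: H_def field_simps)
    finally show "expectation (\<lambda>x. W x * (g x * cos (T x)) * cos (th * X j x + be)) =
      expectation (\<lambda>x. expectation W * (g x * cos (T x)) * cos (th * X j x + be))"
      by (simp add: mult.assoc)
  next
    fix x assume "x \<in> space M"
    show "\<bar>W x * (g x * cos (T x))\<bar> \<le> C"
      using mult_mono[OF bd[OF \<open>x \<in> space M\<close>] gc[of x]] C0 by (simp add: abs_mult)
    show "\<bar>expectation W * (g x * cos (T x))\<bar> \<le> C"
      using mult_mono[OF EW gc[of x]] C0 by (simp add: abs_mult)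
  qed (use XJ A in measurable)
  then show ?case
    using insert.hyps by (simp add: g_def T_def ac_simps)
qed

text \<open>
  A weight that is uncorrelated with all cosines of linear combinations of \<open>X\<close> is uncorrelated with every
  event generated by \<open>X\<close>. The previous lemma gives this for the finite cylinder events, which form an
  intersection-stable generator; Dynkin's argument extends it.
\<close>

lemma generated_algebra_factorI:
  fixes X :: "'i \<Rightarrow> 'a \<Rightarrow> real" and W :: "'a \<Rightarrow> real"
  assumes X: "\<And>i. i \<in> I \<Longrightarrow> X i \<in> borel_measurable M"
    and Wm[measurable]: "W \<in> borel_measurable M"
    and bd: "\<And>x. x \<in> space M \<Longrightarrow> \<bar>W x\<bar> \<le> C"
    and eq: "\<And>K c al. finite K \<Longrightarrow> K \<subseteq> I \<Longrightarrow>
      expectation (\<lambda>x. W x * cos ((\<Sum>k\<in>K. c k * X k x) + al)) =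
      expectation W * expectation (\<lambda>x. cos ((\<Sum>k\<in>K. c k * X k x) + al))"
    and F: "F \<in> sets (generated_algebra M I X)"
  shows "expectation (\<lambda>x. W x * indicator F x) = expectation W * prob F"
proof -
  define G where "G = {{x \<in> space M. \<forall>j\<in>J. X j x \<in> A j} | J A. finite J \<and> J \<subseteq> I \<and> (\<forall>j::'i. A j \<in> sets (borel::real measure))}"
  have iW: "integrable M W" using integrable_bounded_rv[OF Wm bd] .
  have G_sets: "G \<subseteq> sets M"
  proof
    fix a assume "a \<in> G"
    then obtain J A where a: "a = {x \<in> space M. \<forall>j\<in>J. X j x \<in> A j}" "finite J" "J \<subseteq> I" "\<And>j. A j \<in> sets borel"
      unfolding G_def by blast
    have "{x \<in> space M. X j x \<in> A j} \<in> sets M" if "j \<in> J" for j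
      using measurable_sets[OF X a(4), of j j] that a(3) by (auto simp: vimage_def Int_def conj_commute)
    then show "a \<in> sets M" unfolding a(1) using a(2) by (intro sets.sets_Collect_finite_All)  auto
  qed
  have gen: "sets (generated_algebra M I X) \<subseteq> sigma_sets (space M) G"
    unfolding sets_generated_algebra
  proof (rule sigma_sets_mono, safe)
    fix i and A :: "real set" assume "i \<in> I" "A \<in> sets borel"
    then have "X i -` A \<inter> space M \<in> G"
      unfolding G_def by (intro CollectI exI[of _ "{i}"] exI[of _ "\<lambda>_. A"]) auto
    then show "X i -` A \<inter> space M \<in> sigma_sets (space M) G" by (rule sigma_sets.Basic)
  qed
  have "Int_stable G"
  proof (rule Int_stableI)
    fix a b assume "a \<in> G" "b \<in> G"
    then obtain J A J' A' where a: "a = {x \<in> space M. \<forall>j\<in>J. X j x \<in> A j}" "finite J" "J \<subseteq> I" "\<And>j. A j \<in> sets borel"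
      and b: "b = {x \<in> space M. \<forall>j\<in>J'. X j x \<in> A' j}" "finite J'" "J' \<subseteq> I" "\<And>j. A' j \<in> sets borel"
      unfolding G_def by blast
    define A'' where "A'' j = (if j \<in> J then A j else UNIV) \<inter> (if j \<in> J' then A' j else UNIV)" for j
    have "a \<inter> b = {x \<in> space M. \<forall>j\<in>J \<union> J'. X j x \<in> A'' j}"
      unfolding a b A''_def by auto
    then show "a \<inter> b \<in> G" unfolding G_def using a b
      by (intro CollectI exI[of _ "J \<union> J'"] exI[of _ A'']) (auto simp: A''_def)
  qed
  have sub: "sigma_sets (space M) G \<subseteq> sets M" using G_sets by (rule sets.sigma_sets_subset)
  have "F \<in> sigma_sets (space M) G" using F gen by auto
  have "G \<subseteq> Pow (space M)" using G_sets sets.space_closed by auto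
  from \<open>Int_stable G\<close> this \<open>F \<in> sigma_sets (space M) G\<close> show ?thesis
  proof (induction rule: sigma_sets_induct_disjoint)
    case (basic a)
    then obtain J A where a: "a = {x \<in> space M. \<forall>j\<in>J. X j x \<in> A j}" "finite J" "J \<subseteq> I" "\<And>j. A j \<in> sets borel"
      unfolding G_def by blast
    have ind: "indicator a x = (\<Prod>j\<in>J. indicator (A j) (X j x) :: real)" if "x \<in> space M" for x
      using that a(2) by (auto simp: a(1) indicator_def)
    have aM: "a \<in> sets M" using basic G_sets by auto
    have "expectation (\<lambda>x. W x * indicator a x) = expectation (\<lambda>x. W x * (\<Prod>j\<in>J. indicator (A j) (X j x)))"
      by (rule Bochner_Integration.integral_cong) (auto simp: ind)
    also have "\<dots> = expectation W * expectation (\<lambda>x. \<Prod>j\<in>J. indicator (A j) (X j x))"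
      using cos_determines_cylinders[OF X Wm bd eq a(2,3,4), where K="{}" and al=0] by simp
    also have "expectation (\<lambda>x. \<Prod>j\<in>J. indicator (A j) (X j x)) = expectation (\<lambda>x. indicator a x :: real)"
      by (rule Bochner_Integration.integral_cong) (simp_all add: ind)
    finally show ?case using aM by simp
  next
    case empty
    then show ?case by simp
  next
    case (compl a)
    then have aM[measurable]: "a \<in> sets M" using sub by auto
    have "expectation (\<lambda>x. W x * indicator (space M - a) x) = expectation (\<lambda>x. W x - W x * indicator a x)"
      by (rule Bochner_Integration.integral_cong) (auto simp: indicator_def)
    also have "\<dots> = expectation W - expectation (\<lambda>x. W x * indicator a x)"
      by (rule Bochner_Integration.integral_diff[OF iW]) (use iW in \<open>auto simp: integrable_mult_indicator mult.commute intro: integrable_real_mult_indicator\<close>)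
    also have "\<dots> = expectation W * (1 - prob a)" using compl by (simp add: algebra_simps)
    finally show ?case using prob_compl[OF aM] by simp
  next
    case (union a)
    then have aM: "\<And>i. a i \<in> sets M" "(\<Union>i. a i) \<in> sets M" using sub by auto
    have "(\<lambda>i. \<integral>x\<in>a i. W x \<partial>M) sums (\<integral>x\<in>(\<Union>i. a i). W x \<partial>M)"
    proof -
      have ii: "set_integrable M (\<Union>i. a i) W" unfolding set_integrable_def
        using integrable_mult_indicator[OF aM(2) iW] .
      show "(\<lambda>i. \<integral>x\<in>a i. W x \<partial>M) sums (\<integral>x\<in>(\<Union>i. a i). W x \<partial>M)"
      proof -
        have "set_integrable M (a i) W" for i unfolding set_integrable_def using integrable_mult_indicator[OF aM(1) iW] .
        have s: "summable (\<lambda>i. \<integral>x\<in>a i. W x \<partial>M)"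
        proof (rule summable_comparison_test')
          have Ca: "\<bar>\<integral>x\<in>a i. W x \<partial>M\<bar> \<le> \<bar>C\<bar> * prob (a i)" for i
          proof -
            have "\<bar>\<integral>x\<in>a i. W x \<partial>M\<bar> \<le> (\<integral>x. \<bar>indicator (a i) x * W x\<bar> \<partial>M)"
              unfolding set_lebesgue_integral_def using integral_abs_bound[of M "\<lambda>x. indicator (a i) x * W x"] by simp
            also have "\<dots> \<le> (\<integral>x. \<bar>C\<bar> * indicator (a i) x \<partial>M)"
            proof (rule integral_mono)
              show "integrable M (\<lambda>x. \<bar>indicator (a i) x * W x\<bar>)"
                using integrable_mult_indicator[OF aM(1) iW, of i] by auto
              show "integrable M (\<lambda>x. \<bar>C\<bar> * indicator (a i) x)"
                by (rule integrable_bounded_rv[where C="\<bar>C\<bar>"]) (use aM in \<open>auto simp: indicator_def\<close>)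
              fix x assume "x \<in> space M"
              then show "\<bar>indicator (a i) x * W x\<bar> \<le> \<bar>C\<bar> * indicator (a i) x"
                using bd[of x] by (auto simp: indicator_def)
            qed
            finally show ?thesis using aM by simp
          qed
          then show "norm (\<integral>x\<in>a n. W x \<partial>M) \<le> \<bar>C\<bar> * prob (a n)" if "0 \<le> n" for n by simp
          show "summable (\<lambda>n. \<bar>C\<bar> * prob (a n))"
            using finite_measure_UNION[of a] union aM(1) by (intro summable_mult) (auto simp: sums_iff)
        qed
        have "(\<integral>x\<in>(\<Union>i. a i). W x \<partial>M) = (\<Sum>i. \<integral>x\<in>a i. W x \<partial>M)"
        proof (rule lebesgue_integral_countable_add[OF _ _ ii])
          show "\<And>i j. i \<noteq> j \<Longrightarrow> a i \<inter> a j = {}" using union by (auto simp: disjoint_family_on_def)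
        qed (use aM in auto)
        with s show ?thesis by (simp add: sums_iff)
      qed
    qed
    moreover have "(\<lambda>i. expectation W * prob (a i)) sums (expectation W * prob (\<Union>i. a i))"
      using finite_measure_UNION[of a] union aM by (intro sums_mult) auto
    moreover have "(\<integral>x\<in>a i. W x \<partial>M) = expectation W * prob (a i)" for i
      using union(3)[of i] by (simp add: set_lebesgue_integral_def mult.commute)
    ultimately have "(\<integral>x\<in>(\<Union>i. a i). W x \<partial>M) = expectation W * prob (\<Union>i. a i)"
      by (simp add: sums_iff)
    then show ?case by (simp add: set_lebesgue_integral_def mult.commute)
  qed
qed

end

context prob_space
begin

section \<open>Gaussian variables and independence\<close>

lemma integrable_product_of_squares:
  fixes f g :: "'a \<Rightarrow> real"
  assumes [measurable]: "f \<in> borel_measurable M" "g \<in> borel_measurable M"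
    and "integrable M (\<lambda>x. (f x)\<^sup>2)" "integrable M (\<lambda>x. (g x)\<^sup>2)"
  shows "integrable M (\<lambda>x. f x * g x)"
proof (rule Bochner_Integration.integrable_bound)
  show "integrable M (\<lambda>x. (f x)\<^sup>2 + (g x)\<^sup>2)" using assms by simp
  show "AE x in M. norm (f x * g x) \<le> norm ((f x)\<^sup>2 + (g x)\<^sup>2)"
  proof (rule AE_I2)
    fix x
    have "2 * (\<bar>f x\<bar> * \<bar>g x\<bar>) \<le> (f x)\<^sup>2 + (g x)\<^sup>2"
      using sum_squares_bound[of "\<bar>f x\<bar>" "\<bar>g x\<bar>"] by (simp add: mult.assoc)
    moreover have "0 \<le> \<bar>f x\<bar> * \<bar>g x\<bar>" by simp
    ultimately have "\<bar>f x\<bar> * \<bar>g x\<bar> \<le> (f x)\<^sup>2 + (g x)\<^sup>2" by linarith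
    then show "norm (f x * g x) \<le> norm ((f x)\<^sup>2 + (g x)\<^sup>2)" by (simp add: abs_mult)
  qed
qed measurable

lemma gaussian_measurable:
  assumes "gaussian_rv M G" shows "G \<in> borel_measurable M"
  using assms distributed_measurable[of M lborel G] unfolding gaussian_rv_def by auto

lemma gaussian_integrable:
  assumes "gaussian_rv M G"
  shows "integrable M G" "integrable M (\<lambda>x. (G x)\<^sup>2)"
proof -
  note m[measurable] = gaussian_measurable[OF assms]
  have "integrable M G \<and> integrable M (\<lambda>x. (G x)\<^sup>2)"
    using assms unfolding gaussian_rv_def
  proof (elim disjE exE conjE)
    fix m s :: real assume s: "0 < s" and D: "distributed M lborel G (normal_density m s)"
    have 1: "integrable M G"
      using distributed_integrable[OF D, of "\<lambda>x. x"] integrable_normal_moment_nz_1[OF s, of m] by simp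
    moreover have 2: "integrable M (\<lambda>x. (G x - m)\<^sup>2)"
      using distributed_integrable[OF D, of "\<lambda>x. (x - m)\<^sup>2"] integrable_normal_moment[OF s, of m 2] by simp
    moreover have "integrable M (\<lambda>x. (G x)\<^sup>2)"
    proof -
      have "(\<lambda>x. (G x)\<^sup>2) = (\<lambda>x. (G x - m)\<^sup>2 + (2 * m * G x - m\<^sup>2))"
        by (auto simp: power2_eq_square algebra_simps)
      then show ?thesis using 1 2 by simp
    qed
    ultimately show ?thesis by simp
  next
    fix m assume ae: "AE w in M. G w = m"
    have "integrable M G" by (subst integrable_cong_AE[of _ _ "\<lambda>_. m"]) (use ae in auto)
    moreover have "integrable M (\<lambda>x. (G x)\<^sup>2)" by (subst integrable_cong_AE[of _ _ "\<lambda>_. m\<^sup>2"]) (use ae in auto)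
    ultimately show ?thesis by simp
  qed
  then show "integrable M G" "integrable M (\<lambda>x. (G x)\<^sup>2)" by auto
qed

lemma gaussian_nondegenerate:
  assumes "gaussian_rv M G" "0 < variance G"
  shows "distributed M lborel G (normal_density (expectation G) (sqrt (variance G)))"
  using assms(1) unfolding gaussian_rv_def
proof (elim disjE exE conjE)
  fix m s :: real assume s: "0 < s" and D: "distributed M lborel G (normal_density m s)"
  show ?thesis using normal_distributed_expectation[OF s D] normal_distributed_variance[OF s D] D s by simp
next
  fix m assume ae: "AE w in M. G w = m" and [measurable]: "G \<in> borel_measurable M"
  have "expectation G = expectation (\<lambda>_. m)" by (rule integral_cong_AE) (use ae in auto)
  then have "expectation G = m" by (simp add: prob_space)
  then have "variance G = expectation (\<lambda>_. 0)" by (intro integral_cong_AE) (use ae in auto)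
  then show ?thesis using assms by simp
qed

lemma gaussian_expectation_cos:
  assumes "gaussian_rv M G"
  shows "expectation (\<lambda>x. cos (G x + al)) = exp (- variance G / 2) * cos (expectation G + al)"
  using assms unfolding gaussian_rv_def
proof (elim disjE exE conjE)
  fix m s :: real assume s: "0 < s" and D: "distributed M lborel G (normal_density m s)"
  have [measurable]: "G \<in> borel_measurable M" using distributed_measurable[OF D] by simp
  define Z where "Z x = (G x - m) / s" for x
  have [measurable]: "Z \<in> borel_measurable M" unfolding Z_def by measurable
  have DZ: "distributed M lborel Z std_normal_density"
    using D normal_standard_normal_convert[OF s, of G m] by (simp add: Z_def[abs_def])
  interpret N: real_distribution std_normal_distribution by (rule real_dist_normal_dist)
  have "expectation (\<lambda>x. cos (s * Z x)) = Re (char std_normal_distribution s)"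
    unfolding char_def using distributed_integral[OF DZ, of "\<lambda>x. cos (s * x)"]
    by (subst integral_Re[symmetric]) (auto intro!: N.integrable_iexp simp: Re_exp integral_real_density)
  moreover have "expectation (\<lambda>x. sin (s * Z x)) = Im (char std_normal_distribution s)"
    unfolding char_def using distributed_integral[OF DZ, of "\<lambda>x. sin (s * x)"]
    by (subst integral_Im[symmetric]) (auto intro!: N.integrable_iexp simp: Im_exp integral_real_density)
  ultimately have e: "expectation (\<lambda>x. cos (s * Z x)) = exp (- s\<^sup>2 / 2)" "expectation (\<lambda>x. sin (s * Z x)) = 0"
    unfolding char_std_normal_distribution by simp_all
  have "cos (G x + al) = cos (m + al) * cos (s * Z x) - sin (m + al) * sin (s * Z x)" for x
  proof -
    have "G x + al = (m + al) + s * Z x" using s by (simp add: Z_def)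
    then show ?thesis by (simp only: cos_add)
  qed
  then have "expectation (\<lambda>x. cos (G x + al)) =
    expectation (\<lambda>x. cos (m + al) * cos (s * Z x) - sin (m + al) * sin (s * Z x))" by simp
  also have "\<dots> = cos (m + al) * expectation (\<lambda>x. cos (s * Z x)) - sin (m + al) * expectation (\<lambda>x. sin (s * Z x))"
    by (subst Bochner_Integration.integral_diff)
      (auto intro!: integrable_mult_right integrable_bounded_rv[where C=1])
  finally show ?thesis unfolding e
    using normal_distributed_expectation[OF s D] normal_distributed_variance[OF s D] by simp
next
  fix m assume ae: "AE w in M. G w = m" and [measurable]: "G \<in> borel_measurable M"
  have "expectation G = expectation (\<lambda>_. m)" by (rule integral_cong_AE) (use ae in auto)
  then have m: "expectation G = m" by (simp add: prob_space)
  then have "variance G = expectation (\<lambda>_. 0)" by (intro integral_cong_AE) (use ae in auto)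
  moreover have "expectation (\<lambda>x. cos (G x + al)) = expectation (\<lambda>_. cos (m + al))"
    by (rule integral_cong_AE) (use ae in auto)
  ultimately show ?thesis using m by (simp add: prob_space)
qed

text \<open>
  The product of the cosines is a sum of cosines of the Gaussian variables \<open>U + V\<close> and \<open>U - V\<close>. Without
  correlation both have variance \<open>variance U + variance V\<close>, so that the exponential factors split.
\<close>

lemma gaussian_uncorrelated_cos:
  assumes U: "gaussian_rv M U" and V: "gaussian_rv M V"
    and P: "gaussian_rv M (\<lambda>x. U x + V x)" and D: "gaussian_rv M (\<lambda>x. U x - V x)"
    and cov: "expectation (\<lambda>x. U x * V x) = expectation U * expectation V"
  shows "expectation (\<lambda>x. cos (U x + al) * cos (V x + be)) =
    expectation (\<lambda>x. cos (U x + al)) * expectation (\<lambda>x. cos (V x + be))"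
proof -
  note i = gaussian_integrable[OF U] gaussian_integrable[OF V]
  have [measurable]: "U \<in> borel_measurable M" "V \<in> borel_measurable M" using U V gaussian_measurable by auto
  have iUV: "integrable M (\<lambda>x. U x * V x)" by (rule integrable_product_of_squares) (use i in auto)
  have vP: "variance (\<lambda>x. U x + s * V x) = variance U + s\<^sup>2 * variance V" for s
  proof -
    have sq: "(U x + s * V x)\<^sup>2 = (U x)\<^sup>2 + (2 * s * (U x * V x) + s\<^sup>2 * (V x)\<^sup>2)" for x
      by (simp add: power2_eq_square algebra_simps)
    have i2: "integrable M (\<lambda>x. (U x + s * V x)\<^sup>2)" unfolding sq using i iUV by simp
    have "variance (\<lambda>x. U x + s * V x) = expectation (\<lambda>x. (U x + s * V x)\<^sup>2) - (expectation U + s * expectation V)\<^sup>2"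
      using i i2 by (subst variance_eq) auto
    also have "expectation (\<lambda>x. (U x + s * V x)\<^sup>2) =
        expectation (\<lambda>x. (U x)\<^sup>2) + (2 * s * (expectation U * expectation V) + s\<^sup>2 * expectation (\<lambda>x. (V x)\<^sup>2))"
      unfolding sq using i iUV by (simp add: cov)
    also have "\<dots> - (expectation U + s * expectation V)\<^sup>2 =
        (expectation (\<lambda>x. (U x)\<^sup>2) - (expectation U)\<^sup>2) + s\<^sup>2 * (expectation (\<lambda>x. (V x)\<^sup>2) - (expectation V)\<^sup>2)"
      by (simp add: power2_eq_square algebra_simps)
    also have "\<dots> = variance U + s\<^sup>2 * variance V"
      using i by (simp add: variance_eq)
    finally show ?thesis .
  qed
  have c: "cos (U x + al) * cos (V x + be) =
     cos (U x - V x + (al - be)) / 2 + cos (U x + V x + (al + be)) / 2" for x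
    unfolding cos_times_cos by (simp add: algebra_simps add_divide_distrib)
  have v: "variance (\<lambda>x. U x + V x) = variance U + variance V" "variance (\<lambda>x. U x - V x) = variance U + variance V"
    using vP[of 1] vP[of "-1"] by simp_all
  have e: "expectation (\<lambda>x. U x + V x) = expectation U + expectation V"
      "expectation (\<lambda>x. U x - V x) = expectation U - expectation V"
    using i by simp_all
  have "expectation (\<lambda>x. cos (U x + al) * cos (V x + be)) =
     expectation (\<lambda>x. cos (U x - V x + (al - be))) / 2 + expectation (\<lambda>x. cos (U x + V x + (al + be))) / 2"
    unfolding c
    by (subst Bochner_Integration.integral_add) (auto intro!: integrable_bounded_rv[where C=1] order_trans[OF abs_cos_le_one])
  also have "\<dots> = exp (- (variance U + variance V) / 2) * ((cos (expectation U - expectation V + (al - be)) +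
      cos (expectation U + expectation V + (al + be))) / 2)"
    unfolding gaussian_expectation_cos[OF P, unfolded v, unfolded e] gaussian_expectation_cos[OF D, unfolded v, unfolded e]
    by (simp add: field_simps)
  also have "(cos (expectation U - expectation V + (al - be)) + cos (expectation U + expectation V + (al + be))) / 2
    = cos (expectation U + al) * cos (expectation V + be)"
    unfolding cos_times_cos by (simp add: algebra_simps)
  also have "exp (- (variance U + variance V) / 2) = exp (- variance U / 2) * exp (- variance V / 2)"
    by (simp add: exp_add[symmetric] field_simps)
  finally show ?thesis unfolding gaussian_expectation_cos[OF U] gaussian_expectation_cos[OF V] by simp
qed

lemma uncorrelated_sums:
  fixes X :: "'i \<Rightarrow> 'a \<Rightarrow> real" and Y :: "'j \<Rightarrow> 'a \<Rightarrow> real"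
  assumes "\<And>i j. i \<in> K \<Longrightarrow> j \<in> L \<Longrightarrow> integrable M (\<lambda>x. X i x * Y j x)"
    and "\<And>i. i \<in> K \<Longrightarrow> integrable M (X i)" "\<And>j. j \<in> L \<Longrightarrow> integrable M (Y j)"
    and "\<And>i j. i \<in> K \<Longrightarrow> j \<in> L \<Longrightarrow> expectation (\<lambda>x. X i x * Y j x) = expectation (X i) * expectation (Y j)"
  shows "expectation (\<lambda>x. (\<Sum>k\<in>K. c k * X k x) * (\<Sum>l\<in>L. d l * Y l x)) =
    expectation (\<lambda>x. \<Sum>k\<in>K. c k * X k x) * expectation (\<lambda>x. \<Sum>l\<in>L. d l * Y l x)"
proof -
  have "expectation (\<lambda>x. (\<Sum>k\<in>K. c k * X k x) * (\<Sum>l\<in>L. d l * Y l x)) =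
    expectation (\<lambda>x. \<Sum>k\<in>K. \<Sum>l\<in>L. (c k * d l) * (X k x * Y l x))"
    by (simp add: sum_product ac_simps)
  also have "\<dots> = (\<Sum>k\<in>K. \<Sum>l\<in>L. (c k * d l) * expectation (\<lambda>x. X k x * Y l x))"
    using assms by (subst Bochner_Integration.integral_sum) (auto intro!: sum.cong)
  also have "\<dots> = (\<Sum>k\<in>K. \<Sum>l\<in>L. (c k * d l) * (expectation (X k) * expectation (Y l)))"
    using assms by (auto intro!: sum.cong)
  also have "\<dots> = (\<Sum>k\<in>K. c k * expectation (X k)) * (\<Sum>l\<in>L. d l * expectation (Y l))"
    by (simp add: sum_product ac_simps)
  finally show ?thesis using assms by simp
qed

text \<open>
  The criterion \<open>generated_algebra_factorI\<close> is used twice: first the weight is a cosine of the family \<open>Y\<close>,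
  which frees the event \<open>F\<close> of the family \<open>X\<close>; then the weight is the indicator of \<open>F\<close>.
\<close>

theorem gaussian_families_independent:
  fixes X :: "'i \<Rightarrow> 'a \<Rightarrow> real" and Y :: "'j \<Rightarrow> 'a \<Rightarrow> real"
  assumes comb: "\<And>K c L d. finite K \<Longrightarrow> K \<subseteq> I \<Longrightarrow> finite L \<Longrightarrow> L \<subseteq> J \<Longrightarrow>
      gaussian_rv M (\<lambda>x. (\<Sum>k\<in>K. c k * X k x) + (\<Sum>l\<in>L. d l * Y l x))"
    and cov: "\<And>i j. i \<in> I \<Longrightarrow> j \<in> J \<Longrightarrow> expectation (\<lambda>x. X i x * Y j x) = expectation (X i) * expectation (Y j)"
    and F: "F \<in> sets (generated_algebra M I X)" and H: "H \<in> sets (generated_algebra M J Y)"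
  shows "prob (F \<inter> H) = prob F * prob H"
proof -
  have gX: "gaussian_rv M (X i)" if "i \<in> I" for i using comb[of "{i}" "{}" "\<lambda>_. 1"] that by simp
  have gY: "gaussian_rv M (Y i)" if "i \<in> J" for i using comb[of "{}" "{i}" _ "\<lambda>_. 1"] that by simp
  note mX = gaussian_measurable[OF gX] and mY = gaussian_measurable[OF gY]
  have subF: "F \<in> sets M" using F subalgebra_generated_algebra[of I X M M] mX by (auto simp: subalgebra_def)
  have subH: "H \<in> sets M" using H subalgebra_generated_algebra[of J Y M M] mY by (auto simp: subalgebra_def)
  have cosY: "expectation (\<lambda>x. cos ((\<Sum>l\<in>L. d l * Y l x) + be) * indicator F x) =
      expectation (\<lambda>x. cos ((\<Sum>l\<in>L. d l * Y l x) + be)) * prob F" if L: "finite L" "L \<subseteq> J" for L d be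
  proof (rule generated_algebra_factorI[OF mX _ _ _ F, where C=1])
    show "(\<lambda>x. cos ((\<Sum>l\<in>L. d l * Y l x) + be)) \<in> borel_measurable M"
      using mY L by (intro measurable_compose[of "\<lambda>x. _ x + _" M borel cos] borel_measurable_add borel_measurable_sum) auto
    fix K c al assume K: "finite K" "K \<subseteq> I"
    define U where "U x = (\<Sum>k\<in>K. c k * X k x)" for x
    define V where "V x = (\<Sum>l\<in>L. d l * Y l x)" for x
    have "expectation (\<lambda>x. cos (U x + al) * cos (V x + be)) =
      expectation (\<lambda>x. cos (U x + al)) * expectation (\<lambda>x. cos (V x + be))"
    proof (rule gaussian_uncorrelated_cos)
      show "gaussian_rv M U" using comb[OF K, of "{}" c] by (simp add: U_def[abs_def])
      show "gaussian_rv M V" using comb[of "{}" L _ d] L by (simp add: V_def[abs_def])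
      show "gaussian_rv M (\<lambda>x. U x + V x)" using comb[OF K L] by (simp add: U_def V_def)
      show "gaussian_rv M (\<lambda>x. U x - V x)" using comb[OF K L, of c "\<lambda>l. - d l"] by (simp add: U_def V_def sum_negf)
      show "expectation (\<lambda>x. U x * V x) = expectation U * expectation V"
        unfolding U_def[abs_def] V_def[abs_def]
        using K L cov gaussian_integrable[OF gX] gaussian_integrable[OF gY] mX mY
        by (intro uncorrelated_sums integrable_product_of_squares) auto
    qed
    then show "expectation (\<lambda>x. cos ((\<Sum>l\<in>L. d l * Y l x) + be) * cos ((\<Sum>k\<in>K. c k * X k x) + al)) =
       expectation (\<lambda>x. cos ((\<Sum>l\<in>L. d l * Y l x) + be)) * expectation (\<lambda>x. cos ((\<Sum>k\<in>K. c k * X k x) + al))"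
      by (simp add: U_def V_def mult.commute)
  qed auto
  have "expectation (\<lambda>x. indicator F x * indicator H x) = expectation (indicator F) * prob H"
  proof (rule generated_algebra_factorI[OF mY _ _ _ H, where C=1])
    fix L d al assume L: "finite L" "L \<subseteq> J"
    show "expectation (\<lambda>x. indicator F x * cos ((\<Sum>k\<in>L. d k * Y k x) + al)) =
       expectation (indicator F) * expectation (\<lambda>x. cos ((\<Sum>k\<in>L. d k * Y k x) + al))"
      using cosY[OF L, of d al] subF by (simp add: mult.commute)
  qed (use subF in \<open>auto simp: indicator_def\<close>)
  also have "(\<lambda>x. indicator F x * indicator H x :: real) = indicator (F \<inter> H)"
    by (auto simp: indicator_def)
  finally show ?thesis using subF subH by simp
qed

end

context prob_space
begin

section \<open>Smoothing by an independent Gaussian variable\<close>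

text \<open>
  Below, \<open>G\<close> is generated by the path of the bridge outside a time window, and \<open>Z\<close> is the deviation of the
  path from its chord at a time inside the window.
\<close>

definition independent_of :: "'a measure \<Rightarrow> ('a \<Rightarrow> real) \<Rightarrow> bool" where
  "independent_of G Z \<longleftrightarrow> subalgebra M G \<and> Z \<in> borel_measurable M \<and>
     (\<forall>F\<in>sets G. \<forall>A\<in>sets borel. prob (F \<inter> (Z -` A \<inter> space M)) = prob F * prob (Z -` A \<inter> space M))"

text \<open>
  Conditionally on \<open>G\<close>, the pair \<open>(W, R)\<close> is constant and \<open>Z\<close> keeps its density: Tonelli's theorem for the
  product of the laws of \<open>(W, R)\<close> and \<open>Z\<close>.
\<close>

lemma independent_of_nn_integral:
  assumes ind: "independent_of G Z" and D: "distributed M lborel Z g"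
    and W: "W \<in> borel_measurable G" and R: "R \<in> borel_measurable G"
    and ph[measurable]: "ph \<in> borel_measurable borel"
  shows "(\<integral>\<^sup>+x. ennreal (W x) * ph (R x + Z x) \<partial>M) =
         (\<integral>\<^sup>+x. ennreal (W x) * (\<integral>\<^sup>+y. g y * ph (R x + y) \<partial>lborel) \<partial>M)"
proof -
  have sub: "subalgebra M G" and Z[measurable]: "Z \<in> borel_measurable M"
    using ind by (auto simp: independent_of_def)
  have [measurable]: "g \<in> borel_measurable lborel" using D by (simp add: distributed_def)
  let ?WR = "\<lambda>x. (W x, R x)"
  have WRG: "?WR \<in> G \<rightarrow>\<^sub>M borel \<Otimes>\<^sub>M borel" using W R by measurable
  have WR[measurable]: "?WR \<in> M \<rightarrow>\<^sub>M borel \<Otimes>\<^sub>M borel" by (rule measurable_from_subalg[OF sub WRG])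
  have [measurable]: "W \<in> borel_measurable M" "R \<in> borel_measurable M"
    using measurable_from_subalg[OF sub] W R by auto
  have spG: "space G = space M" using sub by (simp add: subalgebra_def)
  interpret Zd: prob_space "distr M borel Z" by (rule prob_space_distr) simp
  interpret WRd: prob_space "distr M (borel \<Otimes>\<^sub>M borel) ?WR" by (rule prob_space_distr) simp
  have eq: "distr M (borel \<Otimes>\<^sub>M borel) ?WR \<Otimes>\<^sub>M distr M borel Z =
      distr M ((borel \<Otimes>\<^sub>M borel) \<Otimes>\<^sub>M borel) (\<lambda>x. (?WR x, Z x))"
  proof (rule pair_measure_eqI)
    fix A :: "(real \<times> real) set" and B :: "real set"
    assume "A \<in> sets (distr M (borel \<Otimes>\<^sub>M borel) ?WR)" "B \<in> sets (distr M borel Z)"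
    then have [measurable]: "A \<in> sets (borel \<Otimes>\<^sub>M borel)" "B \<in> sets borel" by auto
    have "?WR -` A \<inter> space M \<in> sets G" using measurable_sets[OF WRG, of A] spG by simp
    then have "prob ((?WR -` A \<inter> space M) \<inter> (Z -` B \<inter> space M)) = prob (?WR -` A \<inter> space M) * prob (Z -` B \<inter> space M)"
      using ind by (auto simp: independent_of_def)
    moreover have "(\<lambda>x. (?WR x, Z x)) -` (A \<times> B) \<inter> space M = (?WR -` A \<inter> space M) \<inter> (Z -` B \<inter> space M)" by auto
    ultimately show "emeasure (distr M (borel \<Otimes>\<^sub>M borel) ?WR) A * emeasure (distr M borel Z) B =
        emeasure (distr M ((borel \<Otimes>\<^sub>M borel) \<Otimes>\<^sub>M borel) (\<lambda>x. (?WR x, Z x))) (A \<times> B)"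
      by (simp add: emeasure_distr emeasure_eq_measure ennreal_mult[symmetric])
  qed (auto intro: WRd.sigma_finite_measure_axioms Zd.sigma_finite_measure_axioms)
  have Zd: "distr M borel Z = density lborel g"
    using distributed_distr_eq_density[OF D] by (simp cong: distr_cong)
  have "(\<integral>\<^sup>+x. ennreal (W x) * ph (R x + Z x) \<partial>M) =
     (\<integral>\<^sup>+p. ennreal (fst (fst p)) * ph (snd (fst p) + snd p) \<partial>distr M ((borel \<Otimes>\<^sub>M borel) \<Otimes>\<^sub>M borel) (\<lambda>x. (?WR x, Z x)))"
    by (subst nn_integral_distr) auto
  also have "\<dots> = (\<integral>\<^sup>+q. \<integral>\<^sup>+z. ennreal (fst q) * ph (snd q + z) \<partial>distr M borel Z \<partial>distr M (borel \<Otimes>\<^sub>M borel) ?WR)"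
    unfolding eq[symmetric] by (subst Zd.nn_integral_fst[symmetric]) auto
  also have "\<dots> = (\<integral>\<^sup>+x. \<integral>\<^sup>+z. ennreal (W x) * ph (R x + z) \<partial>distr M borel Z \<partial>M)"
    by (subst nn_integral_distr) auto
  also have "\<dots> = (\<integral>\<^sup>+x. ennreal (W x) * (\<integral>\<^sup>+y. g y * ph (R x + y) \<partial>lborel) \<partial>M)"
    unfolding Zd by (intro nn_integral_cong) (simp add: nn_integral_density nn_integral_cmult mult.assoc ac_simps)
  finally show ?thesis .
qed

lemma normal_density_le: "0 < s \<Longrightarrow> normal_density m s x \<le> 1 / (2 * s)"
proof -
  assume s: "0 < s"
  have "4 * s\<^sup>2 \<le> 2 * pi * s\<^sup>2" using pi_ge_two s by (intro mult_right_mono) auto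
  then have "sqrt ((2 * s)\<^sup>2) \<le> sqrt (2 * pi * s\<^sup>2)" by (intro real_sqrt_le_mono) (simp add: power_mult_distrib)
  then have "2 * s \<le> sqrt (2 * pi * s\<^sup>2)" using s by (simp only: real_sqrt_abs)
  then have "1 / sqrt (2 * pi * s\<^sup>2) \<le> 1 / (2 * s)" using s by (intro divide_left_mono) auto
  moreover have "normal_density m s x \<le> 1 / sqrt (2 * pi * s\<^sup>2) * 1"
    unfolding normal_density_def by (intro mult_left_mono) auto
  ultimately show ?thesis by simp
qed

text \<open>
  Relative to the total weight, the density of \<open>R + Z\<close> is at most \<open>1 / (2 * s)\<close>, which bounds the density
  of \<open>Z\<close>; for arguments and values of \<open>R\<close> in \<open>{-K..K}\<close> it is at least the density of \<open>Z\<close> at \<open>2 * K\<close>.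
\<close>

lemma smoothing_upper_bound:
  fixes ph :: "real \<Rightarrow> ennreal"
  assumes ind: "independent_of G Z" and D: "distributed M lborel Z (normal_density 0 s)" and s: "0 < s"
    and W: "W \<in> borel_measurable G" and R: "R \<in> borel_measurable G"
    and ph[measurable]: "ph \<in> borel_measurable borel"
  shows "(\<integral>\<^sup>+x. ennreal (W x) * ph (R x + Z x) \<partial>M) \<le>
         (\<integral>\<^sup>+x. ennreal (W x) \<partial>M) * (ennreal (1 / (2 * s)) * (\<integral>\<^sup>+y. ph y \<partial>lborel))"
proof -
  have sub: "subalgebra M G" using ind by (auto simp: independent_of_def)
  have [measurable]: "W \<in> borel_measurable M" "R \<in> borel_measurable M"
    using measurable_from_subalg[OF sub] W R by auto
  have inner: "(\<integral>\<^sup>+y. ennreal (normal_density 0 s y) * ph (r + y) \<partial>lborel) \<le> ennreal (1 / (2 * s)) * (\<integral>\<^sup>+y. ph y \<partial>lborel)" for r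
  proof -
    have "(\<integral>\<^sup>+y. ennreal (normal_density 0 s y) * ph (r + y) \<partial>lborel) \<le> (\<integral>\<^sup>+y. ennreal (1 / (2 * s)) * ph (r + y) \<partial>lborel)"
      by (intro nn_integral_mono mult_right_mono ennreal_leI normal_density_le s) auto
    also have "\<dots> = ennreal (1 / (2 * s)) * (\<integral>\<^sup>+y. ph y \<partial>lborel)"
      using nn_integral_real_affine[of ph 1 r] by (simp add: nn_integral_cmult)
    finally show ?thesis .
  qed
  show ?thesis
    unfolding independent_of_nn_integral[OF ind D W R ph]
    by (subst nn_integral_multc[symmetric]) (auto intro!: nn_integral_mono mult_left_mono inner)
qed

lemma smoothing_lower_bound:
  fixes ph :: "real \<Rightarrow> ennreal"
  assumes ind: "independent_of G Z" and D: "distributed M lborel Z (normal_density 0 s)" and s: "0 < s"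
    and W: "W \<in> borel_measurable G" and R: "R \<in> borel_measurable G"
    and ph[measurable]: "ph \<in> borel_measurable borel"
    and supp: "\<And>y. ph y \<noteq> 0 \<Longrightarrow> \<bar>y\<bar> \<le> K" "\<And>x. x \<in> space M \<Longrightarrow> W x > 0 \<Longrightarrow> \<bar>R x\<bar> \<le> K"
  shows "(\<integral>\<^sup>+x. ennreal (W x) \<partial>M) * (ennreal (normal_density 0 s (2 * K)) * (\<integral>\<^sup>+y. ph y \<partial>lborel)) \<le>
     (\<integral>\<^sup>+x. ennreal (W x) * ph (R x + Z x) \<partial>M)"
proof -
  have sub: "subalgebra M G" using ind by (auto simp: independent_of_def)
  have [measurable]: "W \<in> borel_measurable M" "R \<in> borel_measurable M"
    using measurable_from_subalg[OF sub] W R by auto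
  have inner: "ennreal (normal_density 0 s (2 * K)) * (\<integral>\<^sup>+y. ph y \<partial>lborel) \<le>
      (\<integral>\<^sup>+y. ennreal (normal_density 0 s y) * ph (r + y) \<partial>lborel)" if r: "\<bar>r\<bar> \<le> K" for r
  proof -
    have "ennreal (normal_density 0 s (2 * K)) * (\<integral>\<^sup>+y. ph y \<partial>lborel) =
      (\<integral>\<^sup>+y. ennreal (normal_density 0 s (2 * K)) * ph (r + y) \<partial>lborel)"
      using nn_integral_real_affine[of ph 1 r] by (simp add: nn_integral_cmult)
    also have "\<dots> \<le> (\<integral>\<^sup>+y. ennreal (normal_density 0 s y) * ph (r + y) \<partial>lborel)"
    proof (rule nn_integral_mono)
      fix y :: real
      show "ennreal (normal_density 0 s (2 * K)) * ph (r + y) \<le> ennreal (normal_density 0 s y) * ph (r + y)"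
      proof (cases "ph (r + y) = 0")
        case False
        then have "\<bar>y\<bar> \<le> \<bar>2 * K\<bar>" using supp(1) r by fastforce
        then have "y\<^sup>2 \<le> (2 * K)\<^sup>2" by (simp only: abs_le_square_iff)
        then have "exp (- (2 * K)\<^sup>2 / (2 * s\<^sup>2)) \<le> exp (- y\<^sup>2 / (2 * s\<^sup>2))"
          unfolding exp_le_cancel_iff minus_divide_left[symmetric] neg_le_iff_le by (rule divide_right_mono) simp
        then have "normal_density 0 s (2 * K) \<le> normal_density 0 s y"
          unfolding normal_density_def by (intro mult_left_mono) auto
        then show ?thesis by (intro mult_right_mono ennreal_leI) auto
      qed simp
    qed
    finally show ?thesis .
  qed
  show ?thesis
    unfolding independent_of_nn_integral[OF ind D W R ph]
  proof (subst nn_integral_multc[symmetric])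
    show "(\<integral>\<^sup>+x. ennreal (W x) * (ennreal (normal_density 0 s (2 * K)) * (\<integral>\<^sup>+y. ph y \<partial>lborel)) \<partial>M)
      \<le> (\<integral>\<^sup>+x. ennreal (W x) * (\<integral>\<^sup>+y. ennreal (normal_density 0 s y) * ph (R x + y) \<partial>lborel) \<partial>M)"
    proof (rule nn_integral_mono)
      fix x assume "x \<in> space M"
      then show "ennreal (W x) * (ennreal (normal_density 0 s (2 * K)) * (\<integral>\<^sup>+y. ph y \<partial>lborel))
         \<le> ennreal (W x) * (\<integral>\<^sup>+y. ennreal (normal_density 0 s y) * ph (R x + y) \<partial>lborel)"
        using inner[of "R x"] supp(2)[of x] by (cases "W x > 0") (auto intro!: mult_left_mono simp: ennreal_neg)
    qed
  qed auto
qed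

text \<open>
  By symmetry both tails have the same probability, and the density bound \<open>1 / (2 * s)\<close> leaves at most
  \<open>x / s\<close> for the interval between them.
\<close>

lemma normal_left_tail:
  assumes D: "distributed M lborel Z (normal_density 0 s)" and s: "0 < s" and x: "0 \<le> x"
  shows "prob {w \<in> space M. Z w \<le> - x} \<ge> 1 / 2 - x / s"
proof -
  have [measurable]: "Z \<in> borel_measurable M" using distributed_measurable[OF D] by simp
  have D': "distributed M lborel (\<lambda>w. - Z w) (normal_density 0 s)"
    using normal_density_affine[OF D s, of "-1" 0] by simp
  have "emeasure M (Z -` {..-x} \<inter> space M) = emeasure M ((\<lambda>w. - Z w) -` {..-x} \<inter> space M)"
    using distributed_emeasure[OF D, of "{..-x}"] distributed_emeasure[OF D', of "{..-x}"] by simp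
  then have sym: "prob {w \<in> space M. Z w \<le> - x} = prob {w \<in> space M. x \<le> Z w}"
    by (simp add: measure_def vimage_def Int_def conj_commute)
  have "emeasure M (Z -` {-x<..<x} \<inter> space M) = (\<integral>\<^sup>+y. ennreal (normal_density 0 s y) * indicator {-x<..<x} y \<partial>lborel)"
    using distributed_emeasure[OF D, of "{-x<..<x}"] by simp
  also have "\<dots> \<le> (\<integral>\<^sup>+y. ennreal (1 / (2 * s)) * indicator {-x<..<x} y \<partial>lborel)"
    by (intro nn_integral_mono mult_right_mono ennreal_leI normal_density_le s) auto
  also have "\<dots> = ennreal (x / s)"
    using x s by (simp add: nn_integral_cmult_indicator ennreal_mult[symmetric])
  finally have "prob (Z -` {-x<..<x} \<inter> space M) \<le> x / s"
    using x s by (simp add: emeasure_eq_measure)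
  then have mid: "prob {w \<in> space M. - x < Z w \<and> Z w < x} \<le> x / s"
    by (simp add: vimage_def Int_def conj_commute)
  have "1 = prob ({w \<in> space M. Z w \<le> - x} \<union> {w \<in> space M. x \<le> Z w} \<union> {w \<in> space M. - x < Z w \<and> Z w < x})"
    by (subst prob_space[symmetric], rule arg_cong[where f=prob]) auto
  also have "\<dots> \<le> prob ({w \<in> space M. Z w \<le> - x} \<union> {w \<in> space M. x \<le> Z w}) + prob {w \<in> space M. - x < Z w \<and> Z w < x}"
    by (rule measure_Un_le) auto
  also have "\<dots> \<le> prob {w \<in> space M. Z w \<le> - x} + prob {w \<in> space M. x \<le> Z w} + prob {w \<in> space M. - x < Z w \<and> Z w < x}"
    by (intro add_right_mono measure_Un_le) auto
  finally have "1 \<le> 2 * prob {w \<in> space M. Z w \<le> - x} + x / s" using sym mid by simp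
  then have "1 / 2 - (x / s) / 2 \<le> prob {w \<in> space M. Z w \<le> - x}" by simp
  moreover have "y / 2 \<le> y" if "0 \<le> y" for y :: real using that by simp
  then have "(x / s) / 2 \<le> x / s" using x s by (meson divide_nonneg_pos)
  ultimately show ?thesis by (meson diff_left_mono order_trans)
qed

section \<open>Substituting a random time; comparing measures\<close>

text \<open>
  If an inequality between two families holds at each deterministic time on each event of \<open>G\<close>, then it
  holds at a random time that is measurable with respect to \<open>G\<close>. The random time is rounded down to a
  grid of mesh \<open>1 / (n + 1)\<close>, where the hypothesis applies cell by cell; continuity and dominated
  convergence remove the rounding.
\<close>

lemma random_time_substitution:
  fixes X Z :: "real \<Rightarrow> 'a \<Rightarrow> real" and dl :: "'a \<Rightarrow> real"
  assumes sub: "subalgebra M G" and dl: "dl \<in> borel_measurable G"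
    and rng: "\<And>w. w \<in> space M \<Longrightarrow> dl w \<in> {a..b}"
    and Xm: "\<And>d. d \<in> {a..b} \<Longrightarrow> X d \<in> borel_measurable M" and Zm: "\<And>d. d \<in> {a..b} \<Longrightarrow> Z d \<in> borel_measurable M"
    and Xb: "\<And>d w. d \<in> {a..b} \<Longrightarrow> w \<in> space M \<Longrightarrow> \<bar>X d w\<bar> \<le> C" and Zb: "\<And>d w. d \<in> {a..b} \<Longrightarrow> w \<in> space M \<Longrightarrow> \<bar>Z d w\<bar> \<le> C"
    and Xc: "\<And>w. w \<in> space M \<Longrightarrow> continuous_on {a..b} (\<lambda>d. X d w)" and Zc: "\<And>w. w \<in> space M \<Longrightarrow> continuous_on {a..b} (\<lambda>d. Z d w)"
    and le: "\<And>E d. E \<in> sets G \<Longrightarrow> d \<in> {a..b} \<Longrightarrow>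
       expectation (\<lambda>w. indicator E w * X d w) \<le> expectation (\<lambda>w. indicator E w * Z d w)"
  shows "expectation (\<lambda>w. X (dl w) w) \<le> expectation (\<lambda>w. Z (dl w) w)"
proof -
  define ka where "ka n w = nat \<lfloor>real (Suc n) * (dl w - a)\<rfloor>" for n w
  define q where "q n k = a + real k / real (Suc n)" for n k
  define K where "K n = {k. q n k \<le> b}" for n
  define E where "E n k = {w \<in> space M. ka n w = k}" for n k
  have spG: "space G = space M" and GM: "sets G \<subseteq> sets M" using sub by (auto simp: subalgebra_def)
  have EG: "E n k \<in> sets G" for n k
  proof -
    have "(\<lambda>w. ka n w) \<in> measurable G (count_space UNIV)"
      unfolding ka_def using dl by measurable
    then have "ka n -` {k} \<inter> space G \<in> sets G" by (rule measurable_sets) simp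
    also have "ka n -` {k} \<inter> space G = E n k" by (auto simp: E_def spG)
    finally show ?thesis .
  qed
  have EM[measurable]: "E n k \<in> sets M" for n k using EG GM by auto
  have finK: "finite (K n)" for n
  proof (rule finite_subset)
    show "K n \<subseteq> {..nat \<lceil>(b - a) * real (Suc n)\<rceil>}"
    proof
      fix k assume "k \<in> K n"
      then have "real k / real (Suc n) \<le> b - a" by (simp add: K_def q_def)
      then have "real k \<le> (b - a) * real (Suc n)" by (simp add: field_simps)
      then show "k \<in> {..nat \<lceil>(b - a) * real (Suc n)\<rceil>}" by (simp add: le_nat_iff) linarith
    qed
  qed simp
  have q_ge: "a \<le> q n k" for n k by (simp add: q_def)
  have qdl: "q n (ka n w) \<le> dl w" "dl w - 1 / real (Suc n) \<le> q n (ka n w)" if "w \<in> space M" for n w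
  proof -
    have nn: "0 \<le> real (Suc n) * (dl w - a)" using rng[OF that] by simp
    then have r: "real (ka n w) = of_int \<lfloor>real (Suc n) * (dl w - a)\<rfloor>" unfolding ka_def by simp
    have "real (ka n w) \<le> real (Suc n) * (dl w - a)" unfolding r by linarith
    then have "real (ka n w) / real (Suc n) \<le> dl w - a" by (simp add: field_simps)
    then show "q n (ka n w) \<le> dl w" by (simp add: q_def)
    have "real (Suc n) * (dl w - a) - 1 \<le> real (ka n w)" unfolding r by linarith
    then have "(real (Suc n) * (dl w - a) - 1) / real (Suc n) \<le> real (ka n w) / real (Suc n)"
      by (rule divide_right_mono) simp
    then show "dl w - 1 / real (Suc n) \<le> q n (ka n w)" by (simp add: q_def diff_divide_distrib)
  qed
  have kaK: "ka n w \<in> K n" if "w \<in> space M" for n w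
    using qdl(1)[OF that, of n] rng[OF that] by (simp add: K_def)
  have qlim: "(\<lambda>n. q n (ka n w)) \<longlonglongrightarrow> dl w" if w: "w \<in> space M" for w
  proof (rule tendsto_sandwich)
    show "(\<lambda>n. dl w - 1 / real (Suc n)) \<longlonglongrightarrow> dl w"
      using tendsto_diff[OF tendsto_const[of "dl w"] LIMSEQ_inverse_real_of_nat] by (simp add: inverse_eq_divide)
  qed (use qdl[OF w] in auto)
  have sumY: "Y (q n (ka n w)) w = (\<Sum>k\<in>K n. indicator (E n k) w * Y (q n k) w)" if w: "w \<in> space M"
    for Y :: "real \<Rightarrow> 'a \<Rightarrow> real" and n w
  proof -
    have "(\<Sum>k\<in>K n. indicator (E n k) w * Y (q n k) w) = (\<Sum>k\<in>K n. if k = ka n w then Y (q n k) w else 0)"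
      by (rule sum.cong) (use w in \<open>auto simp: E_def indicator_def\<close>)
    then show ?thesis using kaK[OF w] finK by simp
  qed
  have main: "(\<lambda>n. expectation (\<lambda>w. Y (q n (ka n w)) w)) \<longlonglongrightarrow> expectation (\<lambda>w. Y (dl w) w)"
     "expectation (\<lambda>w. Y (q n (ka n w)) w) = (\<Sum>k\<in>K n. expectation (\<lambda>w. indicator (E n k) w * Y (q n k) w))"
    if Ym: "\<And>d. d \<in> {a..b} \<Longrightarrow> Y d \<in> borel_measurable M" and Yb: "\<And>d w. d \<in> {a..b} \<Longrightarrow> w \<in> space M \<Longrightarrow> \<bar>Y d w\<bar> \<le> C"
      and Yc: "\<And>w. w \<in> space M \<Longrightarrow> continuous_on {a..b} (\<lambda>d. Y d w)" for Y n
  proof -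
    have qK: "q n k \<in> {a..b}" if "k \<in> K n" for n k using that q_ge by (auto simp: K_def)
    have Ynm: "(\<lambda>w. Y (q n (ka n w)) w) \<in> borel_measurable M" for n
      by (subst measurable_cong[OF sumY]) (auto intro!: borel_measurable_sum borel_measurable_times Ym qK)
    have lim: "(\<lambda>n. Y (q n (ka n w)) w) \<longlonglongrightarrow> Y (dl w) w" if w: "w \<in> space M" for w
    proof (rule continuous_on_tendsto_compose[OF Yc[OF w] qlim[OF w] rng[OF w]])
      show "\<forall>\<^sub>F n in sequentially. q n (ka n w) \<in> {a..b}" using qK kaK[OF w] by auto
    qed
    have Ym': "(\<lambda>w. Y (dl w) w) \<in> borel_measurable M"
      by (rule borel_measurable_LIMSEQ_real[OF lim Ynm])
    show "(\<lambda>n. expectation (\<lambda>w. Y (q n (ka n w)) w)) \<longlonglongrightarrow> expectation (\<lambda>w. Y (dl w) w)"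
    proof (rule integral_dominated_convergence[where w="\<lambda>_. C"])
      show "AE w in M. norm (Y (q n (ka n w)) w) \<le> C" for n
        using Yb qK kaK by (intro AE_I2) auto
    qed (use Ynm Ym' lim in auto)
    have "expectation (\<lambda>w. Y (q n (ka n w)) w) = expectation (\<lambda>w. \<Sum>k\<in>K n. indicator (E n k) w * Y (q n k) w)"
      by (rule Bochner_Integration.integral_cong[OF refl sumY])
    also have "\<dots> = (\<Sum>k\<in>K n. expectation (\<lambda>w. indicator (E n k) w * Y (q n k) w))"
    proof (rule Bochner_Integration.integral_sum)
      fix k assume "k \<in> K n"
      show "integrable M (\<lambda>w. indicator (E n k) w * Y (q n k) w)"
      proof (rule integrable_bounded_rv[where C=C])
        fix w assume w: "w \<in> space M"
        have "\<bar>Y (q n k) w\<bar> \<le> C" using Yb[OF qK w] \<open>k \<in> K n\<close> by auto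
        then show "\<bar>indicator (E n k) w * Y (q n k) w\<bar> \<le> C" by (auto simp: indicator_def)
      qed (use Ym[OF qK[OF \<open>k \<in> K n\<close>]] in measurable)
    qed
    finally show "expectation (\<lambda>w. Y (q n (ka n w)) w) = (\<Sum>k\<in>K n. expectation (\<lambda>w. indicator (E n k) w * Y (q n k) w))" .
  qed
  show ?thesis
  proof (rule LIMSEQ_le[OF main(1)[of X, OF Xm Xb Xc] main(1)[of Z, OF Zm Zb Zc]])
    have "expectation (\<lambda>w. X (q n (ka n w)) w) \<le> expectation (\<lambda>w. Z (q n (ka n w)) w)" for n
      unfolding main(2)[of X, OF Xm Xb Xc, simplified] main(2)[of Z, OF Zm Zb Zc, simplified]
      by (intro sum_mono le EG) (auto simp: K_def q_ge)
    then show "\<exists>N. \<forall>n\<ge>N. expectation (\<lambda>w. X (q n (ka n w)) w) \<le> expectation (\<lambda>w. Z (q n (ka n w)) w)" by blast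
  qed auto
qed

end

text \<open>
  Continuous functions increase to the indicator of an open set, and outer regularity passes from open
  sets to Borel sets. Estimates at a random time need continuous test functions; this lemma turns them
  into statements about measures.
\<close>

lemma measure_le_if_continuous_le:
  fixes mu nu :: "real measure" and l u :: real
  assumes sm: "sets mu = sets borel" and sn: "sets nu = sets borel" and fn: "finite_measure nu"
    and le: "\<And>ph. continuous_on UNIV ph \<Longrightarrow> (\<And>x. 0 \<le> ph x) \<Longrightarrow> (\<And>x. ph x \<le> 1) \<Longrightarrow> (\<And>x. x \<notin> {l<..<u} \<Longrightarrow> ph x = 0) \<Longrightarrow>
      (\<integral>\<^sup>+x. ennreal (ph x) \<partial>mu) \<le> (\<integral>\<^sup>+x. ennreal (ph x) \<partial>nu)"
    and A: "A \<in> sets borel" "A \<subseteq> {l<..<u}"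
  shows "emeasure mu A \<le> emeasure nu A"
proof -
  interpret nu: finite_measure nu by fact
  have op: "emeasure mu U \<le> emeasure nu U" if U: "open U" "U \<subseteq> {l<..<u}" for U
  proof -
    define ph where "ph n x = min 1 (real n * infdist x (- U))" for n x
    have ne: "- U \<noteq> {}" using U by (metis Compl_UNIV_eq UNIV_I double_compl greaterThanLessThan_iff less_irrefl subsetD)
    have c: "continuous_on UNIV (ph n)" for n unfolding ph_def by (intro continuous_intros)
    have m[measurable]: "ph n \<in> borel_measurable borel" for n using c by (rule borel_measurable_continuous_onI)
    have sup: "(SUP n. ennreal (ph n x)) = indicator U x" for x
    proof (cases "x \<in> U")
      case True
      then have "infdist x (- U) > 0"
        using ne U infdist_pos_not_in_closed[of "- U" x] by auto
      then obtain n where "1 < real n * infdist x (- U)" using ex_less_of_nat_mult by blast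
      then have "ph n x = 1" by (simp add: ph_def)
      show ?thesis
      proof (rule antisym)
        show "(SUP n. ennreal (ph n x)) \<le> indicator U x" using True by (auto intro!: SUP_least simp: ph_def)
        show "indicator U x \<le> (SUP n. ennreal (ph n x))"
          using True \<open>ph n x = 1\<close> by (intro SUP_upper2[of n]) auto
      qed
    next
      case False
      then have "infdist x (- U) = 0" using infdist_zero by auto
      then show ?thesis using False by (simp add: ph_def)
    qed
    have inc: "incseq (\<lambda>n x. ennreal (ph n x))"
      by (auto simp: incseq_def le_fun_def ph_def intro!: ennreal_leI min.mono mult_right_mono infdist_nonneg)
    have conv: "(SUP n. \<integral>\<^sup>+x. ennreal (ph n x) \<partial>N) = emeasure N U" if s: "sets N = sets borel" for N
    proof -
      have [measurable]: "ph n \<in> borel_measurable N" for n using m s by (simp cong: measurable_cong_sets)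
      have "(SUP n. \<integral>\<^sup>+x. ennreal (ph n x) \<partial>N) = (\<integral>\<^sup>+x. (SUP n. ennreal (ph n x)) \<partial>N)"
        by (rule nn_integral_monotone_convergence_SUP[symmetric, OF inc]) measurable
      also have "\<dots> = emeasure N U" unfolding sup using U s by simp
      finally show ?thesis .
    qed
    have "(SUP n. \<integral>\<^sup>+x. ennreal (ph n x) \<partial>mu) \<le> (SUP n. \<integral>\<^sup>+x. ennreal (ph n x) \<partial>nu)"
    proof (intro SUP_mono' le c)
      fix n x assume "x \<notin> {l<..<u}"
      then have "x \<in> - U" using U by auto
      then show "ph n x = 0" by (simp add: ph_def)
    qed (auto simp: ph_def infdist_nonneg)
    then show ?thesis by (simp add: conv sm sn)
  qed
  have "emeasure nu A = (INF U \<in> {U. A \<subseteq> U \<and> open U}. emeasure nu U)"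
    by (rule outer_regular) (use sn A nu.emeasure_finite in auto)
  also have "\<dots> \<ge> emeasure mu A"
  proof (rule INF_greatest)
    fix U assume U: "U \<in> {U. A \<subseteq> U \<and> open U}"
    have "emeasure mu A \<le> emeasure mu (U \<inter> {l<..<u})" using U A sm by (intro emeasure_mono) auto
    also have "\<dots> \<le> emeasure nu (U \<inter> {l<..<u})" using U by (intro op) auto
    also have "\<dots> \<le> emeasure nu U" using U sn by (intro emeasure_mono) auto
    finally show "emeasure mu A \<le> emeasure nu U" .
  qed
  finally show ?thesis .
qed

section \<open>The first minimum of a continuous path\<close>

definition first_argmin_on :: "real \<Rightarrow> real \<Rightarrow> (real \<Rightarrow> real) \<Rightarrow> real" where
  "first_argmin_on p q f = Inf {t \<in> {p..q}. \<forall>s\<in>{p..q}. f t \<le> f s}"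

definition min_on :: "real \<Rightarrow> real \<Rightarrow> (real \<Rightarrow> real) \<Rightarrow> real" where
  "min_on p q f = f (first_argmin_on p q f)"

lemma first_argmin_eq: "first_argmin f = first_argmin_on 0 1 f"
  by (simp add: first_argmin_def first_argmin_on_def)

lemma
  assumes "p \<le> q" and c: "continuous_on {p..q} f"
  shows first_argmin_on_mem: "first_argmin_on p q f \<in> {p..q}"
    and min_on_le: "s \<in> {p..q} \<Longrightarrow> min_on p q f \<le> f s"
    and min_on_less: "\<lbrakk>p \<le> s; s < first_argmin_on p q f\<rbrakk> \<Longrightarrow> min_on p q f < f s"
proof -
  define S where "S = {t \<in> {p..q}. \<forall>s\<in>{p..q}. f t \<le> f s}"
  have "{p..q} \<noteq> {}" using assms by auto
  then have ne: "S \<noteq> {}"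
    using continuous_attains_inf[OF compact_Icc _ c] by (auto simp: S_def)
  have bdd: "bdd_below S" by (rule bdd_belowI[of _ p]) (auto simp: S_def)
  have "closed S"
  proof -
    obtain t0 where t0: "t0 \<in> S" using ne by auto
    have "S = {t \<in> {p..q}. f t \<le> f t0}"
    proof (intro set_eqI iffI)
      fix t assume "t \<in> {t \<in> {p..q}. f t \<le> f t0}"
      then have t: "t \<in> {p..q}" "f t \<le> f t0" by auto
      have "f t \<le> f s" if "s \<in> {p..q}" for s
        using t(2) t0 that unfolding S_def by (blast intro: order_trans)
      then show "t \<in> S" using t(1) unfolding S_def by blast
    qed (use t0 in \<open>auto simp: S_def\<close>)
    moreover have "closed {t \<in> {p..q}. f t \<le> f t0}"
    proof -
      have "closed ({p..q} \<inter> f -` {..f t0})" by (rule continuous_closed_preimage[OF c]) auto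
      also have "{p..q} \<inter> f -` {..f t0} = {t \<in> {p..q}. f t \<le> f t0}" by auto
      finally show ?thesis .
    qed
    ultimately show ?thesis by simp
  qed
  then have mem: "first_argmin_on p q f \<in> S"
    unfolding first_argmin_on_def S_def[symmetric] using closed_contains_Inf[OF ne bdd] by simp
  then show *: "first_argmin_on p q f \<in> {p..q}" by (simp add: S_def)
  show le: "min_on p q f \<le> f s" if "s \<in> {p..q}" for s using mem that by (auto simp: S_def min_on_def)
  show "min_on p q f < f s" if "p \<le> s" "s < first_argmin_on p q f"
  proof (rule ccontr)
    assume "\<not> min_on p q f < f s"
    then have fs: "f s \<le> min_on p q f" by simp
    have "f s \<le> f s'" if "s' \<in> {p..q}" for s' using fs le[OF that] by (rule order_trans)
    then have "s \<in> S" using that * by (auto simp: S_def)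
    then have "first_argmin_on p q f \<le> s"
      unfolding first_argmin_on_def S_def[symmetric] using bdd by (rule cInf_lower)
    then show False using that by simp
  qed
qed

lemma first_argmin_on_eqI:
  assumes "p \<le> q" "continuous_on {p..q} f" and "t \<in> {p..q}" "\<And>s. s \<in> {p..q} \<Longrightarrow> f t \<le> f s"
    and "\<And>s. p \<le> s \<Longrightarrow> s < t \<Longrightarrow> f t < f s"
  shows "first_argmin_on p q f = t"
proof (rule antisym)
  show "first_argmin_on p q f \<le> t"
  proof (rule ccontr)
    assume "\<not> first_argmin_on p q f \<le> t"
    then have "min_on p q f < f t" using assms(3) by (intro min_on_less[OF assms(1,2)]) auto
    moreover have "f t \<le> min_on p q f"
      unfolding min_on_def by (rule assms(4)[OF first_argmin_on_mem[OF assms(1,2)]])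
    ultimately show False by simp
  qed
  show "t \<le> first_argmin_on p q f"
  proof (rule ccontr)
    assume "\<not> t \<le> first_argmin_on p q f"
    then have "f t < min_on p q f"
      unfolding min_on_def using first_argmin_on_mem[OF assms(1,2)] by (intro assms(5)) auto
    then show False using min_on_le[OF assms(1,2,3)] by simp
  qed
qed

text \<open>
  By continuity it suffices to test the condition on the countably many points that divide the interval
  in a rational ratio.
\<close>

lemma closed_path_event:
  fixes Y :: "real \<Rightarrow> 'a \<Rightarrow> real"
  assumes cont: "\<And>w. w \<in> space G \<Longrightarrow> continuous_on {p..q} (\<lambda>u. Y u w)"
    and meas: "\<And>u. u \<in> {p..q} \<Longrightarrow> Y u \<in> borel_measurable G" and h: "h \<in> borel_measurable G"
  shows "{w \<in> space G. \<forall>u\<in>{p..q}. h w \<le> Y u w} \<in> sets G"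
proof (cases "p \<le> q")
  case True
  define D where "D = {p + (q - p) * (real k / real (Suc n)) | k n. k \<le> Suc n}"
  have "D = (\<lambda>(k, n). p + (q - p) * (real k / real (Suc n))) ` {(k, n). k \<le> Suc n}" by (auto simp: D_def)
  then have cD: "countable D" by simp
  have Dsub: "D \<subseteq> {p..q}"
  proof
    fix u assume "u \<in> D"
    then obtain k n where u: "u = p + (q - p) * (real k / real (Suc n))" "k \<le> Suc n" by (auto simp: D_def)
    have "real k / real (Suc n) \<le> 1" using u(2) by (simp add: field_simps)
    then have "(q - p) * (real k / real (Suc n)) \<le> (q - p) * 1" using True by (intro mult_left_mono) auto
    moreover have "0 \<le> (q - p) * (real k / real (Suc n))" using True by simp
    ultimately show "u \<in> {p..q}" unfolding u by auto
  qed
  have Dne: "D \<noteq> {}" unfolding D_def by blast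
  have dense: "h w \<le> Y u w" if w: "w \<in> space G" and D: "\<forall>u\<in>D. h w \<le> Y u w" and u: "u \<in> {p..q}" for u w
  proof (cases "p = q")
    case True
    have "p + (q - p) * (real 0 / real (Suc 0)) \<in> D" unfolding D_def by blast
    then show ?thesis using D u True by auto
  next
    case False
    define x where "x = (u - p) / (q - p)"
    have x: "0 \<le> x" "x \<le> 1" "u = p + (q - p) * x" using u False by (auto simp: x_def field_simps)
    define k where "k n = nat \<lfloor>real (Suc n) * x\<rfloor>" for n
    have kr: "real (k n) = of_int \<lfloor>real (Suc n) * x\<rfloor>" for n using x by (simp add: k_def)
    have lim: "(\<lambda>n. real (k n) / real (Suc n)) \<longlonglongrightarrow> x"
    proof (rule tendsto_sandwich)
      show "(\<lambda>n. x - 1 / real (Suc n)) \<longlonglongrightarrow> x"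
        using tendsto_diff[OF tendsto_const[of x] LIMSEQ_inverse_real_of_nat] by (simp add: inverse_eq_divide)
      have "(real (Suc n) * x - 1) / real (Suc n) \<le> real (k n) / real (Suc n)" for n
        unfolding kr by (rule divide_right_mono) linarith+
      then show "\<forall>\<^sub>F n in sequentially. x - 1 / real (Suc n) \<le> real (k n) / real (Suc n)"
        by (simp add: diff_divide_distrib)
      have "real (k n) / real (Suc n) \<le> (real (Suc n) * x) / real (Suc n)" for n
        unfolding kr by (rule divide_right_mono) linarith+
      then show "\<forall>\<^sub>F n in sequentially. real (k n) / real (Suc n) \<le> x" by simp
    qed simp
    have "k n \<le> Suc n" for n
    proof -
      have "real (Suc n) * x \<le> real (Suc n) * 1" using x by (intro mult_left_mono) auto
      then have "real (k n) \<le> real (Suc n)" unfolding kr by (metis mult_1_right of_int_floor_le order_trans)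
      then show ?thesis by simp
    qed
    then have uD: "p + (q - p) * (real (k n) / real (Suc n)) \<in> D" for n by (auto simp: D_def)
    have "(\<lambda>n. p + (q - p) * (real (k n) / real (Suc n))) \<longlonglongrightarrow> u"
      unfolding x(3) by (intro tendsto_intros lim)
    then have "(\<lambda>n. Y (p + (q - p) * (real (k n) / real (Suc n))) w) \<longlonglongrightarrow> Y u w"
      by (rule continuous_on_tendsto_compose[OF cont[OF w] _ u])
        (intro always_eventually allI subsetD[OF Dsub] uD)
    then show ?thesis by (rule LIMSEQ_le_const) (use D uD in auto)
  qed
  have "{w \<in> space G. \<forall>u\<in>{p..q}. h w \<le> Y u w} = {w \<in> space G. \<forall>u\<in>D. h w \<le> Y u w}"
    using dense Dsub by blast
  also have "\<dots> = (\<Inter>u\<in>D. {w \<in> space G. h w \<le> Y u w})" using Dne by auto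
  also have "\<dots> \<in> sets G"
    using Dsub by (intro sets.countable_INT'[OF cD Dne] image_subsetI borel_measurable_le meas h) auto
  finally show ?thesis .
qed simp

lemma min_on_measurable:
  fixes Y :: "real \<Rightarrow> 'a \<Rightarrow> real"
  assumes cont: "\<And>w. w \<in> space G \<Longrightarrow> continuous_on {p..q} (\<lambda>u. Y u w)"
    and meas: "\<And>u. u \<in> {p..q} \<Longrightarrow> Y u \<in> borel_measurable G" and pq: "p \<le> q"
  shows "(\<lambda>w. min_on p q (\<lambda>u. Y u w)) \<in> borel_measurable G"
proof (subst borel_measurable_iff_ge, intro allI)
  fix c :: real
  have "{w \<in> space G. c \<le> min_on p q (\<lambda>u. Y u w)} = {w \<in> space G. \<forall>u\<in>{p..q}. c \<le> Y u w}"
    using min_on_le[OF pq cont] first_argmin_on_mem[OF pq cont]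
    by (fastforce simp: min_on_def intro: order_trans)
  then show "{w \<in> space G. c \<le> min_on p q (\<lambda>u. Y u w)} \<in> sets G"
    using closed_path_event[of G p q Y "\<lambda>_. c", OF cont meas] by simp
qed

text \<open>
  The first minimum is attained by time \<open>c\<close> iff the minimum over \<open>{p..c}\<close> is as small as the minimum over
  \<open>{p..q}\<close>.
\<close>

lemma first_argmin_on_measurable:
  fixes Y :: "real \<Rightarrow> 'a \<Rightarrow> real"
  assumes cont: "\<And>w. w \<in> space G \<Longrightarrow> continuous_on {p..q} (\<lambda>u. Y u w)"
    and meas: "\<And>u. u \<in> {p..q} \<Longrightarrow> Y u \<in> borel_measurable G" and pq: "p \<le> q"
  shows "(\<lambda>w. first_argmin_on p q (\<lambda>u. Y u w)) \<in> borel_measurable G"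
proof (subst borel_measurable_iff_le, intro allI)
  fix c :: real
  consider "c < p" | "q \<le> c" | "p \<le> c" "c < q" by linarith
  then show "{w \<in> space G. first_argmin_on p q (\<lambda>u. Y u w) \<le> c} \<in> sets G"
  proof cases
    case 1
    then have "{w \<in> space G. first_argmin_on p q (\<lambda>u. Y u w) \<le> c} = {}"
      using first_argmin_on_mem[OF pq cont] by fastforce
    then show ?thesis by (simp only: sets.empty_sets)
  next
    case 2
    then have "{w \<in> space G. first_argmin_on p q (\<lambda>u. Y u w) \<le> c} = space G"
      using first_argmin_on_mem[OF pq cont] by fastforce
    then show ?thesis by (simp only: sets.top)
  next
    case 3
    have cc: "continuous_on {p..c} (\<lambda>u. Y u w)" if "w \<in> space G" for w
      using cont[OF that] by (rule continuous_on_subset) (use 3 in auto)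
    have "{w \<in> space G. first_argmin_on p q (\<lambda>u. Y u w) \<le> c} =
      {w \<in> space G. min_on p c (\<lambda>u. Y u w) \<le> min_on p q (\<lambda>u. Y u w)}" (is "?L = ?R")
    proof (intro set_eqI iffI)
      fix w assume "w \<in> ?L"
      then have w: "w \<in> space G" "first_argmin_on p q (\<lambda>u. Y u w) \<le> c" by auto
      have "min_on p c (\<lambda>u. Y u w) \<le> Y (first_argmin_on p q (\<lambda>u. Y u w)) w"
        by (rule min_on_le[OF \<open>p \<le> c\<close> cc[OF w(1)]]) (use w first_argmin_on_mem[OF pq cont[OF w(1)]] in auto)
      then show "w \<in> ?R" using w by (simp add: min_on_def)
    next
      fix w assume "w \<in> ?R"
      then have w: "w \<in> space G" "min_on p c (\<lambda>u. Y u w) \<le> min_on p q (\<lambda>u. Y u w)" by auto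
      have "first_argmin_on p q (\<lambda>u. Y u w) \<le> first_argmin_on p c (\<lambda>u. Y u w)"
        using min_on_less[OF pq cont[OF w(1)], of "first_argmin_on p c (\<lambda>u. Y u w)"] w(2)
          first_argmin_on_mem[OF \<open>p \<le> c\<close> cc[OF w(1)]]
        by (fastforce simp: min_on_def)
      then show "w \<in> ?L" using w first_argmin_on_mem[OF \<open>p \<le> c\<close> cc[OF w(1)]] by auto
    qed
    moreover have "?R \<in> sets G"
      using 3 by (intro borel_measurable_le min_on_measurable cc cont meas) auto
    ultimately show ?thesis by simp
  qed
qed

section \<open>The bridge inside and outside a time window\<close>

lemma sets_generated_algebra_mono:
  "I \<subseteq> J \<Longrightarrow> sets (generated_algebra M I X) \<subseteq> sets (generated_algebra M J X)"
  unfolding sets_generated_algebra by (rule sigma_sets_mono') auto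

locale bridge =
  fixes M :: "'a measure" and B :: "real \<Rightarrow> 'a \<Rightarrow> real" and lam :: real
  assumes lam_neg: "lam < 0" and br: "brownian_bridge M lam B"
begin

sublocale prob_space M using br by (simp add: brownian_bridge_def)

lemma paths:
  assumes "w \<in> space M"
  shows B_cont: "continuous_on {0..1} (\<lambda>t. B t w)" and B_0: "B 0 w = 0"
  using br assms by (auto simp: brownian_bridge_def)

lemma B_cont_on: "w \<in> space M \<Longrightarrow> 0 \<le> p \<Longrightarrow> q \<le> 1 \<Longrightarrow> continuous_on {p..q} (\<lambda>t. B t w)"
  by (rule continuous_on_subset[OF B_cont]) auto

lemma B_gaussian: "finite J \<Longrightarrow> J \<subseteq> {0..1} \<Longrightarrow> gaussian_rv M (\<lambda>w. \<Sum>t\<in>J. c t * B t w)"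
  using br by (auto simp: brownian_bridge_def gaussian_process_def)

lemma B_gaussian1: "t \<in> {0..1} \<Longrightarrow> gaussian_rv M (B t)"
  using B_gaussian[of "{t}" "\<lambda>_. 1"] by simp

lemma B_measurable: "t \<in> {0..1} \<Longrightarrow> B t \<in> borel_measurable M"
  using gaussian_measurable[OF B_gaussian1] .

lemma B_integrable: "t \<in> {0..1} \<Longrightarrow> integrable M (B t)"
  using gaussian_integrable[OF B_gaussian1] by auto

lemma BB_integrable: "t \<in> {0..1} \<Longrightarrow> s \<in> {0..1} \<Longrightarrow> integrable M (\<lambda>w. B t w * B s w)"
  using gaussian_integrable[OF B_gaussian1] B_measurable by (intro integrable_product_of_squares) auto

lemma B_expectation: "t \<in> {0..1} \<Longrightarrow> expectation (B t) = lam * t"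
  using br by (simp add: brownian_bridge_def)

lemma B_moment:
  assumes "0 \<le> s" "s \<le> t" "t \<le> 1"
  shows "expectation (\<lambda>w. B s w * B t w) = s * (1 - t) + lam\<^sup>2 * s * t"
proof -
  have st: "s \<in> {0..1}" "t \<in> {0..1}" using assms by auto
  have "s * (1 - t) = expectation (\<lambda>w. (B s w - lam * s) * (B t w - lam * t))"
    using br assms by (simp add: brownian_bridge_def)
  also have "\<dots> = expectation (\<lambda>w. B s w * B t w - (lam * t * B s w + lam * s * B t w) + lam\<^sup>2 * s * t)"
    by (simp add: algebra_simps power2_eq_square)
  also have "\<dots> = expectation (\<lambda>w. B s w * B t w) - (lam * t * (lam * s) + lam * s * (lam * t)) + lam\<^sup>2 * s * t"
    using st BB_integrable B_integrable by (simp add: B_expectation prob_space)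
  finally show ?thesis by (simp add: algebra_simps power2_eq_square)
qed

lemma B_1: "AE w in M. B 1 w = lam"
proof -
  have m: "expectation (B 1) = lam" using B_expectation[of 1] by simp
  have i: "integrable M (B 1)" "integrable M (\<lambda>w. (B 1 w)\<^sup>2)"
    using gaussian_integrable[OF B_gaussian1[of 1]] by auto
  have "expectation (\<lambda>w. (B 1 w - lam)\<^sup>2) = variance (B 1)" using m by simp
  also have "\<dots> = 0"
    by (subst variance_eq[OF i]) (use B_moment[of 1 1] m in \<open>simp add: power2_eq_square\<close>)
  finally have "expectation (\<lambda>w. (B 1 w - lam)\<^sup>2) = 0" .
  moreover have "integrable M (\<lambda>w. (B 1 w - lam)\<^sup>2)" using i by (simp add: power2_diff)
  ultimately have "AE w in M. (B 1 w - lam)\<^sup>2 = 0"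
    by (subst (asm) integral_nonneg_eq_0_iff_AE) (simp_all only: zero_le_power2 AE_I2)
  then show ?thesis by simp
qed

text \<open>
  A window \<open>{a..b}\<close> splits the path into the part that \<open>outer a b\<close> describes and the deviation \<open>dev a b\<close>
  from the chord between the values at \<open>a\<close> and \<open>b\<close>.
\<close>

definition outer :: "real \<Rightarrow> real \<Rightarrow> 'a measure" where
  "outer a b = generated_algebra M ({0..a} \<union> {b..1}) B"

definition dev :: "real \<Rightarrow> real \<Rightarrow> real \<Rightarrow> 'a \<Rightarrow> real" where
  "dev a b u w = B u w - ((b - u) * B a w + (u - a) * B b w) / (b - a)"

definition inner_alg :: "real \<Rightarrow> real \<Rightarrow> 'a measure" where
  "inner_alg a b = generated_algebra M {a..b} (dev a b)"

text \<open>
  The linear span of the values of the process; the defining property of a Gaussian process speaks about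
  its elements.
\<close>

definition lin :: "('a \<Rightarrow> real) \<Rightarrow> bool" where
  "lin G \<longleftrightarrow> (\<exists>J c. finite J \<and> J \<subseteq> {0..1} \<and> G = (\<lambda>w. \<Sum>t\<in>J. c t * B t w))"

lemma lin_B: "t \<in> {0..1} \<Longrightarrow> lin (B t)"
  unfolding lin_def by (intro exI[of _ "{t}"] exI[of _ "\<lambda>_. 1"]) auto

lemma lin_scale: "lin G \<Longrightarrow> lin (\<lambda>w. c * G w)"
  unfolding lin_def
proof (elim exE conjE)
  fix J d assume "finite J" "J \<subseteq> {0..1}" "G = (\<lambda>w. \<Sum>t\<in>J. d t * B t w)"
  then show "\<exists>J c'. finite J \<and> J \<subseteq> {0..1} \<and> (\<lambda>w. c * G w) = (\<lambda>w. \<Sum>t\<in>J. c' t * B t w)"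
    by (intro exI[of _ J] exI[of _ "\<lambda>t. c * d t"]) (auto simp: sum_distrib_left mult.assoc)
qed

lemma lin_add: "lin G \<Longrightarrow> lin H \<Longrightarrow> lin (\<lambda>w. G w + H w)"
  unfolding lin_def
proof (elim exE conjE)
  fix J d K e assume J: "finite J" "J \<subseteq> {0..1}" and G: "G = (\<lambda>w. \<Sum>t\<in>J. d t * B t w)"
    and K: "finite K" "K \<subseteq> {0..1}" and H: "H = (\<lambda>w. \<Sum>t\<in>K. e t * B t w)"
  have "G w + H w = (\<Sum>t\<in>J \<union> K. ((if t \<in> J then d t else 0) + (if t \<in> K then e t else 0)) * B t w)" for w
  proof -
    have "G w = (\<Sum>t\<in>J \<union> K. (if t \<in> J then d t else 0) * B t w)"
      unfolding G using J K by (intro sum.mono_neutral_cong_left) auto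
    moreover have "H w = (\<Sum>t\<in>J \<union> K. (if t \<in> K then e t else 0) * B t w)"
      unfolding H using J K by (intro sum.mono_neutral_cong_left) auto
    ultimately show ?thesis by (simp add: distrib_right sum.distrib)
  qed
  then show "\<exists>J c. finite J \<and> J \<subseteq> {0..1} \<and> (\<lambda>w. G w + H w) = (\<lambda>w. \<Sum>t\<in>J. c t * B t w)"
    using J K by (intro exI[of _ "J \<union> K"] exI) auto
qed

lemma lin_sum:
  assumes "finite K" "\<And>k. k \<in> K \<Longrightarrow> lin (G k)" shows "lin (\<lambda>w. \<Sum>k\<in>K. c k * G k w)"
  using assms
proof (induction K rule: finite_induct)
  case empty
  show ?case unfolding lin_def by (intro exI[of _ "{}"]) auto
next
  case (insert k K)
  then show ?case by (simp add: lin_add lin_scale)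
qed

lemma lin_gaussian: "lin G \<Longrightarrow> gaussian_rv M G"
  unfolding lin_def using B_gaussian by blast

lemma dev_eq: "dev a b u w = B u w + ((- ((b - u) / (b - a))) * B a w + (- ((u - a) / (b - a))) * B b w)"
  by (simp add: dev_def add_divide_distrib)

context
  fixes a b :: real
  assumes ab: "0 \<le> a" "a < b" "b \<le> 1"
begin

lemma dev_lin: "u \<in> {a..b} \<Longrightarrow> lin (dev a b u)"
  unfolding dev_eq[abs_def] using ab by (intro lin_add lin_scale lin_B) auto

lemma interpolation_of_affine:
  fixes f :: "real \<Rightarrow> real" assumes "f = (\<lambda>t. c + d * t)"
  shows "f u + ((- ((b - u) / (b - a))) * f a + (- ((u - a) / (b - a))) * f b) = 0"
proof -
  have "f u * (b - a) = (b - u) * f a + (u - a) * f b" unfolding assms by (simp add: algebra_simps)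
  then have "f u = ((b - u) * f a + (u - a) * f b) / (b - a)" using ab by (simp add: field_simps)
  then show ?thesis by (simp add: add_divide_distrib)
qed

lemma dev_expectation: "u \<in> {a..b} \<Longrightarrow> expectation (dev a b u) = 0"
  unfolding dev_eq[abs_def] using interpolation_of_affine[of "\<lambda>t. lam * t" 0 lam u] B_integrable ab
  by (simp add: B_expectation)

lemma dev_B_expand:
  assumes "u \<in> {a..b}" "v \<in> {0..1}"
  shows "expectation (\<lambda>w. B v w * dev a b u w) = expectation (\<lambda>w. B v w * B u w) +
    ((- ((b - u) / (b - a))) * expectation (\<lambda>w. B v w * B a w) + (- ((u - a) / (b - a))) * expectation (\<lambda>w. B v w * B b w))"
proof -
  define c d where "c = - ((b - u) / (b - a))" and "d = - ((u - a) / (b - a))"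
  have "expectation (\<lambda>w. B v w * dev a b u w) =
    expectation (\<lambda>w. B v w * B u w + (c * (B v w * B a w) + d * (B v w * B b w)))"
    unfolding dev_eq c_def[symmetric] d_def[symmetric] by (simp add: algebra_simps)
  also have "\<dots> = expectation (\<lambda>w. B v w * B u w) + (c * expectation (\<lambda>w. B v w * B a w) + d * expectation (\<lambda>w. B v w * B b w))"
    using assms ab BB_integrable by simp
  finally show ?thesis by (simp only: c_def d_def)
qed

text \<open>
  For fixed \<open>v\<close> outside the window, the second moment of \<open>B v\<close> and \<open>B t\<close> is an affine function of \<open>t\<close> in the
  window, and the deviation of an affine function from its chord vanishes.
\<close>

lemma dev_uncorrelated:
  assumes u: "u \<in> {a..b}" and v: "v \<in> {0..a} \<union> {b..1}"
  shows "expectation (\<lambda>w. B v w * dev a b u w) = 0"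
proof -
  obtain c d where cd: "\<And>t. t \<in> {a..b} \<Longrightarrow> expectation (\<lambda>w. B v w * B t w) = c + d * t"
  proof (cases "v \<le> a")
    case True
    then have "expectation (\<lambda>w. B v w * B t w) = v + (lam\<^sup>2 * v - v) * t" if "t \<in> {a..b}" for t
      using B_moment[of v t] that ab v by (auto simp: algebra_simps)
    then show ?thesis by (rule that)
  next
    case False
    then have "expectation (\<lambda>w. B v w * B t w) = 0 + ((1 - v) + lam\<^sup>2 * v) * t" if "t \<in> {a..b}" for t
      using B_moment[of t v] that ab v by (auto simp: algebra_simps)
    then show ?thesis by (rule that)
  qed
  have v01: "v \<in> {0..1}" using v ab by auto
  show ?thesis
    unfolding dev_B_expand[OF u v01] cd[OF u] using cd[of a] cd[of b] ab
      interpolation_of_affine[of "\<lambda>t. c + d * t" c d u] by simp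
qed

theorem window_independent:
  assumes "F \<in> sets (outer a b)" "H \<in> sets (inner_alg a b)"
  shows "prob (F \<inter> H) = prob F * prob H"
proof (rule gaussian_families_independent[OF _ _ assms[unfolded outer_def inner_alg_def]])
  fix K c L d assume "finite K" "K \<subseteq> {0..a} \<union> {b..1}" "finite L" "L \<subseteq> {a..b}"
  then show "gaussian_rv M (\<lambda>x. (\<Sum>k\<in>K. c k * B k x) + (\<Sum>l\<in>L. d l * dev a b l x))"
    using ab by (intro lin_gaussian lin_add lin_sum lin_B dev_lin) auto
qed (simp add: dev_uncorrelated dev_expectation)

lemma dev_normal:
  assumes u: "a < u" "u < b"
  shows "distributed M lborel (dev a b u) (normal_density 0 (sqrt ((u - a) * (b - u) / (b - a))))"
proof -
  have uab: "u \<in> {a..b}" using u by auto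
  have g: "gaussian_rv M (dev a b u)" using uab by (intro lin_gaussian dev_lin)
  have i: "integrable M (\<lambda>w. B v w * dev a b u w)" if "v \<in> {0..1}" for v
    using that gaussian_integrable[OF g] gaussian_integrable[OF B_gaussian1] gaussian_measurable[OF g] B_measurable
    by (intro integrable_product_of_squares) auto
  have "variance (dev a b u) = expectation (\<lambda>w. dev a b u w * dev a b u w)"
    using dev_expectation[OF uab] by (simp add: power2_eq_square)
  also have "\<dots> = expectation (\<lambda>w. B u w * dev a b u w + ((- ((b - u) / (b - a))) * (B a w * dev a b u w) + (- ((u - a) / (b - a))) * (B b w * dev a b u w)))"
    by (rule Bochner_Integration.integral_cong[OF refl], subst (1) dev_eq) (simp add: algebra_simps)
  also have "\<dots> = expectation (\<lambda>w. B u w * dev a b u w)"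
    using i[of u] i[of a] i[of b] u ab by (simp add: dev_uncorrelated)
  also have "\<dots> = u * (1 - u) + lam\<^sup>2 * u * u + ((- ((b - u) / (b - a))) * (a * (1 - u) + lam\<^sup>2 * a * u) + (- ((u - a) / (b - a))) * (u * (1 - b) + lam\<^sup>2 * u * b))"
    using u ab B_moment[of u u] B_moment[of a u] B_moment[of u b] by (subst dev_B_expand) (auto simp: mult.commute)
  also have "\<dots> = (u - a) * (b - u) / (b - a)"
    using ab by (simp add: divide_simps) (simp add: algebra_simps power2_eq_square)
  finally have v: "variance (dev a b u) = (u - a) * (b - u) / (b - a)" .
  have "0 < (u - a) * (b - u) / (b - a)" using u by simp
  then show ?thesis
    using gaussian_nondegenerate[OF g] v dev_expectation[OF uab] by simp
qed

end

end

context prob_space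
begin

section \<open>Events of small probability and independent events\<close>

lemma prob_tendsto_0:
  assumes "\<And>n. A n \<in> events" and "\<And>w. w \<in> space M \<Longrightarrow> \<forall>\<^sub>F n in sequentially. w \<notin> A n"
  shows "(\<lambda>n. prob (A n)) \<longlonglongrightarrow> 0"
proof -
  have "(\<lambda>n. expectation (\<lambda>w. indicator (A n) w :: real)) \<longlonglongrightarrow> expectation (\<lambda>w. 0 :: real)"
  proof (rule integral_dominated_convergence[where w="\<lambda>_. 1"])
    show "AE w in M. (\<lambda>n. indicator (A n) w :: real) \<longlonglongrightarrow> 0"
    proof (rule AE_I2)
      fix w assume "w \<in> space M"
      have "\<forall>\<^sub>F n in sequentially. indicator (A n) w = (0::real)"
        using assms(2)[OF \<open>w \<in> space M\<close>] by eventually_elim simp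
      then show "(\<lambda>n. indicator (A n) w :: real) \<longlonglongrightarrow> 0" by (rule tendsto_eventually)
    qed
  qed (use assms(1) in \<open>auto simp: indicator_def\<close>)
  then show ?thesis using assms(1) by simp
qed

lemma eventually_prob_le:
  assumes "\<And>n. A n \<in> events" and "\<And>w. w \<in> space M \<Longrightarrow> \<forall>\<^sub>F n in sequentially. w \<notin> A n" and "0 < e"
  shows "\<forall>\<^sub>F n in sequentially. prob (A n) \<le> e"
  using order_tendstoD(2)[OF prob_tendsto_0[OF assms(1,2)] assms(3)] by (auto elim: eventually_mono)

text \<open>
  The conditional probability of \<open>H\<close> given \<open>G\<close> is the constant \<open>prob H\<close>.
\<close>

lemma expectation_mult_independent_event:
  assumes sub: "subalgebra M G" and ind: "\<And>F. F \<in> sets G \<Longrightarrow> prob (F \<inter> H) = prob F * prob H"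
    and H[measurable]: "H \<in> events" and W: "W \<in> borel_measurable G" and bd: "\<And>w. w \<in> space M \<Longrightarrow> \<bar>W w\<bar> \<le> C"
  shows "expectation (\<lambda>w. W w * indicator H w) = expectation W * prob H"
proof -
  interpret finite_measure_subalgebra M G by unfold_locales (rule sub)
  have [measurable]: "W \<in> borel_measurable M" by (rule measurable_from_subalg[OF sub W])
  have iW: "integrable M W" by (rule integrable_bounded_rv[where C=C]) (use bd in auto)
  have "AE w in M. real_cond_exp M G (indicator H) w = prob H"
  proof (rule real_cond_exp_charact)
    fix A assume A: "A \<in> sets G"
    then have [measurable]: "A \<in> events" using sub by (auto simp: subalgebra_def)
    have "(\<integral>w\<in>A. indicator H w \<partial>M) = prob (A \<inter> H)"
      unfolding set_lebesgue_integral_def by (simp add: indicator_inter_arith[symmetric])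
    also have "\<dots> = (\<integral>w\<in>A. prob H \<partial>M)"
      using ind[OF A] unfolding set_lebesgue_integral_def by simp
    finally show "(\<integral>w\<in>A. indicator H w \<partial>M) = (\<integral>w\<in>A. prob H \<partial>M)" .
  qed (auto intro!: integrable_bounded_rv[where C=1] simp: indicator_def)
  then have "expectation (\<lambda>w. W w * real_cond_exp M G (indicator H) w) = expectation (\<lambda>w. W w * prob H)"
    by (intro integral_cong_AE) auto
  moreover have "expectation (\<lambda>w. W w * real_cond_exp M G (indicator H) w) = expectation (\<lambda>w. W w * indicator H w)"
    by (rule real_cond_exp_intg(2)) (use W iW in \<open>auto intro: integrable_real_mult_indicator\<close>)
  ultimately show ?thesis by simp
qed

lemma
  fixes ph :: "real \<Rightarrow> real"
  assumes ind: "independent_of G Z" and D: "distributed M lborel Z (normal_density 0 s)" and s: "0 < s"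
    and W: "W \<in> borel_measurable G" "\<And>w. w \<in> space M \<Longrightarrow> 0 \<le> W w" "\<And>w. w \<in> space M \<Longrightarrow> W w \<le> 1"
    and R: "R \<in> borel_measurable G"
    and ph[measurable]: "ph \<in> borel_measurable borel" and ph01: "\<And>y. 0 \<le> ph y" "\<And>y. ph y \<le> 1"
    and J: "(\<integral>\<^sup>+y. ennreal (ph y) \<partial>lborel) = ennreal J" "0 \<le> J"
  shows expectation_smoothing_upper: "expectation (\<lambda>w. W w * ph (R w + Z w)) \<le> expectation W * (1 / (2 * s) * J)"
    and expectation_smoothing_lower: "\<lbrakk>\<And>y. ph y \<noteq> 0 \<Longrightarrow> \<bar>y\<bar> \<le> K; \<And>w. w \<in> space M \<Longrightarrow> W w > 0 \<Longrightarrow> \<bar>R w\<bar> \<le> K\<rbrakk>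
      \<Longrightarrow> expectation W * (normal_density 0 s (2 * K) * J) \<le> expectation (\<lambda>w. W w * ph (R w + Z w))"
proof -
  have sub: "subalgebra M G" and [measurable]: "Z \<in> borel_measurable M" using ind by (auto simp: independent_of_def)
  have [measurable]: "W \<in> borel_measurable M" "R \<in> borel_measurable M"
    using measurable_from_subalg[OF sub] W R by auto
  have nn: "(\<integral>\<^sup>+w. ennreal (W w) * ennreal (ph (R w + Z w)) \<partial>M) = ennreal (expectation (\<lambda>w. W w * ph (R w + Z w)))"
  proof -
    have "(\<integral>\<^sup>+w. ennreal (W w) * ennreal (ph (R w + Z w)) \<partial>M) = (\<integral>\<^sup>+w. ennreal (W w * ph (R w + Z w)) \<partial>M)"
      by (intro nn_integral_cong) (use W ph01 in \<open>auto simp: ennreal_mult\<close>)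
    also have "\<dots> = ennreal (expectation (\<lambda>w. W w * ph (R w + Z w)))"
    proof (rule nn_integral_eq_integral)
      show "integrable M (\<lambda>w. W w * ph (R w + Z w))"
        by (rule integrable_bounded_rv[where C=1]) (use W ph01 in \<open>auto simp: abs_mult intro!: mult_le_one\<close>)
    qed (use W ph01 in auto)
    finally show ?thesis .
  qed
  have nW: "(\<integral>\<^sup>+w. ennreal (W w) \<partial>M) = ennreal (expectation W)"
    by (rule nn_integral_eq_integral) (use W in \<open>auto intro!: integrable_bounded_rv[where C=1]\<close>)
  have eW: "0 \<le> expectation W" by (rule integral_nonneg_AE) (use W in auto)
  have e0: "0 \<le> expectation (\<lambda>w. W w * ph (R w + Z w))" by (rule integral_nonneg_AE) (use W ph01 in auto)
  show "expectation (\<lambda>w. W w * ph (R w + Z w)) \<le> expectation W * (1 / (2 * s) * J)"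
    using smoothing_upper_bound[OF ind D s W(1) R, of "\<lambda>y. ennreal (ph y)"] s eW J
    unfolding nn nW J by (simp add: ennreal_mult'[symmetric] ennreal_mult[symmetric] ennreal_le_iff)
  show "expectation W * (normal_density 0 s (2 * K) * J) \<le> expectation (\<lambda>w. W w * ph (R w + Z w))"
    if "\<And>y. ph y \<noteq> 0 \<Longrightarrow> \<bar>y\<bar> \<le> K" "\<And>w. w \<in> space M \<Longrightarrow> W w > 0 \<Longrightarrow> \<bar>R w\<bar> \<le> K"
  proof -
    have supp: "\<bar>y\<bar> \<le> K" if "ennreal (ph y) \<noteq> 0" for y
      using \<open>\<And>y. ph y \<noteq> 0 \<Longrightarrow> \<bar>y\<bar> \<le> K\<close> that by (metis ennreal_0)
    have "ennreal (expectation W * (normal_density 0 s (2 * K) * J)) =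
        ennreal (expectation W) * (ennreal (normal_density 0 s (2 * K)) * ennreal J)"
      using eW J(2) by (simp add: ennreal_mult)
    also have "\<dots> \<le> ennreal (expectation (\<lambda>w. W w * ph (R w + Z w)))"
      unfolding nn[symmetric] nW[symmetric] J(1)[symmetric]
      by (rule smoothing_lower_bound[OF ind D s W(1) R _ supp that(2)]) measurable
    finally show ?thesis using e0 by (simp only: ennreal_le_iff)
  qed
qed

end

context bridge
begin

section \<open>The minimum is not attained at the end\<close>

lemma outer_subalgebra: "a \<le> 1 \<Longrightarrow> 0 \<le> b \<Longrightarrow> subalgebra M (outer a b)"
  unfolding outer_def by (rule subalgebra_generated_algebra) (auto intro: B_measurable)

lemma space_outer [simp]: "space (outer a b) = space M" by (simp add: outer_def)

lemma B_outer: "v \<in> {0..a} \<union> {b..1} \<Longrightarrow> B v \<in> borel_measurable (outer a b)"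
  unfolding outer_def by (rule measurable_generated_algebra)

lemma space_inner_alg [simp]: "space (inner_alg a b) = space M" by (simp add: inner_alg_def)

lemma dev_inner: "u \<in> {a..b} \<Longrightarrow> dev a b u \<in> borel_measurable (inner_alg a b)"
  unfolding inner_alg_def by (rule measurable_generated_algebra)

lemma dev_measurable:
  assumes "0 \<le> a" "b \<le> 1" "u \<in> {a..b}" shows "dev a b u \<in> borel_measurable M"
proof -
  have [measurable]: "B a \<in> borel_measurable M" "B b \<in> borel_measurable M" "B u \<in> borel_measurable M"
    using assms by (auto intro!: B_measurable)
  show ?thesis unfolding dev_def[abs_def] by measurable
qed

lemma inner_subalgebra: "0 \<le> a \<Longrightarrow> b \<le> 1 \<Longrightarrow> subalgebra M (inner_alg a b)"
  unfolding inner_alg_def by (rule subalgebra_generated_algebra) (auto intro: dev_measurable)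

lemma dev_cont:
  assumes "w \<in> space M" "0 \<le> a" "a < b" "b \<le> 1" shows "continuous_on {a..b} (\<lambda>u. dev a b u w)"
  unfolding dev_eq using assms by (intro continuous_intros B_cont_on) auto

lemma dev_independent_of:
  assumes "0 \<le> a" "a < u" "u < b" "b \<le> 1" shows "independent_of (outer a b) (dev a b u)"
  unfolding independent_of_def
proof (intro conjI ballI)
  fix F and A :: "real set" assume "F \<in> sets (outer a b)" and A: "A \<in> sets borel"
  moreover have "dev a b u -` A \<inter> space M \<in> sets (inner_alg a b)"
    using measurable_sets[OF dev_inner[of u a b] A] assms by simp
  ultimately show "prob (F \<inter> (dev a b u -` A \<inter> space M)) = prob F * prob (dev a b u -` A \<inter> space M)"
    using assms by (intro window_independent) auto
qed (use assms in \<open>auto intro: outer_subalgebra dev_measurable\<close>)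

lemma small_dev_event:
  assumes "0 \<le> a" "a < b" "b \<le> 1"
  shows "{w \<in> space M. \<forall>u\<in>{a..b}. \<bar>dev a b u w\<bar> \<le> c} \<in> sets (inner_alg a b)"
proof -
  have "{w \<in> space (inner_alg a b). \<forall>u\<in>{a..b}. - c \<le> - \<bar>dev a b u w\<bar>} \<in> sets (inner_alg a b)"
    by (rule closed_path_event) (use assms in \<open>auto intro!: continuous_intros dev_cont borel_measurable_abs[OF dev_inner]\<close>)
  then show ?thesis by simp
qed

lemma small_dev_event_outer:
  assumes "0 \<le> a" "a < b" "b \<le> 1" and "{a..b} \<subseteq> {0..p} \<union> {q..1}"
  shows "{w \<in> space M. \<forall>u\<in>{a..b}. \<bar>dev a b u w\<bar> \<le> c} \<in> sets (outer p q)"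
proof -
  have m: "dev a b u \<in> borel_measurable (outer p q)" if "u \<in> {a..b}" for u
  proof -
    have [measurable]: "B a \<in> borel_measurable (outer p q)" "B b \<in> borel_measurable (outer p q)" "B u \<in> borel_measurable (outer p q)"
    proof -
      have "{a, b, u} \<subseteq> {a..b}" using assms(2) that by auto
      then have "{a, b, u} \<subseteq> {0..p} \<union> {q..1}" using assms(4) by (rule order_trans)
      then show "B a \<in> borel_measurable (outer p q)" "B b \<in> borel_measurable (outer p q)" "B u \<in> borel_measurable (outer p q)"
        by (blast intro!: B_outer)+
    qed
    show ?thesis unfolding dev_def[abs_def] by measurable
  qed
  have "{w \<in> space (outer p q). \<forall>u\<in>{a..b}. - c \<le> - \<bar>dev a b u w\<bar>} \<in> sets (outer p q)"
    by (rule closed_path_event) (use assms in \<open>auto intro!: continuous_intros dev_cont borel_measurable_abs[OF m]\<close>)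
  then show ?thesis by simp
qed

lemma interpolation_bounds:
  fixes a b u x y :: real
  assumes "a < b" "u \<in> {a..b}" "l \<le> x" "l \<le> y" "x \<le> h" "y \<le> h"
  shows "l \<le> ((b - u) * x + (u - a) * y) / (b - a)" "((b - u) * x + (u - a) * y) / (b - a) \<le> h"
proof -
  have "(b - u) * l + (u - a) * l \<le> (b - u) * x + (u - a) * y"
    using assms by (intro add_mono mult_left_mono) auto
  then show "l \<le> ((b - u) * x + (u - a) * y) / (b - a)" using assms by (simp add: field_simps)
  have "(b - u) * x + (u - a) * y \<le> (b - u) * h + (u - a) * h"
    using assms by (intro add_mono mult_left_mono) auto
  then show "((b - u) * x + (u - a) * y) / (b - a) \<le> h" using assms by (simp add: field_simps)
qed

lemma dev_le_two_sup:
  assumes "a < b" "u \<in> {a..b}" "\<And>v. v \<in> {a..b} \<Longrightarrow> \<bar>B v w\<bar> \<le> c"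
  shows "\<bar>dev a b u w\<bar> \<le> 2 * c"
proof -
  have "\<bar>B a w\<bar> \<le> c" "\<bar>B b w\<bar> \<le> c" "\<bar>B u w\<bar> \<le> c" using assms by auto
  then show ?thesis
    using interpolation_bounds[OF assms(1,2), of "-c" "B a w" "B b w" c] unfolding dev_def by (simp add: abs_le_iff)
qed

definition tau :: "'a \<Rightarrow> real" where "tau w = first_argmin_on 0 1 (\<lambda>u. B u w)"

lemma tau_range: "w \<in> space M \<Longrightarrow> tau w \<in> {0..1}"
  unfolding tau_def by (rule first_argmin_on_mem) (auto intro: B_cont)

lemma tau_measurable [measurable]: "tau \<in> borel_measurable M"
  unfolding tau_def[abs_def] by (rule first_argmin_on_measurable) (auto intro: B_cont B_measurable)

lemma above_endpoint_event:
  assumes "0 < h" "h < 1"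
  shows "{w \<in> space M. \<forall>u\<in>{0..1-h}. B 1 w \<le> B u w} \<in> sets (outer (1 - h) 1)"
proof -
  have "{w \<in> space (outer (1 - h) 1). \<forall>u\<in>{0..1-h}. B 1 w \<le> B u w} \<in> sets (outer (1 - h) 1)"
    by (rule closed_path_event) (use assms in \<open>auto intro!: B_cont_on B_outer\<close>)
  then show ?thesis by simp
qed

text \<open>
  Suppose that the path stays above its final value and that its height at time \<open>1 - h\<close> is at most \<open>K\<close>. At a
  time \<open>1 - g\<close> much closer to the end, the chord is only \<open>g * K / h\<close> above the final value, which is small
  compared with the standard deviation of order \<open>sqrt g\<close> of the deviation from the chord. So the
  independent deviation must not be very negative, and this costs a factor close to \<open>1 / 2\<close>.
\<close>

lemma above_endpoint_contraction:
  assumes h: "0 < h" "h < 1" and e: "0 < e"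
    and O0: "O0 \<in> events" "\<And>w. w \<in> O0 \<Longrightarrow> w \<in> space M \<and> (\<forall>u\<in>{0..<1}. B 1 w \<le> B u w)"
  shows "prob O0 \<le> 5 / 8 * prob {w \<in> space M. \<forall>u\<in>{0..1-h}. B 1 w \<le> B u w} + e"
proof -
  define Oh where "Oh = {w \<in> space M. \<forall>u\<in>{0..1-h}. B 1 w \<le> B u w}"
  have Oh: "Oh \<in> sets (outer (1 - h) 1)" unfolding Oh_def using h by (rule above_endpoint_event)
  have sub: "subalgebra M (outer (1 - h) 1)" using h by (intro outer_subalgebra) auto
  have OhM: "Oh \<in> events" using Oh sub by (auto simp: subalgebra_def)
  have [measurable]: "B (1 - h) \<in> borel_measurable M" "B 1 \<in> borel_measurable M" using h by (auto intro: B_measurable)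
  have "\<forall>\<^sub>F n in sequentially. prob {w \<in> space M. real n < B (1 - h) w - B 1 w} \<le> e"
  proof (rule eventually_prob_le[OF _ _ e])
    fix w
    have "\<forall>\<^sub>F n in sequentially. B (1 - h) w - B 1 w \<le> real n"
      by (rule eventually_sequentiallyI[of "nat \<lceil>B (1 - h) w - B 1 w\<rceil>"]) linarith
    then show "\<forall>\<^sub>F n in sequentially. w \<notin> {w \<in> space M. real n < B (1 - h) w - B 1 w}"
      by eventually_elim auto
  qed measurable
  then have "\<forall>\<^sub>F n in sequentially. 1 \<le> n \<and> prob {w \<in> space M. real n < B (1 - h) w - B 1 w} \<le> e"
    using eventually_ge_at_top[of "1::nat"] by eventually_elim auto
  then obtain n :: nat where n: "1 \<le> n" "prob {w \<in> space M. real n < B (1 - h) w - B 1 w} \<le> e"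
    by (auto simp: eventually_sequentially)
  define K where "K = real n"
  have K: "0 < K" using n by (simp add: K_def)
  \<comment> \<open>The second bound makes the shift \<open>x\<close> at most an eighth of the standard deviation \<open>s\<close>; the factor \<open>2\<close> in \<open>x\<close> makes the inequality strict.\<close>
  define g where "g = min (h / 2) (h\<^sup>2 / (512 * K\<^sup>2))"
  have g: "0 < g" "g \<le> h / 2" "g \<le> h\<^sup>2 / (512 * K\<^sup>2)" using h K by (auto simp: g_def)
  define x where "x = 2 * (g * K / h)"
  have x: "0 < x" "g * K / h < x"
  proof -
    have y: "0 < g * K / h" using g h K by simp
    have y2: "0 < 2 * y \<and> y < 2 * y" if "0 < y" for y :: real using that by simp
    show "0 < x" unfolding x_def by (rule y2[OF y, THEN conjunct1])
    show "g * K / h < x" unfolding x_def by (rule y2[OF y, THEN conjunct2])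
  qed
  define s where "s = sqrt ((h - g) * g / h)"
  have s2: "g / 2 \<le> (h - g) * g / h"
  proof -
    have "g / 2 * h = h / 2 * g" by simp
    also have "\<dots> \<le> (h - g) * g" using g h by (intro mult_right_mono) auto
    finally show ?thesis using h by (simp add: pos_le_divide_eq)
  qed
  have s: "0 < s" using g s2 by (auto simp: s_def)
  define Z where "Z = dev (1 - h) 1 (1 - g)"
  have DZ: "distributed M lborel Z (normal_density 0 s)"
    using dev_normal[of "1 - h" 1 "1 - g"] h g unfolding Z_def s_def by simp
  have indZ: "independent_of (outer (1 - h) 1) Z" unfolding Z_def using h g by (intro dev_independent_of) auto
  have Zm[measurable]: "Z \<in> borel_measurable M" using indZ by (simp add: independent_of_def)
  have xs: "x / s \<le> 1 / 8"
  proof -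
    have "(8 * x)\<^sup>2 = 256 * K\<^sup>2 / h\<^sup>2 * g * g" by (simp add: x_def power_mult_distrib power_divide power2_eq_square)
    also have "\<dots> \<le> 256 * K\<^sup>2 / h\<^sup>2 * (h\<^sup>2 / (512 * K\<^sup>2)) * g" using g by (intro mult_right_mono mult_left_mono) auto
    also have "\<dots> = g / 2" using h K by (simp add: field_simps)
    finally have 1: "(8 * x)\<^sup>2 \<le> g / 2" .
    have 2: "g / 2 \<le> s\<^sup>2"
    proof -
      have "0 \<le> (h - g) * g / h" using s2 g(1) by linarith
      then have "s\<^sup>2 = (h - g) * g / h" unfolding s_def by (rule real_sqrt_pow2)
      then show ?thesis using s2 by simp
    qed
    have "8 * x \<le> s" using power2_le_imp_le[OF order_trans[OF 1 2]] s by simp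
    then show ?thesis using s by (simp add: pos_divide_le_eq)
  qed
  have pZ: "prob (Z -` {-x<..} \<inter> space M) \<le> 5 / 8"
  proof -
    have "Z -` {-x<..} \<inter> space M = space M - {w \<in> space M. Z w \<le> - x}" by auto
    then have "prob (Z -` {-x<..} \<inter> space M) = 1 - prob {w \<in> space M. Z w \<le> - x}"
      by (simp add: prob_compl)
    then show ?thesis using normal_left_tail[OF DZ s, of x] x xs by simp
  qed
  have "O0 \<subseteq> (Oh \<inter> (Z -` {-x<..} \<inter> space M)) \<union> {w \<in> space M. real n < B (1 - h) w - B 1 w}"
  proof
    fix w assume "w \<in> O0"
    then have w: "w \<in> space M" "\<And>u. 0 \<le> u \<Longrightarrow> u < 1 \<Longrightarrow> B 1 w \<le> B u w" using O0 by auto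
    have "Z w > - x" if "B (1 - h) w - B 1 w \<le> K"
    proof -
      have "Z w = (B (1 - g) w - B 1 w) - g / h * (B (1 - h) w - B 1 w)"
        using h by (simp add: Z_def dev_def field_simps)
      moreover have "0 \<le> B (1 - g) w - B 1 w" using w(2)[of "1 - g"] g h by simp
      moreover have "g / h * (B (1 - h) w - B 1 w) \<le> g / h * K" using that g h by (intro mult_left_mono) auto
      ultimately show ?thesis using x by simp
    qed
    then show "w \<in> (Oh \<inter> (Z -` {-x<..} \<inter> space M)) \<union> {w \<in> space M. real n < B (1 - h) w - B 1 w}"
      using w h by (auto simp: Oh_def K_def not_less)
  qed
  then have "prob O0 \<le> prob ((Oh \<inter> (Z -` {-x<..} \<inter> space M)) \<union> {w \<in> space M. real n < B (1 - h) w - B 1 w})"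
    by (rule finite_measure_mono) (use OhM in measurable)
  also have "\<dots> \<le> prob (Oh \<inter> (Z -` {-x<..} \<inter> space M)) + prob {w \<in> space M. real n < B (1 - h) w - B 1 w}"
    by (rule measure_Un_le) (use OhM in measurable)
  also have "prob (Oh \<inter> (Z -` {-x<..} \<inter> space M)) = prob Oh * prob (Z -` {-x<..} \<inter> space M)"
    using indZ Oh by (auto simp: independent_of_def)
  also have "\<dots> \<le> prob Oh * (5 / 8)" using pZ by (intro mult_left_mono) auto
  finally show ?thesis using n(2) by (simp add: Oh_def)
qed

text \<open>
  As \<open>h\<close> tends to \<open>0\<close>, the contraction becomes \<open>p \<le> 5 / 8 * p\<close> for the probability \<open>p\<close> that the path stays
  above its final value.
\<close>

lemma tau_less_1: "prob {w \<in> space M. tau w = 1} = 0"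
proof -
  define A where "A n = {w \<in> space M. \<forall>u\<in>{0..1 - 1 / real (n + 2)}. B 1 w \<le> B u w}" for n :: nat
  have AM: "A n \<in> events" for n
    using above_endpoint_event[of "1 / real (n + 2)"] outer_subalgebra[of "1 - 1 / real (n + 2)" 1]
    by (auto simp: A_def subalgebra_def)
  define O0 where "O0 = (\<Inter>n. A n)"
  have O0M: "O0 \<in> events" unfolding O0_def using AM by auto
  have O0: "w \<in> space M \<and> (\<forall>u\<in>{0..<1}. B 1 w \<le> B u w)" if "w \<in> O0" for w
  proof (intro conjI ballI)
    show "w \<in> space M" using that by (auto simp: O0_def A_def)
    fix u :: real assume u: "u \<in> {0..<1}"
    obtain n :: nat where "inverse (1 - u) < real n" using reals_Archimedean2 by blast
    then have "1 / real (n + 2) \<le> 1 - u" using u by (simp add: field_simps)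
    then have "u \<in> {0..1 - 1 / real (n + 2)}" using u by auto
    then show "B 1 w \<le> B u w" using that by (auto simp: O0_def A_def)
  qed
  have "prob O0 \<le> 5 / 8 * prob (A n)" for n
  proof (rule field_le_epsilon)
    fix e :: real assume "0 < e"
    then show "prob O0 \<le> 5 / 8 * prob (A n) + e"
      unfolding A_def using O0M O0 by (intro above_endpoint_contraction) auto
  qed
  moreover have "decseq A"
  proof (rule decseq_SucI)
    fix n
    have "1 / real (Suc n + 2) \<le> 1 / real (n + 2)" by (intro divide_left_mono) auto
    then show "A (Suc n) \<subseteq> A n" by (force simp: A_def)
  qed
  then have "(\<lambda>n. prob (A n)) \<longlonglongrightarrow> prob O0"
    unfolding O0_def using AM by (intro finite_Lim_measure_decseq) auto
  then have "(\<lambda>n. 5 / 8 * prob (A n)) \<longlonglongrightarrow> 5 / 8 * prob O0" by (rule tendsto_mult_left)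
  ultimately have "prob O0 \<le> 5 / 8 * prob O0" by (intro LIMSEQ_le_const) auto
  then have "prob O0 = 0" using measure_nonneg[of M O0] by linarith
  moreover have "{w \<in> space M. tau w = 1} \<subseteq> O0"
  proof
    fix w assume w: "w \<in> {w \<in> space M. tau w = 1}"
    have "B 1 w \<le> B u w" if "u \<in> {0..1}" for u
      using min_on_le[of 0 1 "\<lambda>u. B u w" u] B_cont that w by (simp add: min_on_def tau_def)
    moreover have "{0..1 - 1 / real (n + 2)} \<subseteq> {0..1}" for n by auto
    ultimately show "w \<in> O0" using w unfolding O0_def A_def by blast
  qed
  then have "prob {w \<in> space M. tau w = 1} \<le> prob O0" by (rule finite_measure_mono[OF _ O0M])
  ultimately show ?thesis using measure_nonneg[of M "{w \<in> space M. tau w = 1}"] by linarith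
qed

end

section \<open>The Vervaat transform of the bridge\<close>

lemma vervaat_before:
  assumes "0 \<le> first_argmin f" "0 \<le> u" "first_argmin f + u < 1"
  shows "vervaat f u = f (first_argmin f + u) - f (first_argmin f)"
proof -
  have "frac (first_argmin f + u) = first_argmin f + u" using assms by (simp add: frac_eq)
  then show ?thesis using assms by (simp add: vervaat_def)
qed

lemma vervaat_after:
  assumes "first_argmin f \<le> 1" "u < 1" "1 \<le> first_argmin f + u"
  shows "vervaat f u = f (u - (1 - first_argmin f)) + (f 1 - f (first_argmin f))"
proof -
  have "frac (first_argmin f + u) = u - (1 - first_argmin f)"
    using assms by (simp add: frac_unique_iff)
  then show ?thesis using assms by (simp add: vervaat_def)
qed

context bridge
begin

definition V :: "real \<Rightarrow> 'a \<Rightarrow> real" where "V u w = vervaat (\<lambda>t. B t w) u"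

lemma tau_le: "w \<in> space M \<Longrightarrow> u \<in> {0..1} \<Longrightarrow> B (tau w) w \<le> B u w"
  using min_on_le[of 0 1 "\<lambda>u. B u w" u] B_cont by (simp add: min_on_def tau_def)

lemma tau_less: "w \<in> space M \<Longrightarrow> 0 \<le> u \<Longrightarrow> u < tau w \<Longrightarrow> B (tau w) w < B u w"
  using min_on_less[of 0 1 "\<lambda>u. B u w" u] B_cont by (simp add: min_on_def tau_def)

lemma V_before:
  assumes "w \<in> space M" "0 \<le> u" "tau w + u < 1"
  shows "V u w = B (tau w + u) w - B (tau w) w"
  using vervaat_before[of "\<lambda>t. B t w" u] assms tau_range[OF assms(1)]
  by (simp add: V_def tau_def first_argmin_eq)

lemma V_after:
  assumes "w \<in> space M" "u < 1" "1 \<le> tau w + u"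
  shows "V u w = B (u - (1 - tau w)) w + (B 1 w - B (tau w) w)"
  using vervaat_after[of "\<lambda>t. B t w" u] assms tau_range[OF assms(1)]
  by (simp add: V_def tau_def first_argmin_eq)

lemma V_nonneg_before: "w \<in> space M \<Longrightarrow> 0 \<le> u \<Longrightarrow> tau w + u < 1 \<Longrightarrow> 0 \<le> V u w"
  using tau_le[of w "tau w + u"] tau_range[of w] by (simp add: V_before)

text \<open>
  In the case \<open>tau w = 1\<close> the transform agrees with \<open>B\<close> near time \<open>0\<close>, and in the other case with the
  increments of \<open>B\<close> after \<open>tau w\<close>.
\<close>

lemma V_small_near_0:
  assumes w: "w \<in> space M" and e: "0 < e"
  shows "\<exists>h>0. \<forall>u. 0 \<le> u \<and> u < h \<longrightarrow> \<bar>V u w\<bar> < e"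
proof -
  note c = B_cont[OF w]
  define p where "p = (if tau w < 1 then tau w else 0)"
  have p: "p \<in> {0..1}" using tau_range[OF w] by (auto simp: p_def)
  obtain d where d: "0 < d" "\<And>v. v \<in> {0..1} \<Longrightarrow> \<bar>v - p\<bar> < d \<Longrightarrow> \<bar>B v w - B p w\<bar> < e"
    using c p e unfolding continuous_on_iff dist_real_def by metis
  define h where "h = min d (if tau w < 1 then 1 - tau w else 1)"
  have "\<bar>V u w\<bar> < e" if u: "0 \<le> u" "u < h" for u
  proof (cases "tau w < 1")
    case True
    then show ?thesis using d(2)[of "p + u"] u tau_range[OF w] V_before[OF w, of u] by (auto simp: p_def h_def)
  next
    case False
    then have t: "tau w = 1" using tau_range[OF w] by auto
    then show ?thesis using d(2)[of u] u V_after[OF w, of u] B_0[OF w] by (auto simp: p_def h_def)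
  qed
  moreover have "0 < h" using d(1) by (auto simp: h_def)
  ultimately show ?thesis by blast
qed

text \<open>
  If the minimum is attained after time \<open>1 - r\<close>, then \<open>tau\<close> and the minimum are \<open>etau r\<close> and \<open>emin r\<close>,
  functions of the last piece of the path. The height \<open>gap r\<close> of the final value above the minimum is the
  amount by which the transform is shifted.
\<close>

definition etau :: "real \<Rightarrow> 'a \<Rightarrow> real" where "etau r w = first_argmin_on (1 - r) 1 (\<lambda>u. B u w)"
definition emin :: "real \<Rightarrow> 'a \<Rightarrow> real" where "emin r w = min_on (1 - r) 1 (\<lambda>u. B u w)"
definition gap :: "real \<Rightarrow> 'a \<Rightarrow> real" where "gap r w = B 1 w - emin r w"
definition pmin :: "real \<Rightarrow> real \<Rightarrow> 'a \<Rightarrow> real" where "pmin p q w = min_on p q (\<lambda>u. B u w)"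

lemma etau_range: "w \<in> space M \<Longrightarrow> 0 < r \<Longrightarrow> r < 1 \<Longrightarrow> etau r w \<in> {1-r..1}"
  unfolding etau_def by (rule first_argmin_on_mem) (auto intro: B_cont_on)

lemma emin_eq: "emin r w = B (etau r w) w"
  by (simp add: emin_def etau_def min_on_def)

lemma emin_le: "w \<in> space M \<Longrightarrow> 0 < r \<Longrightarrow> r < 1 \<Longrightarrow> u \<in> {1-r..1} \<Longrightarrow> emin r w \<le> B u w"
  unfolding emin_def by (rule min_on_le) (auto intro: B_cont_on)

lemma pmin_le: "w \<in> space M \<Longrightarrow> 0 \<le> p \<Longrightarrow> p \<le> q \<Longrightarrow> q \<le> 1 \<Longrightarrow> u \<in> {p..q} \<Longrightarrow> pmin p q w \<le> B u w"
  unfolding pmin_def by (rule min_on_le) (auto intro: B_cont_on)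

lemma less_pmin_iff:
  assumes "w \<in> space M" "0 \<le> p" "p \<le> q" "q \<le> 1"
  shows "c < pmin p q w \<longleftrightarrow> (\<forall>u\<in>{p..q}. c < B u w)"
proof
  assume "\<forall>u\<in>{p..q}. c < B u w"
  moreover have "first_argmin_on p q (\<lambda>u. B u w) \<in> {p..q}"
    by (rule first_argmin_on_mem) (use assms in \<open>auto intro: B_cont_on\<close>)
  ultimately show "c < pmin p q w" by (simp add: pmin_def min_on_def)
qed (use pmin_le[OF assms] in force)

lemma end_measurable:
  assumes "0 < r" "r < 1" "q \<le> 1 - r"
  shows "etau r \<in> borel_measurable (outer p q)" "emin r \<in> borel_measurable (outer p q)" "gap r \<in> borel_measurable (outer p q)"
proof -
  show "etau r \<in> borel_measurable (outer p q)"
    unfolding etau_def[abs_def] using assms by (intro first_argmin_on_measurable B_outer B_cont_on) auto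
  show [measurable]: "emin r \<in> borel_measurable (outer p q)"
    unfolding emin_def[abs_def] using assms by (intro min_on_measurable B_outer B_cont_on) auto
  have [measurable]: "B 1 \<in> borel_measurable (outer p q)" using assms by (intro B_outer) auto
  show "gap r \<in> borel_measurable (outer p q)" unfolding gap_def[abs_def] by measurable
qed

lemma pmin_outer:
  assumes "0 \<le> c" "c \<le> d" "d \<le> 1" "{c..d} \<subseteq> {0..p} \<union> {q..1}"
  shows "pmin c d \<in> borel_measurable (outer p q)"
  unfolding pmin_def[abs_def] using assms by (intro min_on_measurable B_outer B_cont_on) auto

lemma pmin_measurable: "0 \<le> p \<Longrightarrow> p \<le> q \<Longrightarrow> q \<le> 1 \<Longrightarrow> pmin p q \<in> borel_measurable M"
  unfolding pmin_def[abs_def] by (intro min_on_measurable B_measurable B_cont_on) auto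

definition end_alg :: "real \<Rightarrow> 'a measure" where "end_alg r = generated_algebra M {1-r..1} B"

lemma end_alg_outer: "q \<le> 1 - r \<Longrightarrow> sets (end_alg r) \<subseteq> sets (outer p q)"
  unfolding end_alg_def outer_def by (rule sets_generated_algebra_mono) auto

lemma end_alg_subalgebra: "r < 1 \<Longrightarrow> subalgebra M (end_alg r)"
  unfolding end_alg_def by (rule subalgebra_generated_algebra) (auto intro: B_measurable)

lemma etau_end_alg: "0 < r \<Longrightarrow> r < 1 \<Longrightarrow> etau r \<in> borel_measurable (end_alg r)"
  unfolding etau_def[abs_def] end_alg_def
  by (intro first_argmin_on_measurable measurable_generated_algebra) (auto intro: B_cont_on)

lemma
  assumes w: "w \<in> space M" and r: "0 < r" "r < 1" and late: "emin r w < pmin 0 (1 - r) w"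
  shows late_tau: "tau w = etau r w"
    and late_V: "r \<le> u \<Longrightarrow> u < 1 \<Longrightarrow> V u w = B (u - (1 - etau r w)) w + gap r w"
proof -
  have head: "emin r w < B u w" if "u \<in> {0..1-r}" for u
    using late that r w by (subst (asm) less_pmin_iff) auto
  show t: "tau w = etau r w"
    unfolding tau_def
  proof (rule first_argmin_on_eqI)
    show "continuous_on {0..1} (\<lambda>u. B u w)" by (rule B_cont[OF w])
    show "etau r w \<in> {0..1}" using etau_range[OF w r] r by auto
    fix s assume s: "s \<in> {0..1::real}"
    show "B (etau r w) w \<le> B s w"
      using head[of s] emin_le[OF w r, of s] s by (cases "s \<le> 1 - r") (auto simp: emin_eq)
  next
    fix s assume s: "0 \<le> s" "s < etau r w"
    show "B (etau r w) w < B s w"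
    proof (cases "s \<le> 1 - r")
      case True then show ?thesis using head[of s] s by (simp add: emin_eq)
    next
      case False then show ?thesis
        using min_on_less[of "1 - r" 1 "\<lambda>u. B u w" s] s r B_cont_on[OF w, of "1-r" 1] by (simp add: etau_def min_on_def)
    qed
  qed simp
  show "V u w = B (u - (1 - etau r w)) w + gap r w" if "r \<le> u" "u < 1"
    using V_after[OF w, of u] that etau_range[OF w r] by (simp add: t gap_def emin_eq)
qed

text \<open>
  Up to time \<open>1 - tau w\<close> the transform is nonnegative, so a negative value at time \<open>r\<close> puts the minimum
  strictly after \<open>1 - r\<close>. At equality, \<open>V r w\<close> is the height of the final value above the minimum.
\<close>

lemma V_neg_late:
  assumes w: "w \<in> space M" and r: "0 < r" "r < 1" and neg: "V r w < 0"
  shows "emin r w < pmin 0 (1 - r) w"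
proof -
  have a: "1 \<le> tau w + r" using V_nonneg_before[OF w, of r] neg r by (meson less_imp_le not_less)
  have "tau w \<noteq> 1 - r"
  proof
    assume t: "tau w = 1 - r"
    then have "V r w = B 0 w + (B 1 w - B (tau w) w)" using V_after[OF w, of r] r by simp
    then show False using tau_le[OF w, of 1] B_0[OF w] neg by simp
  qed
  then have "1 - r < tau w" using a by simp
  then have "B (tau w) w < B u w" if "u \<in> {0..1-r}" for u using tau_less[OF w, of u] that by auto
  then have "B (tau w) w < pmin 0 (1 - r) w" using r w by (subst less_pmin_iff) auto
  moreover have "emin r w \<le> B (tau w) w" using tau_range[OF w] a by (intro emin_le[OF w r]) auto
  ultimately show ?thesis by simp
qed

section \<open>The support of the bridge\<close>

text \<open>
  Along a fine grid, the path is kept near \<open>f\<close> by a sequence of conditions: at each grid point the value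
  lies near \<open>f\<close>, and in each cell the deviation from the chord is small. A new value, given the path so
  far and the final value, has a positive density; the deviation in a cell is independent of everything
  else and small with probability at least \<open>1 / 2\<close> once the mesh is fine.
\<close>

lemma support_theorem:
  fixes f :: "real \<Rightarrow> real"
  assumes f: "continuous_on {0..1} f" "f 0 = 0" "f 1 = lam" and eta: "0 < eta"
  shows "0 < prob {w \<in> space M. \<forall>u\<in>{0..1}. \<bar>B u w - f u\<bar> \<le> eta}"
proof -
  \<comment> \<open>Four errors of size \<open>e\<close> are added below.\<close>
  define e where "e = eta / 8"
  have e: "0 < e" using eta by (simp add: e_def)
  have osc_f: "\<forall>\<^sub>F n in sequentially. \<forall>u\<in>{0..1}. \<forall>v\<in>{0..1}. \<bar>u - v\<bar> \<le> 1 / real (Suc n) \<longrightarrow> \<bar>g u - g v\<bar> < e"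
    if g: "continuous_on {0..1} g" for g :: "real \<Rightarrow> real"
  proof -
    have "uniformly_continuous_on {0..1} g" using g by (rule compact_uniformly_continuous) simp
    then obtain d where d: "0 < d" "\<And>u v. u \<in> {0..1} \<Longrightarrow> v \<in> {0..1} \<Longrightarrow> \<bar>u - v\<bar> < d \<Longrightarrow> \<bar>g u - g v\<bar> < e"
      unfolding uniformly_continuous_on_def dist_real_def using e by metis
    have "\<forall>\<^sub>F n in sequentially. 1 / real (Suc n) < d"
      using order_tendstoD(2)[OF LIMSEQ_inverse_real_of_nat d(1)] by (simp add: inverse_eq_divide)
    then show ?thesis by eventually_elim (use d(2) in force)
  qed
  define bad where "bad n i = {w \<in> space M. \<not> (\<forall>u\<in>{real i / real (Suc n)..real (Suc i) / real (Suc n)}.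
      \<bar>dev (real i / real (Suc n)) (real (Suc i) / real (Suc n)) u w\<bar> \<le> 2 * e)}" for n i
  have grid: "0 \<le> real i / real (Suc n)" "real i / real (Suc n) < real (Suc i) / real (Suc n)" "real (Suc i) / real (Suc n) \<le> 1"
    if "i \<le> n" for i n using that by (auto simp: divide_simps)
  define Bad where "Bad n = (\<Union>i\<in>{..n}. bad n i)" for n
  have good_inner: "space M - bad n i \<in> sets (inner_alg (real i / real (Suc n)) (real (Suc i) / real (Suc n)))" if "i \<le> n" for n i
  proof -
    have "space M - bad n i = {w \<in> space M. \<forall>u\<in>{real i / real (Suc n)..real (Suc i) / real (Suc n)}.
      \<bar>dev (real i / real (Suc n)) (real (Suc i) / real (Suc n)) u w\<bar> \<le> 2 * e}" by (auto simp: bad_def)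
    then show ?thesis using small_dev_event[OF grid[OF that]] by simp
  qed
  have goodM: "space M - bad n i \<in> events" if "i \<le> n" for n i
    using good_inner[OF that] inner_subalgebra[OF grid(1)[OF that] grid(3)[OF that]]
    unfolding subalgebra_def by blast
  have badM: "bad n i \<in> events" if "i \<le> n" for n i
  proof -
    have "bad n i = space M - (space M - bad n i)" by (auto simp: bad_def)
    then show ?thesis using goodM[OF that] by (metis sets.compl_sets)
  qed
  have BadM: "Bad n \<in> events" for n unfolding Bad_def using badM by auto
  have "\<forall>\<^sub>F n in sequentially. prob (Bad n) \<le> 1 / 2"
  proof (rule eventually_prob_le[OF BadM])
    fix w assume w: "w \<in> space M"
    show "\<forall>\<^sub>F n in sequentially. w \<notin> Bad n" using osc_f[OF B_cont[OF w]]
    proof eventually_elim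
      case (elim n)
      have "\<bar>dev (real i / real (Suc n)) (real (Suc i) / real (Suc n)) u w\<bar> \<le> 2 * e"
        if i: "i \<le> n" and u: "u \<in> {real i / real (Suc n)..real (Suc i) / real (Suc n)}" for i u
      proof -
        define p q where "p = real i / real (Suc n)" and "q = real (Suc i) / real (Suc n)"
        have pq: "0 \<le> p" "p < q" "q \<le> 1" "q - p = 1 / real (Suc n)"
          using grid[OF i] by (auto simp: p_def q_def diff_divide_distrib[symmetric])
        have u': "u \<in> {p..q}" using u by (simp add: p_def q_def)
        have near: "\<bar>B v w - B u w\<bar> \<le> e" if "v \<in> {p..q}" for v
          using elim pq u' that by (intro less_imp_le) (auto simp: abs_le_iff)
        have "\<bar>B p w - B u w\<bar> \<le> e" "\<bar>B q w - B u w\<bar> \<le> e" using near pq by auto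
        then have "B u w - e \<le> ((q - u) * B p w + (u - p) * B q w) / (q - p)"
           "((q - u) * B p w + (u - p) * B q w) / (q - p) \<le> B u w + e"
          using interpolation_bounds[OF \<open>p < q\<close> u', of "B u w - e" "B p w" "B q w" "B u w + e"] by auto
        then show ?thesis using e unfolding dev_def p_def[symmetric] q_def[symmetric] by (simp add: abs_le_iff)
      qed
      then show ?case unfolding Bad_def bad_def by blast
    qed
  qed simp
  then have "\<forall>\<^sub>F n in sequentially. prob (Bad n) \<le> 1 / 2 \<and>
      (\<forall>u\<in>{0..1}. \<forall>v\<in>{0..1}. \<bar>u - v\<bar> \<le> 1 / real (Suc n) \<longrightarrow> \<bar>f u - f v\<bar> < e)"
    using osc_f[OF f(1)] by eventually_elim auto
  then obtain n where n: "prob (Bad n) \<le> 1 / 2"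
      "\<And>u v. u \<in> {0..1} \<Longrightarrow> v \<in> {0..1} \<Longrightarrow> \<bar>u - v\<bar> \<le> 1 / real (Suc n) \<Longrightarrow> \<bar>f u - f v\<bar> < e"
    by (auto simp: eventually_sequentially)
  define N where "N = Suc n"
  define x where "x i = real i / real N" for i
  have x: "0 \<le> x i" "x i < x (Suc i)" "x (Suc i) \<le> 1" "x (Suc i) - x i = 1 / real N" if "i \<le> n" for i
    using grid[OF that] by (auto simp: x_def N_def diff_divide_distrib[symmetric])
  have xN: "x N = 1" "x 0 = 0" by (auto simp: x_def N_def)
  have good: "1 / 2 \<le> prob (space M - bad n i)" if "i \<le> n" for i
  proof -
    have "prob (bad n i) \<le> prob (Bad n)" using that BadM by (intro finite_measure_mono) (auto simp: Bad_def)
    then show ?thesis using n(1) prob_compl[OF badM[OF that]] by simp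
  qed
  define S where "S i = {w \<in> space M. (\<forall>u\<in>{0..x i}. \<bar>B u w - f u\<bar> \<le> eta) \<and> \<bar>B (x i) w - f (x i)\<bar> \<le> e}" for i
  have S_outer: "S i \<in> sets (outer (x i) q)" if "x i \<le> 1" "q \<le> 1" for i q
  proof -
    have [measurable]: "B (x i) \<in> borel_measurable (outer (x i) q)" by (rule B_outer) (simp add: x_def)
    have "{w \<in> space (outer (x i) q). \<forall>u\<in>{0..x i}. - eta \<le> - \<bar>B u w - f u\<bar>} \<in> sets (outer (x i) q)"
    proof (rule closed_path_event)
      fix w assume "w \<in> space (outer (x i) q)"
      then show "continuous_on {0..x i} (\<lambda>u. - \<bar>B u w - f u\<bar>)"
        using that f(1) by (intro continuous_intros B_cont_on) (auto elim: continuous_on_subset)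
    next
      fix u assume "u \<in> {0..x i}"
      then have [measurable]: "B u \<in> borel_measurable (outer (x i) q)" by (intro B_outer) auto
      show "(\<lambda>w. - \<bar>B u w - f u\<bar>) \<in> borel_measurable (outer (x i) q)" by measurable
    qed simp
    then have "{w \<in> space M. \<forall>u\<in>{0..x i}. \<bar>B u w - f u\<bar> \<le> eta} \<in> sets (outer (x i) q)" by simp
    moreover have "{w \<in> space (outer (x i) q). \<bar>B (x i) w - f (x i)\<bar> \<le> e} \<in> sets (outer (x i) q)" by measurable
    ultimately have "{w \<in> space M. \<forall>u\<in>{0..x i}. \<bar>B u w - f u\<bar> \<le> eta} \<inter> {w \<in> space (outer (x i) q). \<bar>B (x i) w - f (x i)\<bar> \<le> e} \<in> sets (outer (x i) q)"
      by (rule sets.Int)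
    also have "{w \<in> space M. \<forall>u\<in>{0..x i}. \<bar>B u w - f u\<bar> \<le> eta} \<inter> {w \<in> space (outer (x i) q). \<bar>B (x i) w - f (x i)\<bar> \<le> e} = S i"
      by (auto simp: S_def)
    finally show ?thesis .
  qed
  have x01: "x i \<in> {0..1}" if "i \<le> N" for i using that by (auto simp: x_def N_def divide_simps)
  have SM: "S i \<in> events" if "i \<le> N" for i
    using S_outer[of i 1] outer_subalgebra[of "x i" 1] x01[OF that] by (auto simp: subalgebra_def)
  have pos: "0 < prob (S i)" if "i \<le> N" for i
    using that
  proof (induction i)
    case 0
    have "S 0 = space M" using eta e B_0 f(2) by (auto simp: S_def xN)
    then show ?case by (simp add: prob_space)
  next
    case (Suc i)
    then have i: "i \<le> n" and IH: "0 < prob (S i)" by (auto simp: N_def)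
    note xi = x[OF i]
    define P where "P = {w \<in> space M. \<bar>B (x (Suc i)) w - f (x (Suc i))\<bar> \<le> e}"
    have P_outer: "P \<in> sets (outer (x i) (x (Suc i)))"
    proof -
      have [measurable]: "B (x (Suc i)) \<in> borel_measurable (outer (x i) (x (Suc i)))" using xi by (intro B_outer) auto
      have "{w \<in> space (outer (x i) (x (Suc i))). \<bar>B (x (Suc i)) w - f (x (Suc i))\<bar> \<le> e} \<in> sets (outer (x i) (x (Suc i)))"
        by measurable
      then show ?thesis by (simp add: P_def)
    qed
    have SP_outer: "S i \<inter> P \<in> sets (outer (x i) (x (Suc i)))" using S_outer[of i "x (Suc i)"] P_outer xi by auto
    have SPM: "S i \<inter> P \<in> events"
      using SP_outer outer_subalgebra[of "x i" "x (Suc i)"] xi by (auto simp: subalgebra_def)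
    have SP: "0 < prob (S i \<inter> P)"
    \<comment> \<open>At the last grid point the value is almost surely \<open>lam\<close>; before it, the deviation from the chord to the end has a density.\<close>
    proof (cases "Suc i = N")
      case True
      then have "AE w in M. w \<in> P"
        using B_1 e by (auto simp: P_def xN f(3))
      then have "prob (S i \<inter> P) = prob (S i)"
        using SM[of i] SPM i by (intro finite_measure_eq_AE) (auto simp: N_def)
      then show ?thesis using IH by simp
    next
      case False
      have x1: "x (Suc i) < 1" using False Suc.prems by (simp add: x_def)
      define Z where "Z = dev (x i) 1 (x (Suc i))"
      define s where "s = sqrt ((x (Suc i) - x i) * (1 - x (Suc i)) / (1 - x i))"
      have s: "0 < s" unfolding s_def real_sqrt_gt_0_iff using xi(2) x1 by (intro divide_pos_pos mult_pos_pos) auto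
      have DZ: "distributed M lborel Z (normal_density 0 s)"
        using dev_normal[of "x i" 1 "x (Suc i)"] xi x1 unfolding Z_def s_def by simp
      have indZ: "independent_of (outer (x i) 1) Z" unfolding Z_def using xi x1 by (intro dev_independent_of) auto
      define R where "R w = ((1 - x (Suc i)) * B (x i) w + (x (Suc i) - x i) * lam) / (1 - x i)" for w
      have Rm: "R \<in> borel_measurable (outer (x i) 1)"
      proof -
        have [measurable]: "B (x i) \<in> borel_measurable (outer (x i) 1)" using xi by (intro B_outer) auto
        show ?thesis unfolding R_def[abs_def] by measurable
      qed
      define y where "y = f (x (Suc i))"
      define K where "K = \<bar>f (x i)\<bar> + e + \<bar>lam\<bar> + \<bar>y\<bar>"
      define W where "W w = (indicator (S i) w :: real)" for w
      have "expectation W * (normal_density 0 s (2 * K) * (2 * e)) \<le> expectation (\<lambda>w. W w * indicator {y - e..y + e} (R w + Z w))"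
      proof (rule expectation_smoothing_lower[OF indZ DZ s])
        show "W \<in> borel_measurable (outer (x i) 1)"
          unfolding W_def[abs_def] using S_outer[of i 1] xi by auto
        have "(\<integral>\<^sup>+ v. ennreal (indicator {y - e..y + e} v) \<partial>lborel) = emeasure lborel {y - e..y + e}"
          by (simp add: ennreal_indicator)
        then show "(\<integral>\<^sup>+ v. ennreal (indicator {y - e..y + e} v) \<partial>lborel) = ennreal (2 * e)" using e by simp
        show "\<bar>v\<bar> \<le> K" if "indicator {y - e..y + e} v \<noteq> (0::real)" for v
          using that e by (auto simp: K_def indicator_def split: if_splits)
        fix w assume w: "w \<in> space M" "0 < W w"
        then have "\<bar>B (x i) w - f (x i)\<bar> \<le> e" by (auto simp: W_def S_def indicator_def split: if_splits)
        then have "\<bar>B (x i) w\<bar> \<le> K" "\<bar>lam\<bar> \<le> K" using e by (auto simp: K_def)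
        then show "\<bar>R w\<bar> \<le> K"
          using interpolation_bounds[of "x i" 1 "x (Suc i)" "-K" "B (x i) w" lam K] xi x1
          unfolding R_def by (simp add: abs_le_iff)
      qed (use Rm e in \<open>auto simp: W_def indicator_def\<close>)
      moreover have "expectation W = prob (S i)" unfolding W_def[abs_def] using SM[of i] i by (simp add: N_def)
      moreover have "expectation (\<lambda>w. W w * indicator {y - e..y + e} (R w + Z w)) = expectation (indicator (S i \<inter> P))"
      proof (rule integral_cong_AE)
        have [measurable]: "Z \<in> borel_measurable M" using indZ by (simp add: independent_of_def)
        have [measurable]: "R \<in> borel_measurable M"
          using measurable_from_subalg[OF outer_subalgebra Rm] xi by auto
        have [measurable]: "S i \<in> events" using SM[of i] i by (simp add: N_def)
        show "(\<lambda>w. W w * indicator {y - e..y + e} (R w + Z w)) \<in> borel_measurable M" unfolding W_def by measurable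
        show "AE w in M. W w * indicator {y - e..y + e} (R w + Z w) = indicator (S i \<inter> P) w"
          using B_1
        proof eventually_elim
          case (elim w)
          then have "R w + Z w = B (x (Suc i)) w" by (simp add: R_def Z_def dev_def)
          then show ?case by (auto simp: W_def P_def S_def indicator_def y_def abs_le_iff)
        qed
      qed (use SPM in auto)
      ultimately have "prob (S i) * (normal_density 0 s (2 * K) * (2 * e)) \<le> prob (S i \<inter> P)"
        using SPM by simp
      moreover have "0 < prob (S i) * (normal_density 0 s (2 * K) * (2 * e))"
        using IH e normal_density_pos[OF s] by simp
      ultimately show ?thesis by linarith
    qed
    define H where "H = space M - bad n i"
    have "prob (S i \<inter> P \<inter> H) = prob (S i \<inter> P) * prob H"
      unfolding H_def using good_inner[OF i] SP_outer xi by (intro window_independent[of "x i" "x (Suc i)"]) (auto simp: x_def N_def)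
    moreover have "0 < prob (S i \<inter> P) * prob H" using SP good[OF i] by (simp add: H_def)
    moreover have "S i \<inter> P \<inter> H \<subseteq> S (Suc i)"
    proof
      fix w assume wS: "w \<in> S i \<inter> P \<inter> H"
      then have w: "w \<in> space M" "\<bar>B (x i) w - f (x i)\<bar> \<le> e" "\<bar>B (x (Suc i)) w - f (x (Suc i))\<bar> \<le> e"
         "\<And>u. u \<in> {0..x i} \<Longrightarrow> \<bar>B u w - f u\<bar> \<le> eta"
         "\<And>u. u \<in> {x i..x (Suc i)} \<Longrightarrow> \<bar>dev (x i) (x (Suc i)) u w\<bar> \<le> 2 * e"
        by (auto simp: S_def P_def H_def bad_def x_def N_def)
      have "\<bar>B u w - f u\<bar> \<le> eta" if u: "u \<in> {x i..x (Suc i)}" for u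
      proof -
        have fu: "\<bar>f v - f u\<bar> \<le> e" if "v \<in> {x i, x (Suc i)}" for v
          using n(2)[of v u] that u xi by (intro less_imp_le) (auto simp: N_def abs_le_iff)
        have "\<bar>f (x i) - f u\<bar> \<le> e" "\<bar>f (x (Suc i)) - f u\<bar> \<le> e" using fu by auto
        then have "f u - 2 * e \<le> B (x i) w" "B (x i) w \<le> f u + 2 * e"
           "f u - 2 * e \<le> B (x (Suc i)) w" "B (x (Suc i)) w \<le> f u + 2 * e" using w(2,3) by linarith+
        then have "f u - 2 * e \<le> ((x (Suc i) - u) * B (x i) w + (u - x i) * B (x (Suc i)) w) / (x (Suc i) - x i)"
          "((x (Suc i) - u) * B (x i) w + (u - x i) * B (x (Suc i)) w) / (x (Suc i) - x i) \<le> f u + 2 * e"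
          using interpolation_bounds[OF xi(2) u, of "f u - 2 * e" "B (x i) w" "B (x (Suc i)) w" "f u + 2 * e"] by auto
        moreover have "\<bar>dev (x i) (x (Suc i)) u w\<bar> \<le> 2 * e" using w(5) u by auto
        ultimately have "\<bar>B u w - f u\<bar> \<le> 4 * e" unfolding dev_def by (simp add: abs_le_iff)
        then show ?thesis using e by (simp add: e_def)
      qed
      then have "\<forall>u\<in>{0..x (Suc i)}. \<bar>B u w - f u\<bar> \<le> eta" using w(4) by (metis atLeastAtMost_iff linear)
      then show "w \<in> S (Suc i)" using w(1,3) by (simp add: S_def)
    qed
    then have "prob (S i \<inter> P \<inter> H) \<le> prob (S (Suc i))" using SM[OF Suc.prems] by (intro finite_measure_mono)
    ultimately show ?case by linarith
  qed
  have "S N \<subseteq> {w \<in> space M. \<forall>u\<in>{0..1}. \<bar>B u w - f u\<bar> \<le> eta}" by (auto simp: S_def xN)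
  moreover have "{w \<in> space M. \<forall>u\<in>{0..1}. \<bar>B u w - f u\<bar> \<le> eta} \<in> events"
  proof -
    have "{w \<in> space M. \<forall>u\<in>{0..1}. - eta \<le> - \<bar>B u w - f u\<bar>} \<in> events"
    proof (rule closed_path_event)
      fix u :: real assume "u \<in> {0..1}"
      then have [measurable]: "B u \<in> borel_measurable M" by (rule B_measurable)
      show "(\<lambda>w. - \<bar>B u w - f u\<bar>) \<in> borel_measurable M" by measurable
    qed (use f in \<open>auto intro!: continuous_intros B_cont\<close>)
    then show ?thesis by simp
  qed
  ultimately have "prob (S N) \<le> prob {w \<in> space M. \<forall>u\<in>{0..1}. \<bar>B u w - f u\<bar> \<le> eta}" by (rule finite_measure_mono)
  then show ?thesis using pos[of N] by simp
qed

end

section \<open>The transform after an early return below zero\<close>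

text \<open>
  Continuous test functions with values in \<open>{0..1}\<close> replace indicators, so that a random time can be
  substituted.
\<close>

definition cutoff :: "(real \<Rightarrow> real) \<Rightarrow> bool" where
  "cutoff g \<longleftrightarrow> continuous_on UNIV g \<and> (\<forall>x. 0 \<le> g x \<and> g x \<le> 1)"

lemma cutoffD:
  assumes "cutoff g"
  shows cutoff_cont: "continuous_on UNIV g" and cutoff_nonneg: "0 \<le> g x" and cutoff_le_1: "g x \<le> 1"
    and cutoff_measurable: "g \<in> borel_measurable borel"
  using assms by (auto simp: cutoff_def intro: borel_measurable_continuous_onI)

lemma cutoff_integral:
  assumes g: "cutoff g" and supp: "\<And>x. g x \<noteq> 0 \<Longrightarrow> \<bar>x\<bar> < ep"
  shows "\<exists>J\<ge>0. (\<integral>\<^sup>+x. ennreal (g x) \<partial>lborel) = ennreal J"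
proof -
  have "(\<integral>\<^sup>+x. ennreal (g x) \<partial>lborel) \<le> (\<integral>\<^sup>+x. indicator {-ep..ep} x \<partial>lborel)"
  proof (rule nn_integral_mono)
    fix x show "ennreal (g x) \<le> indicator {-ep..ep} x"
      using cutoff_le_1[OF g, of x] supp[of x] by (cases "g x = 0") (auto simp: indicator_def abs_less_iff)
  qed
  also have "\<dots> < \<infinity>" by (simp add: emeasure_lborel_Icc_eq)
  finally have "(\<integral>\<^sup>+x. ennreal (g x) \<partial>lborel) < top" by simp
  then show ?thesis by (intro exI[of _ "enn2real (\<integral>\<^sup>+x. ennreal (g x) \<partial>lborel)"]) (simp add: enn2real_nonneg)
qed

lemma mult_unit_interval: "0 \<le> x \<Longrightarrow> x \<le> 1 \<Longrightarrow> 0 \<le> y \<Longrightarrow> y \<le> 1 \<Longrightarrow> 0 \<le> x * y \<and> x * y \<le> (1::real)"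
  by (simp add: mult_le_one)

context bridge
begin

lemma outer_mono:
  assumes "{0..a} \<union> {b..1} \<subseteq> {0..p} \<union> {q..1}" "f \<in> borel_measurable (outer a b)"
  shows "f \<in> borel_measurable (outer p q)"
proof (rule measurable_from_subalg[OF _ assms(2)])
  show "subalgebra (outer p q) (outer a b)"
    using sets_generated_algebra_mono[OF assms(1), of M B] by (simp add: subalgebra_def outer_def)
qed

lemma shifted_path_cont:
  assumes "w \<in> space M" "0 < r" "r \<le> u" "u \<le> 1" and g: "cutoff g"
  shows "continuous_on {0..r} (\<lambda>d. g (B (u - d) w + c))"
proof -
  have "continuous_on {0..r} (\<lambda>d. B (u - d) w)"
    by (rule continuous_on_compose2[OF B_cont[OF assms(1)]]) (use assms in \<open>auto intro!: continuous_intros\<close>)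
  then show ?thesis
    by (intro continuous_on_compose2[OF cutoff_cont[OF g]] continuous_intros) auto
qed

text \<open>
  The indicator of the event that the minimum is attained after \<open>1 - r\<close>, and of the weaker condition that
  only looks at the path outside the window \<open>{a..b}\<close>.
\<close>

definition late :: "real \<Rightarrow> 'a \<Rightarrow> real" where
  "late r w = (if emin r w < pmin 0 (1 - r) w then 1 else 0)"

definition late_outside :: "real \<Rightarrow> real \<Rightarrow> real \<Rightarrow> 'a \<Rightarrow> real" where
  "late_outside r a b w = (if emin r w < pmin 0 a w \<and> emin r w < pmin b (1 - r) w then 1 else 0)"

lemma late_measurable: "0 < r \<Longrightarrow> r < 1 \<Longrightarrow> late r \<in> borel_measurable M"
proof -
  assume r: "0 < r" "r < 1"
  have [measurable]: "emin r \<in> borel_measurable M" "pmin 0 (1 - r) \<in> borel_measurable M"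
    unfolding emin_def[abs_def] pmin_def[abs_def] using r by (intro min_on_measurable B_measurable B_cont_on; auto)+
  show ?thesis unfolding late_def[abs_def] by measurable
qed

lemma late_outside_measurable:
  assumes "0 < r" "r < 1" "0 \<le> a" "a \<le> b" "b \<le> 1 - r"
  shows "late_outside r a b \<in> borel_measurable (outer a b)"
proof -
  have [measurable]: "emin r \<in> borel_measurable (outer a b)" "pmin 0 a \<in> borel_measurable (outer a b)"
    "pmin b (1 - r) \<in> borel_measurable (outer a b)"
    using assms by (auto intro!: end_measurable pmin_outer)
  show ?thesis unfolding late_outside_def[abs_def] by measurable
qed

lemma late_le_outside:
  assumes "w \<in> space M" "0 < r" "r < 1" "0 \<le> a" "a \<le> b" "b \<le> 1 - r"
  shows "late r w \<le> late_outside r a b w"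
  using assms by (auto simp: late_def late_outside_def less_pmin_iff)

lemma late_from_outside:
  assumes "w \<in> space M" "0 < r" "r < 1" "0 \<le> a" "a \<le> b" "b \<le> 1 - r"
    and "late_outside r a b w \<noteq> 0" "\<And>u. u \<in> {a..b} \<Longrightarrow> emin r w < B u w"
  shows "late r w = 1"
proof -
  have "emin r w < B u w" if u: "u \<in> {0..1-r}" for u
  proof -
    consider "u \<in> {0..a}" | "u \<in> {a..b}" | "u \<in> {b..1-r}" using u assms(4-6)
      by (metis atLeastAtMost_iff linear)
    then show ?thesis
      using assms by cases (auto simp: late_outside_def less_pmin_iff split: if_splits)
  qed
  then show ?thesis using assms by (simp add: late_def less_pmin_iff)
qed

lemma B_decompose:
  assumes "a < b"
  shows "B u w + c = dev a b u w + ((b - u) * (B a w + c) + (u - a) * (B b w + c)) / (b - a)"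
proof -
  have "(b - u) * (B a w + c) + (u - a) * (B b w + c) = ((b - u) * B a w + (u - a) * B b w) + c * (b - a)"
    by (simp add: algebra_simps)
  then show ?thesis using assms by (simp add: dev_def add_divide_distrib)
qed

end

text \<open>
  Measurability of the transform is part of the Markov property that is to be refuted.
\<close>

locale vervaat_bridge = bridge +
  assumes V_measurable: "u \<in> {0..1} \<Longrightarrow> V u \<in> borel_measurable M"
begin

text \<open>
  A weight that lives on negative values of \<open>V r\<close> may be multiplied by \<open>late r\<close>, and on this event \<open>V\<close> may be
  expressed through the last piece of the path.
\<close>

lemma late_factor:
  assumes "w \<in> space M" "0 < r" "r < 1" and nu: "\<And>v. nu v \<noteq> 0 \<Longrightarrow> v < 0"
    and eq: "\<lbrakk>emin r w < pmin 0 (1 - r) w\<rbrakk> \<Longrightarrow> x = nu (V r w) * y"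
  shows "late r w * x = nu (V r w) * (y :: real)"
proof (cases "emin r w < pmin 0 (1 - r) w")
  case False
  then have "nu (V r w) = 0" using V_neg_late[OF assms(1-3)] nu by blast
  then show ?thesis using False by (simp add: late_def)
qed (simp add: late_def eq)

text \<open>
  Let \<open>d = 1 - tau\<close>. On the event \<open>V r < 0\<close> the transform at a time \<open>u \<ge> r\<close> is \<open>B (u - d) + gap r\<close>, and the
  values at \<open>s\<close> and \<open>T\<close> are the ends of a chord of the bridge over the window \<open>{s-d..T-d}\<close>. For frozen \<open>d\<close> the
  event in hypothesis \<open>F\<close> concerns the deviation from this chord, hence is independent of the values at \<open>r\<close>,
  \<open>s\<close>, \<open>T\<close> and of the last piece of the path. On this event the path stays above \<open>lam\<close> in the window, so
  that the minimum remains late, and the value at \<open>t\<close> is below \<open>- eta\<close>: the chord is at most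
  \<open>ep + ka * ((t - s) / (T - s))\<close> there.
\<close>

lemma negative_after_restart:
  assumes cf: "cutoff nu" "cutoff ph" "cutoff gam" "cutoff psi"
    and nu: "\<And>v. nu v \<noteq> 0 \<Longrightarrow> v < 0" and ph: "\<And>v. ph v \<noteq> 0 \<Longrightarrow> \<bar>v\<bar> < ep"
    and gam: "\<And>v. gam v \<noteq> 0 \<Longrightarrow> \<bar>v\<bar> \<le> ka" and psi: "\<And>v. v \<le> - eta \<Longrightarrow> psi v = 1"
    and times: "0 < r" "r < s" "s < t" "t < T" "T \<le> 1 - r"
    and sizes: "0 < ep" "ep \<le> - lam / 4" "0 < ka" "ka \<le> - lam / 4" "0 \<le> c" "c \<le> 1"
    and F: "\<And>d. d \<in> {0..r} \<Longrightarrow> c \<le> prob {w \<in> space M. dev (s-d) (T-d) (t-d) w \<le> - (eta + ep + ka * ((t - s) / (T - s))) \<and>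
        (\<forall>u\<in>{s-d..T-d}. \<bar>dev (s-d) (T-d) u w\<bar> \<le> - lam / 8)}"
  shows "c * expectation (\<lambda>w. nu (V r w) * (ph (V s w) * gam (V T w))) \<le>
    expectation (\<lambda>w. nu (V r w) * (ph (V s w) * gam (V T w) * psi (V t w)))"
proof -
  have r1: "r < 1" using times by simp
  note nn = cutoff_nonneg[OF cf(1)] cutoff_nonneg[OF cf(2)] cutoff_nonneg[OF cf(3)] cutoff_nonneg[OF cf(4)]
  note le1 = cutoff_le_1[OF cf(1)] cutoff_le_1[OF cf(2)] cutoff_le_1[OF cf(3)] cutoff_le_1[OF cf(4)]
  note [measurable] = cutoff_measurable[OF cf(1)] cutoff_measurable[OF cf(2)] cutoff_measurable[OF cf(3)] cutoff_measurable[OF cf(4)]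
  define q where "q d w = nu (B (r - d) w + gap r w) * (ph (B (s - d) w + gap r w) * gam (B (T - d) w + gap r w))" for d w
  define p where "p d w = psi (B (t - d) w + gap r w)" for d w
  have q01: "0 \<le> q d w" "q d w \<le> 1" for d w
    unfolding q_def using nn le1 by (auto intro!: mult_nonneg_nonneg mult_le_one)
  have p01: "0 \<le> p d w" "p d w \<le> 1" for d w unfolding p_def using nn le1 by auto
  have late01: "0 \<le> late r w" "late r w \<le> 1" for w by (auto simp: late_def)
  have Bd: "(\<lambda>w. B (u - d) w) \<in> borel_measurable M" if "d \<in> {0..r}" "u \<in> {r, s, t, T}" for u d
    using that times by (intro B_measurable) auto
  have gapM[measurable]: "gap r \<in> borel_measurable M"
    using end_measurable(3)[OF times(1) r1, of "1 - r" 0] outer_subalgebra[of 0 "1 - r"] times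
    by (auto intro: measurable_from_subalg)
  have lateM[measurable]: "late r \<in> borel_measurable M" using times(1) r1 by (rule late_measurable)
  have qM[measurable]: "q d \<in> borel_measurable M" and pM[measurable]: "p d \<in> borel_measurable M" if d: "d \<in> {0..r}" for d
  proof -
    have [measurable]: "(\<lambda>w. B (r - d) w) \<in> borel_measurable M" "(\<lambda>w. B (s - d) w) \<in> borel_measurable M"
      "(\<lambda>w. B (T - d) w) \<in> borel_measurable M" "(\<lambda>w. B (t - d) w) \<in> borel_measurable M"
      using Bd[OF d] by auto
    show "q d \<in> borel_measurable M" unfolding q_def[abs_def] by measurable
    show "p d \<in> borel_measurable M" unfolding p_def[abs_def] by measurable
  qed
  have key: "expectation (\<lambda>w. c * (late r w * q (1 - etau r w) w)) \<le>
      expectation (\<lambda>w. late r w * (q (1 - etau r w) w * p (1 - etau r w) w))"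
  proof (rule random_time_substitution[where G="end_alg r" and a=0 and b=r and C=1 and dl="\<lambda>w. 1 - etau r w"
        and X="\<lambda>d w. c * (late r w * q d w)" and Z="\<lambda>d w. late r w * (q d w * p d w)"])
    show "subalgebra M (end_alg r)" by (rule end_alg_subalgebra[OF r1])
    have [measurable]: "etau r \<in> borel_measurable (end_alg r)" by (rule etau_end_alg[OF times(1) r1])
    show "(\<lambda>w. 1 - etau r w) \<in> borel_measurable (end_alg r)" by measurable
    show "1 - etau r w \<in> {0..r}" if "w \<in> space M" for w using etau_range[OF that times(1) r1] by auto
  next
    fix d assume d: "d \<in> {0..r}"
    note [measurable] = qM[OF d] pM[OF d]
    show "(\<lambda>w. c * (late r w * q d w)) \<in> borel_measurable M" "(\<lambda>w. late r w * (q d w * p d w)) \<in> borel_measurable M"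
      by measurable
  next
    fix d w
    show "\<bar>c * (late r w * q d w)\<bar> \<le> 1" "\<bar>late r w * (q d w * p d w)\<bar> \<le> 1"
      using sizes q01[of d w] p01[of d w] late01[of w] by (auto simp: abs_mult intro!: mult_le_one)
  next
    fix w assume w: "w \<in> space M"
    note cc = shifted_path_cont[OF w times(1), where c="gap r w"]
    show "continuous_on {0..r} (\<lambda>d. c * (late r w * q d w))" "continuous_on {0..r} (\<lambda>d. late r w * (q d w * p d w))"
      unfolding q_def p_def using times cf by (intro continuous_intros cc; simp)+
  next
    fix E d assume E: "E \<in> sets (end_alg r)" and d: "d \<in> {0..r}"
    define a b where "a = s - d" and "b = T - d"
    have ab: "0 \<le> a" "a < b" "b \<le> 1 - r" "b \<le> 1" using d times by (auto simp: a_def b_def)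
    have sub: "subalgebra M (outer a b)" using ab by (intro outer_subalgebra) auto
    \<comment> \<open>\<open>W\<close> collects what the path outside the window determines.\<close>
    define W where "W w = indicator E w * late_outside r a b w * q d w" for w
    have EG: "E \<in> sets (outer a b)" using E end_alg_outer[of b r a] ab by auto
    have WG: "W \<in> borel_measurable (outer a b)"
    proof -
      have [measurable]: "(\<lambda>w. B (r - d) w) \<in> borel_measurable (outer a b)" "(\<lambda>w. B (s - d) w) \<in> borel_measurable (outer a b)"
        "(\<lambda>w. B (T - d) w) \<in> borel_measurable (outer a b)"
        using d times by (auto intro!: B_outer simp: a_def b_def)
      have [measurable]: "gap r \<in> borel_measurable (outer a b)" "late_outside r a b \<in> borel_measurable (outer a b)"
        using ab times r1 by (auto intro!: end_measurable late_outside_measurable)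
      note [measurable] = EG
      show ?thesis unfolding W_def[abs_def] q_def by measurable
    qed
    have WM: "W \<in> borel_measurable M" by (rule measurable_from_subalg[OF sub WG])
    have W01: "0 \<le> W w" "W w \<le> 1" for w
      unfolding W_def using q01[of d w] by (auto simp: indicator_def late_outside_def)
    define H where "H = {w \<in> space M. dev a b (t-d) w \<le> - (eta + ep + ka * ((t - s) / (T - s))) \<and>
        (\<forall>u\<in>{a..b}. \<bar>dev a b u w\<bar> \<le> - lam / 8)}"
    have H_inner: "H \<in> sets (inner_alg a b)"
    proof -
      have [measurable]: "dev a b (t - d) \<in> borel_measurable (inner_alg a b)"
        using times by (intro dev_inner) (auto simp: a_def b_def)
      have "{w \<in> space (inner_alg a b). dev a b (t-d) w \<le> - (eta + ep + ka * ((t - s) / (T - s)))} \<in> sets (inner_alg a b)"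
        by measurable
      then have "{w \<in> space (inner_alg a b). dev a b (t-d) w \<le> - (eta + ep + ka * ((t - s) / (T - s)))} \<inter>
         {w \<in> space M. \<forall>u\<in>{a..b}. \<bar>dev a b u w\<bar> \<le> - lam / 8} \<in> sets (inner_alg a b)"
        using small_dev_event[OF ab(1,2,4)] by (intro sets.Int)
      also have "{w \<in> space (inner_alg a b). dev a b (t-d) w \<le> - (eta + ep + ka * ((t - s) / (T - s)))} \<inter>
         {w \<in> space M. \<forall>u\<in>{a..b}. \<bar>dev a b u w\<bar> \<le> - lam / 8} = H" by (auto simp: H_def)
      finally show ?thesis .
    qed
    have HM: "H \<in> events" using H_inner inner_subalgebra[OF ab(1,4)] by (auto simp: subalgebra_def)
    have cH: "c \<le> prob H" using F[OF d] by (simp add: H_def a_def b_def)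
    have iW: "integrable M W" by (rule integrable_bounded_rv[OF WM, where C=1]) (use W01 in auto)
    have EM: "E \<in> events" using EG sub by (auto simp: subalgebra_def)
    note [measurable] = qM[OF d] pM[OF d] EM HM WM
    have "expectation (\<lambda>w. indicator E w * (c * (late r w * q d w))) \<le> expectation (\<lambda>w. c * W w)"
    proof (rule integral_mono)
      show "integrable M (\<lambda>w. indicator E w * (c * (late r w * q d w)))"
        by (rule integrable_bounded_rv[where C=1])
          (use sizes q01 late01 in \<open>auto simp: abs_mult indicator_def intro!: mult_le_one\<close>)
      fix w assume w: "w \<in> space M"
      have "late r w * q d w \<le> late_outside r a b w * q d w"
        using late_le_outside[OF w times(1) r1, of a b] ab q01 by (intro mult_right_mono) auto
      then show "indicator E w * (c * (late r w * q d w)) \<le> c * W w"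
        using sizes by (auto simp: W_def indicator_def intro!: mult_left_mono)
    qed (use iW in simp)
    also have "\<dots> = c * expectation W" by simp
    also have "\<dots> \<le> expectation W * prob H"
    proof -
      have "0 \<le> expectation W" by (rule integral_nonneg_AE) (use W01 in auto)
      then show ?thesis using mult_left_mono[OF cH, of "expectation W"] by (simp only: mult.commute[of c])
    qed
    also have "\<dots> = expectation (\<lambda>w. W w * indicator H w)"
      using window_independent[OF ab(1,2,4) _ H_inner] WG W01 HM
      by (intro expectation_mult_independent_event[OF sub, symmetric, where C=1]) auto
    also have "\<dots> \<le> expectation (\<lambda>w. indicator E w * (late r w * (q d w * p d w)))"
    proof (rule integral_mono_AE)
      show "integrable M (\<lambda>w. W w * indicator H w)"
        by (rule integrable_bounded_rv[where C=1]) (use W01 in \<open>auto simp: indicator_def\<close>)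
      show "integrable M (\<lambda>w. indicator E w * (late r w * (q d w * p d w)))"
        by (rule integrable_bounded_rv[where C=1])
          (use p01 q01 late01 in \<open>auto simp: abs_mult indicator_def intro!: mult_le_one\<close>)
      show "AE w in M. W w * indicator H w \<le> indicator E w * (late r w * (q d w * p d w))"
        using B_1 AE_space
      proof eventually_elim
        case (elim w)
        show ?case
        proof (cases "W w = 0 \<or> w \<notin> H")
          case True
          then show ?thesis using p01[of d w] q01[of d w] late01[of w] by (auto simp: indicator_def)
        next
          case False
          then have wH: "w \<in> H" and W0: "w \<in> E" "late_outside r a b w \<noteq> 0" "q d w \<noteq> 0"
            by (auto simp: W_def indicator_def)
          define x z where "x = B a w + gap r w" and "z = B b w + gap r w"
          have x: "\<bar>x\<bar> < ep" using W0(3) ph by (auto simp: q_def x_def a_def)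
          have z: "\<bar>z\<bar> \<le> ka" using W0(3) gam by (auto simp: q_def z_def b_def)
          have dec: "B u w + gap r w = dev a b u w + ((b - u) * x + (u - a) * z) / (b - a)" for u
            unfolding x_def z_def by (rule B_decompose[OF ab(2)])
          have "emin r w < B u w" if u: "u \<in> {a..b}" for u
          proof -
            have "lam / 4 \<le> ((b - u) * x + (u - a) * z) / (b - a)"
              using interpolation_bounds(1)[OF ab(2) u, of "lam / 4" x z "ep + ka"] x z sizes by auto
            moreover have "lam / 8 \<le> dev a b u w" using wH u by (force simp: H_def abs_le_iff)
            ultimately have "lam < B u w + gap r w" using dec[of u] lam_neg by linarith
            then show ?thesis using elim by (simp add: gap_def)
          qed
          then have l1: "late r w = 1"
            using elim ab W0 times r1 by (intro late_from_outside[of w r a b]) auto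
          have "((b - (t-d)) * x + ((t-d) - a) * z) / (b - a) \<le> ep + ka * ((t - s) / (T - s))"
          proof -
            have "(T - t) * x \<le> (T - t) * ep"
              using x times by (intro mult_left_mono) auto
            also have "\<dots> \<le> (T - s) * ep" using times sizes by (intro mult_right_mono) auto
            finally have f1: "(T - t) * x \<le> (T - s) * ep" .
            have f2: "(t - s) * z \<le> ka * (t - s)"
              using z times by (subst mult.commute) (intro mult_right_mono, auto)
            have "((T - t) * x + (t - s) * z) / (T - s) \<le> ((T - s) * ep + ka * (t - s)) / (T - s)"
              by (rule divide_right_mono[OF add_mono[OF f1 f2]]) (use times in simp)
            then show ?thesis using times by (simp add: a_def b_def add_divide_distrib)
          qed
          moreover have "dev a b (t-d) w \<le> - (eta + ep + ka * ((t - s) / (T - s)))" using wH by (simp add: H_def)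
          ultimately have "B (t - d) w + gap r w \<le> - eta" using dec[of "t - d"] by linarith
          then have "p d w = 1" unfolding p_def by (rule psi)
          then show ?thesis using l1 W0 wH q01[of d w] by (auto simp: W_def indicator_def late_outside_def)
        qed
      qed
    qed
    finally show "expectation (\<lambda>w. indicator E w * (c * (late r w * q d w))) \<le>
      expectation (\<lambda>w. indicator E w * (late r w * (q d w * p d w)))" .
  qed
  have Vlate: "V u w = B (u - (1 - etau r w)) w + gap r w" if "w \<in> space M" "emin r w < pmin 0 (1 - r) w" "u \<in> {r, s, t, T}" for u w
    using that times r1 by (intro late_V[OF that(1) times(1) r1 that(2)]) auto
  have e1: "late r w * q (1 - etau r w) w = nu (V r w) * (ph (V s w) * gam (V T w))" if w: "w \<in> space M" for w
    by (rule late_factor[OF w times(1) r1 nu]) (simp_all add: q_def Vlate[OF w])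
  have e2: "late r w * (q (1 - etau r w) w * p (1 - etau r w) w) = nu (V r w) * (ph (V s w) * gam (V T w) * psi (V t w))" if w: "w \<in> space M" for w
    by (rule late_factor[OF w times(1) r1 nu]) (simp_all add: q_def p_def Vlate[OF w])
  have "c * expectation (\<lambda>w. nu (V r w) * (ph (V s w) * gam (V T w))) = expectation (\<lambda>w. c * (late r w * q (1 - etau r w) w))"
    by (subst integral_mult_right_zero[symmetric], rule Bochner_Integration.integral_cong) (auto simp: e1)
  also note key
  also have "expectation (\<lambda>w. late r w * (q (1 - etau r w) w * p (1 - etau r w) w)) =
      expectation (\<lambda>w. nu (V r w) * (ph (V s w) * gam (V T w) * psi (V t w)))"
    by (rule Bochner_Integration.integral_cong) (auto simp: e2)
  finally show ?thesis .
qed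

end

context vervaat_bridge
begin

section \<open>The law of the transform at a fixed time\<close>

text \<open>
  The value \<open>V s\<close> is again \<open>B (s - d) + gap r\<close> for \<open>d = 1 - tau\<close>. Given the path outside the window
  \<open>{s-h-d..s+h-d}\<close>, whose ends are kept in a bounded region by \<open>ze\<close>, it has a Gaussian density. The
  deviations in the two halves of the window are independent of this value; each of them is small with
  probability at least \<open>1 / 2\<close>, and then the path stays above \<open>lam\<close> in the window and the minimum remains
  late. This accounts for the factor \<open>1 / 4\<close>.
\<close>

lemma density_minorant:
  assumes cf: "cutoff nu" "cutoff ze" "cutoff ph"
    and nu: "\<And>v. nu v \<noteq> 0 \<Longrightarrow> v < 0" and ph: "\<And>v. ph v \<noteq> 0 \<Longrightarrow> \<bar>v\<bar> \<le> - lam / 2"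
    and ze: "\<And>v. ze v \<noteq> 0 \<Longrightarrow> \<bar>v\<bar> \<le> - lam / 2"
    and times: "0 < r" "r < s - h" "0 < h" "s + h \<le> 1 - r"
    and good: "\<And>d. d \<in> {0..r} \<Longrightarrow> 1 / 2 \<le> prob {w \<in> space M. \<forall>u\<in>{s-h-d..s-d}. \<bar>dev (s-h-d) (s-d) u w\<bar> \<le> - lam / 8}"
      "\<And>d. d \<in> {0..r} \<Longrightarrow> 1 / 2 \<le> prob {w \<in> space M. \<forall>u\<in>{s-d..s+h-d}. \<bar>dev (s-d) (s+h-d) u w\<bar> \<le> - lam / 8}"
    and J: "(\<integral>\<^sup>+y. ennreal (ph y) \<partial>lborel) = ennreal J" "0 \<le> J"
  shows "normal_density 0 (sqrt (h / 2)) lam / 4 * J * expectation (\<lambda>w. nu (V r w) * (ze (V (s - h) w) * ze (V (s + h) w))) \<le>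
    expectation (\<lambda>w. nu (V r w) * ph (V s w))"
proof -
  define ga where "ga = normal_density 0 (sqrt (h / 2)) lam / 4 * J"
  have r1: "r < 1" using times by simp
  have ga0: "0 \<le> ga" using J by (simp add: ga_def)
  note nn = cutoff_nonneg[OF cf(1)] cutoff_nonneg[OF cf(2)] cutoff_nonneg[OF cf(3)]
  note le1 = cutoff_le_1[OF cf(1)] cutoff_le_1[OF cf(2)] cutoff_le_1[OF cf(3)]
  note [measurable] = cutoff_measurable[OF cf(1)] cutoff_measurable[OF cf(2)] cutoff_measurable[OF cf(3)]
  define q where "q d w = nu (B (r - d) w + gap r w) * (ze (B (s - h - d) w + gap r w) * ze (B (s + h - d) w + gap r w))" for d w
  define n where "n d w = nu (B (r - d) w + gap r w)" for d w
  define p where "p d w = ph (B (s - d) w + gap r w)" for d w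
  have q01: "0 \<le> q d w" "q d w \<le> 1" for d w
    unfolding q_def using nn le1 by (auto intro!: mult_nonneg_nonneg mult_le_one)
  have qn: "q d w \<le> n d w" for d w
    unfolding q_def n_def using nn le1 by (intro mult_left_le) (auto intro!: mult_le_one)
  have p01: "0 \<le> p d w" "p d w \<le> 1" for d w unfolding p_def using nn le1 by auto
  have n01: "0 \<le> n d w" "n d w \<le> 1" for d w unfolding n_def using nn le1 by auto
  have late01: "0 \<le> late r w" "late r w \<le> 1" for w by (auto simp: late_def)
  have Bd: "(\<lambda>w. B (u - d) w) \<in> borel_measurable M" if "d \<in> {0..r}" "u \<in> {r, s - h, s, s + h}" for u d
    using that times by (intro B_measurable) auto
  have gapM[measurable]: "gap r \<in> borel_measurable M"
    using end_measurable(3)[OF times(1) r1, of "1 - r" 0] outer_subalgebra[of 0 "1 - r"] r1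
    by (auto intro: measurable_from_subalg)
  have lateM[measurable]: "late r \<in> borel_measurable M" using times(1) r1 by (rule late_measurable)
  have qM: "q d \<in> borel_measurable M" and pM: "p d \<in> borel_measurable M" and nM: "n d \<in> borel_measurable M" if d: "d \<in> {0..r}" for d
  proof -
    have [measurable]: "(\<lambda>w. B (r - d) w) \<in> borel_measurable M" "(\<lambda>w. B (s - h - d) w) \<in> borel_measurable M"
      "(\<lambda>w. B (s - d) w) \<in> borel_measurable M" "(\<lambda>w. B (s + h - d) w) \<in> borel_measurable M"
      using Bd[OF d] by auto
    show "q d \<in> borel_measurable M" unfolding q_def[abs_def] by measurable
    show "p d \<in> borel_measurable M" unfolding p_def[abs_def] by measurable
    show "n d \<in> borel_measurable M" unfolding n_def[abs_def] by measurable
  qed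
  have key: "expectation (\<lambda>w. ga * (late r w * q (1 - etau r w) w)) \<le>
      expectation (\<lambda>w. late r w * (n (1 - etau r w) w * p (1 - etau r w) w))"
  proof (rule random_time_substitution[where G="end_alg r" and a=0 and b=r and C="1 + ga" and dl="\<lambda>w. 1 - etau r w"
        and X="\<lambda>d w. ga * (late r w * q d w)" and Z="\<lambda>d w. late r w * (n d w * p d w)"])
    show "subalgebra M (end_alg r)" by (rule end_alg_subalgebra[OF r1])
    have [measurable]: "etau r \<in> borel_measurable (end_alg r)" by (rule etau_end_alg[OF times(1) r1])
    show "(\<lambda>w. 1 - etau r w) \<in> borel_measurable (end_alg r)" by measurable
    show "1 - etau r w \<in> {0..r}" if "w \<in> space M" for w using etau_range[OF that times(1) r1] by auto
  next
    fix d assume d: "d \<in> {0..r}"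
    note [measurable] = qM[OF d] pM[OF d] nM[OF d]
    show "(\<lambda>w. ga * (late r w * q d w)) \<in> borel_measurable M" "(\<lambda>w. late r w * (n d w * p d w)) \<in> borel_measurable M"
      by measurable
  next
    fix d w
    have 1: "\<bar>late r w * q d w\<bar> \<le> 1" "\<bar>late r w * (n d w * p d w)\<bar> \<le> 1"
      using q01[of d w] p01[of d w] n01[of d w] late01[of w] by (auto simp: abs_mult intro!: mult_le_one)
    then show "\<bar>late r w * (n d w * p d w)\<bar> \<le> 1 + ga" using ga0 by linarith
    have "\<bar>ga * (late r w * q d w)\<bar> \<le> ga * 1" using mult_left_mono[OF 1(1) ga0] ga0 by (simp only: abs_mult[of ga] abs_of_nonneg)
    then show "\<bar>ga * (late r w * q d w)\<bar> \<le> 1 + ga" by simp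
  next
    fix w assume w: "w \<in> space M"
    note cc = shifted_path_cont[OF w times(1), where c="gap r w"]
    show "continuous_on {0..r} (\<lambda>d. ga * (late r w * q d w))" "continuous_on {0..r} (\<lambda>d. late r w * (n d w * p d w))"
      unfolding q_def p_def n_def using times cf by (intro continuous_intros cc; simp)+
  next
    fix E d assume E: "E \<in> sets (end_alg r)" and d: "d \<in> {0..r}"
    define a m b where "a = s - h - d" and "m = s - d" and "b = s + h - d"
    have ab: "0 \<le> a" "a < m" "m < b" "b \<le> 1 - r" "a < b" "b \<le> 1" "0 \<le> m" "m \<le> 1" using d times by (auto simp: a_def b_def m_def)
    have sub: "subalgebra M (outer a b)" using ab by (intro outer_subalgebra) auto
    \<comment> \<open>\<open>W\<close> collects what the path outside the window determines.\<close>
    define W where "W w = indicator E w * late_outside r a b w * q d w" for w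
    have EG: "E \<in> sets (outer a b)" using E end_alg_outer[of b r a] ab by auto
    have WG: "W \<in> borel_measurable (outer a b)"
    proof -
      have [measurable]: "(\<lambda>w. B (r - d) w) \<in> borel_measurable (outer a b)" "(\<lambda>w. B (s - h - d) w) \<in> borel_measurable (outer a b)"
        "(\<lambda>w. B (s + h - d) w) \<in> borel_measurable (outer a b)"
        using d times by (auto intro!: B_outer simp: a_def b_def)
      have [measurable]: "gap r \<in> borel_measurable (outer a b)" "late_outside r a b \<in> borel_measurable (outer a b)"
        using ab times r1 by (auto intro!: end_measurable late_outside_measurable)
      note [measurable] = EG
      show ?thesis unfolding W_def[abs_def] q_def by measurable
    qed
    have WM: "W \<in> borel_measurable M" by (rule measurable_from_subalg[OF sub WG])
    have W01: "0 \<le> W w" "W w \<le> 1" for w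
      unfolding W_def using q01[of d w] by (auto simp: indicator_def late_outside_def)
    define H1 where "H1 = {w \<in> space M. \<forall>u\<in>{a..m}. \<bar>dev a m u w\<bar> \<le> - lam / 8}"
    define H2 where "H2 = {w \<in> space M. \<forall>u\<in>{m..b}. \<bar>dev m b u w\<bar> \<le> - lam / 8}"
    have H1_inner: "H1 \<in> sets (inner_alg a m)" unfolding H1_def using ab by (intro small_dev_event) auto
    have H2_inner: "H2 \<in> sets (inner_alg m b)" unfolding H2_def using ab by (intro small_dev_event) auto
    have H2_outer: "H2 \<in> sets (outer a m)" unfolding H2_def using ab by (intro small_dev_event_outer) auto
    have HM: "H1 \<in> events" "H2 \<in> events"
      using H1_inner H2_inner inner_subalgebra[of a m] inner_subalgebra[of m b] ab by (auto simp: subalgebra_def)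
    have pH: "1 / 2 \<le> prob H1" "1 / 2 \<le> prob H2" using good[OF d] by (simp_all add: H1_def H2_def a_def b_def m_def)
    have EM: "E \<in> events" using EG sub by (auto simp: subalgebra_def)
    note [measurable] = qM[OF d] pM[OF d] nM[OF d] EM HM WM
    define W1 where "W1 w = W w * p d w" for w
    have W1_meas: "W1 \<in> borel_measurable (outer a' b')" if "{0..a} \<union> {b..1} \<subseteq> {0..a'} \<union> {b'..1}" "m \<in> {0..a'} \<union> {b'..1}" for a' b'
    proof -
      have [measurable]: "W \<in> borel_measurable (outer a' b')" by (rule outer_mono[OF that(1) WG])
      have [measurable]: "(\<lambda>w. B (s - d) w) \<in> borel_measurable (outer a' b')" using that(2) by (intro B_outer) (simp add: m_def)
      have [measurable]: "gap r \<in> borel_measurable (outer a' b')"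
        by (rule outer_mono[OF that(1) end_measurable(3)]) (use times r1 ab in auto)
      show ?thesis unfolding W1_def[abs_def] p_def by measurable
    qed
    have W101: "0 \<le> W1 w" "W1 w \<le> 1" for w unfolding W1_def using W01[of w] p01[of d w] by (auto intro: mult_le_one)
    have W1M[measurable]: "W1 \<in> borel_measurable M" unfolding W1_def[abs_def] by measurable
    have iW: "integrable M W" by (rule integrable_bounded_rv[OF WM, where C=1]) (use W01 in auto)
    have eW1: "0 \<le> expectation W1" by (rule integral_nonneg_AE) (use W101 in auto)
    have "expectation (\<lambda>w. indicator E w * (ga * (late r w * q d w))) \<le> expectation (\<lambda>w. ga * W w)"
    proof (rule integral_mono)
      show "integrable M (\<lambda>w. indicator E w * (ga * (late r w * q d w)))"
      proof (rule integrable_bounded_rv[where C="ga * 1"])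
        fix w
        have "ga * (late r w * q d w) \<le> ga * 1" using q01[of d w] late01[of w] ga0 by (intro mult_left_mono mult_le_one) auto
        then show "\<bar>indicator E w * (ga * (late r w * q d w))\<bar> \<le> ga * 1"
          using q01[of d w] late01[of w] ga0 by (auto simp: indicator_def abs_mult)
      qed measurable
      fix w assume w: "w \<in> space M"
      have "late r w * q d w \<le> late_outside r a b w * q d w"
        using late_le_outside[OF w times(1) r1, of a b] ab q01 by (intro mult_right_mono) auto
      then show "indicator E w * (ga * (late r w * q d w)) \<le> ga * W w"
        using ga0 by (auto simp: W_def indicator_def intro!: mult_left_mono)
    qed (use iW in simp)
    also have "\<dots> = (expectation W * (normal_density 0 (sqrt (h / 2)) (2 * (- lam / 2)) * J)) / 4"
      by (simp add: ga_def normal_density_def)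
    also have "expectation W * (normal_density 0 (sqrt (h / 2)) (2 * (- lam / 2)) * J) \<le> expectation W1"
    proof -
      define R where "R w = ((b - m) * (B a w + gap r w) + (m - a) * (B b w + gap r w)) / (b - a)" for w
      have Rm: "R \<in> borel_measurable (outer a b)"
      proof -
        have [measurable]: "B a \<in> borel_measurable (outer a b)" "B b \<in> borel_measurable (outer a b)"
          "gap r \<in> borel_measurable (outer a b)"
          using ab times r1 by (auto intro!: B_outer end_measurable)
        show ?thesis unfolding R_def[abs_def] by measurable
      qed
      have sq: "(m - a) * (b - m) / (b - a) = h / 2" using times by (simp add: a_def b_def m_def)
      have "expectation W * (normal_density 0 (sqrt (h / 2)) (2 * (- lam / 2)) * J) \<le>
        expectation (\<lambda>w. W w * ph (R w + dev a b m w))"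
      proof (rule expectation_smoothing_lower[OF dev_independent_of])
        show "distributed M lborel (dev a b m) (normal_density 0 (sqrt (h / 2)))"
          using dev_normal[of a b m] ab unfolding sq by simp
        fix w assume w: "w \<in> space M" "0 < W w"
        then have "q d w \<noteq> 0" by (auto simp: W_def)
        then have "\<bar>B a w + gap r w\<bar> \<le> - lam / 2" "\<bar>B b w + gap r w\<bar> \<le> - lam / 2"
          using ze by (auto simp: q_def a_def b_def)
        then have "lam / 2 \<le> B a w + gap r w" "B a w + gap r w \<le> - lam / 2"
          "lam / 2 \<le> B b w + gap r w" "B b w + gap r w \<le> - lam / 2" by linarith+
        then have "lam / 2 \<le> R w" "R w \<le> - lam / 2"
          using interpolation_bounds[of a b m "lam / 2" "B a w + gap r w" "B b w + gap r w" "- lam / 2"] ab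
          unfolding R_def by auto
        then show "\<bar>R w\<bar> \<le> - lam / 2" by linarith
      qed (use ab times WG W01 Rm nn le1 J ph in auto)
      also have "(\<lambda>w. W w * ph (R w + dev a b m w)) = W1"
      proof
        fix w
        have "R w + dev a b m w = B (s - d) w + gap r w"
          using B_decompose[OF \<open>a < b\<close>, of m w "gap r w"] by (simp add: R_def m_def)
        then show "W w * ph (R w + dev a b m w) = W1 w" by (simp add: W1_def p_def)
      qed
      finally show ?thesis .
    qed
    then have "expectation W * (normal_density 0 (sqrt (h / 2)) (2 * (- lam / 2)) * J) / 4 \<le> expectation W1 / 4" by simp
    also have "expectation W1 / 4 \<le> expectation (\<lambda>w. W1 w * indicator H2 w) * prob H1"
    proof -
      have "expectation W1 * (1 / 2) \<le> expectation W1 * prob H2" using pH(2) eW1 by (intro mult_left_mono)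
      also have "\<dots> = expectation (\<lambda>w. W1 w * indicator H2 w)"
        using window_independent[OF ab(7,3,6) _ H2_inner] W101 HM ab
        by (intro expectation_mult_independent_event[OF outer_subalgebra[of m b], symmetric, where C=1] W1_meas) auto
      finally have "expectation W1 / 2 * (1 / 2) \<le> expectation (\<lambda>w. W1 w * indicator H2 w) * prob H1"
        using pH(1) eW1 by (intro mult_mono) auto
      then show ?thesis by simp
    qed
    also have "\<dots> = expectation (\<lambda>w. (W1 w * indicator H2 w) * indicator H1 w)"
    proof (rule expectation_mult_independent_event[OF outer_subalgebra[of a m], symmetric, where C=1])
      have [measurable]: "W1 \<in> borel_measurable (outer a m)" using ab by (intro W1_meas) auto
      note [measurable] = H2_outer
      show "(\<lambda>w. W1 w * indicator H2 w) \<in> borel_measurable (outer a m)" by measurable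
    qed (use window_independent[OF ab(1,2,8) _ H1_inner] W101 HM ab in \<open>auto simp: indicator_def\<close>)
    also have "\<dots> \<le> expectation (\<lambda>w. indicator E w * (late r w * (n d w * p d w)))"
    proof (rule integral_mono_AE)
      show "integrable M (\<lambda>w. (W1 w * indicator H2 w) * indicator H1 w)"
        by (rule integrable_bounded_rv[where C=1]) (use W101 in \<open>auto simp: indicator_def\<close>)
      show "integrable M (\<lambda>w. indicator E w * (late r w * (n d w * p d w)))"
        by (rule integrable_bounded_rv[where C=1])
          (use p01 n01 late01 in \<open>auto simp: abs_mult indicator_def intro!: mult_le_one\<close>)
      show "AE w in M. (W1 w * indicator H2 w) * indicator H1 w \<le> indicator E w * (late r w * (n d w * p d w))"
        using B_1 AE_space
      proof eventually_elim
        case (elim w)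
        show ?case
        proof (cases "W1 w = 0 \<or> w \<notin> H1 \<or> w \<notin> H2")
          case True
          then show ?thesis using p01[of d w] n01[of d w] late01[of w] by (auto simp: indicator_def)
        next
          case False
          then have wH: "w \<in> H1" "w \<in> H2" and W0: "w \<in> E" "late_outside r a b w \<noteq> 0" "q d w \<noteq> 0" "p d w \<noteq> 0"
            by (auto simp: W1_def W_def indicator_def)
          define x y z where "x = B a w + gap r w" and "y = B m w + gap r w" and "z = B b w + gap r w"
          have xyz: "\<bar>x\<bar> \<le> - lam / 2" "\<bar>y\<bar> \<le> - lam / 2" "\<bar>z\<bar> \<le> - lam / 2"
            using W0(3,4) ze ph by (auto simp: q_def p_def x_def y_def z_def a_def b_def m_def)
          have "emin r w < B u w" if u: "u \<in> {a..b}" for u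
          proof -
            have "lam < B u w + gap r w"
            proof (cases "u \<le> m")
              case True
              then have u': "u \<in> {a..m}" using u by auto
              have "lam / 2 \<le> ((m - u) * x + (u - a) * y) / (m - a)"
                using interpolation_bounds(1)[OF ab(2) u', of "lam / 2" x y "-lam/2"] xyz by auto
              moreover have "lam / 8 \<le> dev a m u w" using wH u' by (force simp: H1_def abs_le_iff)
              ultimately show ?thesis using B_decompose[OF ab(2), of u w "gap r w"] lam_neg unfolding x_def y_def by linarith
            next
              case False
              then have u': "u \<in> {m..b}" using u by auto
              have "lam / 2 \<le> ((b - u) * y + (u - m) * z) / (b - m)"
                using interpolation_bounds(1)[OF ab(3) u', of "lam / 2" y z "-lam/2"] xyz by auto
              moreover have "lam / 8 \<le> dev m b u w" using wH u' by (force simp: H2_def abs_le_iff)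
              ultimately show ?thesis using B_decompose[OF ab(3), of u w "gap r w"] lam_neg unfolding y_def z_def by linarith
            qed
            then show ?thesis using elim by (simp add: gap_def)
          qed
          then have l1: "late r w = 1"
            using elim ab W0 times r1 by (intro late_from_outside[of w r a b]) auto
          have "q d w * p d w \<le> n d w * p d w" using qn p01 by (intro mult_right_mono) auto
          then show ?thesis using l1 W0 wH by (auto simp: W1_def W_def indicator_def late_outside_def)
        qed
      qed
    qed
    finally show "expectation (\<lambda>w. indicator E w * (ga * (late r w * q d w))) \<le>
      expectation (\<lambda>w. indicator E w * (late r w * (n d w * p d w)))" .
  qed
  have Vlate: "V u w = B (u - (1 - etau r w)) w + gap r w" if "w \<in> space M" "emin r w < pmin 0 (1 - r) w" "u \<in> {r, s-h, s, s+h}" for u w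
    using that times r1 by (intro late_V[OF that(1) times(1) r1 that(2)]) auto
  have e1: "late r w * q (1 - etau r w) w = nu (V r w) * (ze (V (s-h) w) * ze (V (s+h) w))" if w: "w \<in> space M" for w
    by (rule late_factor[OF w times(1) r1 nu]) (simp_all add: q_def Vlate[OF w])
  have e2: "late r w * (n (1 - etau r w) w * p (1 - etau r w) w) = nu (V r w) * ph (V s w)" if w: "w \<in> space M" for w
    by (rule late_factor[OF w times(1) r1 nu]) (simp_all add: n_def p_def Vlate[OF w])
  have "ga * expectation (\<lambda>w. nu (V r w) * (ze (V (s - h) w) * ze (V (s + h) w))) = expectation (\<lambda>w. ga * (late r w * q (1 - etau r w) w))"
    by (subst integral_mult_right_zero[symmetric], rule Bochner_Integration.integral_cong) (auto simp: e1)
  also note key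
  also have "expectation (\<lambda>w. late r w * (n (1 - etau r w) w * p (1 - etau r w) w)) = expectation (\<lambda>w. nu (V r w) * ph (V s w))"
    by (rule Bochner_Integration.integral_cong) (auto simp: e2)
  finally show ?thesis by (simp add: ga_def)
qed

text \<open>
  If \<open>tau\<close> lies in a cell \<open>{p..q}\<close> that is short compared with \<open>s\<close>, then it is the first minimum over this
  cell and \<open>V s = B (tau + s) - B tau\<close>. A window of length \<open>s\<close> around \<open>tau + s\<close> does not meet the cell, so
  the deviation at its centre, with standard deviation \<open>sqrt s / 2\<close>, smoothes the law of \<open>V s\<close>. Dropping
  the condition that the path outside the cell lies above the minimum only increases the expectation.
\<close>

lemma density_majorant_on_cell:
  assumes cf: "cutoff ph" and pq: "0 \<le> p" "p < q" "q - p \<le> s / 4" "q \<le> 1 - 2 * s" "0 < s"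
    and J: "(\<integral>\<^sup>+y. ennreal (ph y) \<partial>lborel) = ennreal J" "0 \<le> J"
  shows "expectation (\<lambda>w. indicator {w \<in> space M. tau w \<in> {p..q}} w * ph (V s w)) \<le> 1 / sqrt s * J"
proof -
  note nn = cutoff_nonneg[OF cf] and le1 = cutoff_le_1[OF cf]
  note [measurable] = cutoff_measurable[OF cf]
  define T where "T = {w \<in> space M. tau w \<in> {p..q}}"
  have [measurable]: "T \<in> events" unfolding T_def by measurable
  define G where "G = generated_algebra M {p..q} B"
  have q1: "q \<le> 1" using pq by simp
  have subG: "subalgebra M G" unfolding G_def
    by (rule subalgebra_generated_algebra) (use pq in \<open>auto intro!: B_measurable\<close>)
  define t where "t w = first_argmin_on p q (\<lambda>u. B u w)" for w
  have tG: "t \<in> borel_measurable G"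
    unfolding t_def[abs_def] G_def using pq q1
    by (intro first_argmin_on_measurable measurable_generated_algebra) (auto intro: B_cont_on)
  have tr: "t w \<in> {p..q}" if "w \<in> space M" for w
    unfolding t_def using pq q1 by (intro first_argmin_on_mem B_cont_on[OF that]) auto
  have tT: "t w = tau w" "pmin p q w = B (tau w) w" if w: "w \<in> T" for w
  proof -
    have ws: "w \<in> space M" using w by (simp add: T_def)
    show "t w = tau w" unfolding t_def
      using w pq q1 by (intro first_argmin_on_eqI B_cont_on[OF ws] tau_le[OF ws] tau_less[OF ws]) (auto simp: T_def)
    then show "pmin p q w = B (tau w) w" by (simp add: pmin_def min_on_def t_def)
  qed
  have pM[measurable]: "pmin p q \<in> borel_measurable M" using pq q1 by (intro pmin_measurable) auto
  define X where "X d w = indicator T w * ph (B (d + s) w - pmin p q w)" for d w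
  have X01: "0 \<le> X d w" "X d w \<le> 1" for d w using nn le1 by (auto simp: X_def indicator_def)
  have "expectation (\<lambda>w. X (t w) w) \<le> expectation (\<lambda>w. 1 / sqrt s * J)"
  proof (rule random_time_substitution[OF subG tG tr, where C="1 + 1 / sqrt s * J"])
    fix d assume d: "d \<in> {p..q}"
    have [measurable]: "(\<lambda>w. B (d + s) w) \<in> borel_measurable M" using d pq by (intro B_measurable) auto
    show "X d \<in> borel_measurable M" unfolding X_def[abs_def] by measurable
  next
    fix d w
    have "0 \<le> 1 / sqrt s * J" using J pq by simp
    then show "\<bar>X d w\<bar> \<le> 1 + 1 / sqrt s * J" "\<bar>1 / sqrt s * J\<bar> \<le> 1 + 1 / sqrt s * J" using X01[of d w] by linarith+
  next
    fix w assume w: "w \<in> space M"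
    have "continuous_on {p..q} (\<lambda>d. B (d + s) w)"
      by (rule continuous_on_compose2[OF B_cont[OF w]]) (use pq in \<open>auto intro!: continuous_intros\<close>)
    then show "continuous_on {p..q} (\<lambda>d. X d w)" unfolding X_def
      by (intro continuous_intros continuous_on_compose2[OF cutoff_cont[OF cf]]) auto
  next
    fix E d assume E: "E \<in> sets G" and d: "d \<in> {p..q}"
    define a b where "a = d + s / 2" and "b = d + 3 * s / 2"
    have ab: "0 \<le> a" "a < d + s" "d + s < b" "b \<le> 1" "a < b" "q \<le> a" "0 \<le> b" using d pq by (auto simp: a_def b_def)
    have sub: "subalgebra M (outer a b)" using ab by (intro outer_subalgebra) auto
    have EG: "E \<in> sets (outer a b)"
    proof -
      have "{p..q} \<subseteq> {0..a} \<union> {b..1}" using ab pq by auto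
      then show ?thesis using E sets_generated_algebra_mono[of "{p..q}" _ M B] unfolding G_def outer_def by blast
    qed
    have EM: "E \<in> events" using EG sub by (auto simp: subalgebra_def)
    define R where "R w = ((b - (d + s)) * (B a w + (- pmin p q w)) + ((d + s) - a) * (B b w + (- pmin p q w))) / (b - a)" for w
    have Rm: "R \<in> borel_measurable (outer a b)"
    proof -
      have [measurable]: "B a \<in> borel_measurable (outer a b)" "B b \<in> borel_measurable (outer a b)"
        "pmin p q \<in> borel_measurable (outer a b)"
        using ab pq by (auto intro!: B_outer pmin_outer)
      show ?thesis unfolding R_def[abs_def] by measurable
    qed
    have RZ: "R w + dev a b (d + s) w = B (d + s) w - pmin p q w" for w
      using B_decompose[OF \<open>a < b\<close>, of "d + s" w "- pmin p q w"] by (simp add: R_def)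
    have sq: "sqrt ((d + s - a) * (b - (d + s)) / (b - a)) = sqrt s / 2"
    proof -
      have "(d + s - a) * (b - (d + s)) / (b - a) = s / 4" using pq by (simp add: a_def b_def)
      then have "sqrt ((d + s - a) * (b - (d + s)) / (b - a)) = sqrt (s / 4)" by (rule arg_cong)
      also have "\<dots> = sqrt s / 2" by (simp add: real_sqrt_divide)
      finally show ?thesis .
    qed
    have [measurable]: "(\<lambda>w. B (d + s) w) \<in> borel_measurable M" using d pq by (intro B_measurable) auto
    note [measurable] = EM
    have "expectation (\<lambda>w. indicator E w * X d w) \<le> expectation (\<lambda>w. indicator E w * ph (R w + dev a b (d + s) w))"
      unfolding RZ
    proof (rule integral_mono)
      show "integrable M (\<lambda>w. indicator E w * X d w)"
        unfolding X_def by (rule integrable_bounded_rv[where C=1]) (use nn le1 in \<open>auto simp: indicator_def\<close>)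
      show "integrable M (\<lambda>w. indicator E w * ph (B (d + s) w - pmin p q w))"
        by (rule integrable_bounded_rv[where C=1]) (use nn le1 in \<open>auto simp: indicator_def\<close>)
      show "indicator E w * X d w \<le> indicator E w * ph (B (d + s) w - pmin p q w)" for w
        using nn by (auto simp: X_def indicator_def)
    qed
    also have "\<dots> \<le> expectation (indicator E) * (1 / (2 * (sqrt s / 2)) * J)"
    proof (rule expectation_smoothing_upper[OF dev_independent_of])
      show "distributed M lborel (dev a b (d + s)) (normal_density 0 (sqrt s / 2))"
        using dev_normal[of a b "d + s"] ab unfolding sq by simp
      show "(indicator E :: 'a \<Rightarrow> real) \<in> borel_measurable (outer a b)" using EG by simp
    qed (use ab pq Rm nn le1 J in auto)
    also have "\<dots> = expectation (\<lambda>w. indicator E w * (1 / sqrt s * J))" by simp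
    finally show "expectation (\<lambda>w. indicator E w * X d w) \<le> expectation (\<lambda>w. indicator E w * (1 / sqrt s * J))" .
  qed auto
  moreover have "X (t w) w = indicator T w * ph (V s w)" if "w \<in> space M" for w
  proof (cases "w \<in> T")
    case True
    then have "tau w + s < 1" using pq by (auto simp: T_def)
    then show ?thesis using True tT[OF True] V_before[OF that, of s] pq by (simp add: X_def)
  qed (simp add: X_def)
  then have "expectation (\<lambda>w. X (t w) w) = expectation (\<lambda>w. indicator T w * ph (V s w))"
    by (intro Bochner_Integration.integral_cong) auto
  ultimately show ?thesis by (simp add: T_def prob_space)
qed

end

context prob_space
begin

section \<open>Weighted laws and the Markov property\<close>

definition weighted_law :: "('a \<Rightarrow> real) \<Rightarrow> ('a \<Rightarrow> real) \<Rightarrow> real measure" where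
  "weighted_law P X = distr (density M (\<lambda>w. ennreal (P w))) borel X"

context
  fixes P X :: "'a \<Rightarrow> real"
  assumes Pm [measurable]: "P \<in> borel_measurable M" and P01: "\<And>w. w \<in> space M \<Longrightarrow> 0 \<le> P w \<and> P w \<le> 1"
    and Xm [measurable]: "X \<in> borel_measurable M"
begin

lemma sets_weighted_law [simp]: "sets (weighted_law P X) = sets borel"
  by (simp add: weighted_law_def)

lemma nn_integral_weighted_law:
  assumes [measurable]: "h \<in> borel_measurable borel" and h: "\<And>x. 0 \<le> h x \<and> h x \<le> 1"
  shows "(\<integral>\<^sup>+x. ennreal (h x) \<partial>weighted_law P X) = ennreal (expectation (\<lambda>w. P w * h (X w)))"
proof -
  have "(\<integral>\<^sup>+x. ennreal (h x) \<partial>weighted_law P X) = (\<integral>\<^sup>+w. ennreal (P w) * ennreal (h (X w)) \<partial>M)"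
    unfolding weighted_law_def by (simp add: nn_integral_distr nn_integral_density)
  also have "\<dots> = (\<integral>\<^sup>+w. ennreal (P w * h (X w)) \<partial>M)"
    by (intro nn_integral_cong) (use P01 h in \<open>auto simp: ennreal_mult\<close>)
  also have "\<dots> = ennreal (expectation (\<lambda>w. P w * h (X w)))"
  proof (rule nn_integral_eq_integral)
    show "integrable M (\<lambda>w. P w * h (X w))"
      by (rule integrable_bounded_rv[where C=1]) (use P01 h in \<open>auto simp: abs_mult intro!: mult_le_one\<close>)
  qed (use P01 h in auto)
  finally show ?thesis .
qed

lemma emeasure_weighted_law:
  assumes "A \<in> sets borel"
  shows "emeasure (weighted_law P X) A = ennreal (expectation (\<lambda>w. P w * indicator A (X w)))"
proof -
  have "0 \<le> (indicator A x :: real) \<and> indicator A x \<le> (1::real)" for x by (auto simp: indicator_def)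
  then show ?thesis using nn_integral_weighted_law[of "indicator A"] assms by (simp add: ennreal_indicator)
qed

lemma finite_weighted_law: "finite_measure (weighted_law P X)"
proof (rule finite_measureI)
  have "space (weighted_law P X) = UNIV" using sets_eq_imp_space_eq[OF sets_weighted_law] by simp
  then show "emeasure (weighted_law P X) (space (weighted_law P X)) \<noteq> \<infinity>"
    using emeasure_weighted_law[of UNIV] by simp
qed

lemma expectation_weighted_nonneg:
  "(\<And>x. 0 \<le> h x) \<Longrightarrow> 0 \<le> expectation (\<lambda>w. P w * h (X w))"
  by (rule integral_nonneg_AE) (use P01 in auto)

text \<open>
  A version of the conditional expectation of \<open>P\<close> given \<open>X\<close>, as a function of the value of \<open>X\<close>: the
  Radon-Nikodym derivative of the law of \<open>X\<close> weighted by \<open>P\<close>. The test functions keep the product \<open>h * k\<close>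
  bounded, as \<open>k\<close> is a finite version of a density that is bounded only almost everywhere.
\<close>

lemma regression_function:
  "\<exists>k\<in>borel_measurable borel. (\<forall>x. 0 \<le> k x) \<and>
     (\<forall>h\<in>borel_measurable borel. (\<forall>x. 0 \<le> h x \<and> h x \<le> 1 \<and> h x * k x \<le> 1) \<longrightarrow>
        expectation (\<lambda>w. P w * h (X w)) = expectation (\<lambda>w. h (X w) * k (X w)))"
proof -
  interpret L: prob_space "distr M borel X" by (rule prob_space_distr) simp
  have "absolutely_continuous (distr M borel X) (weighted_law P X)"
    unfolding absolutely_continuous_def
  proof
    fix A assume A: "A \<in> null_sets (distr M borel X)"
    then have [measurable]: "A \<in> sets borel" and 0: "prob (X -` A \<inter> space M) = 0"
      by (auto simp: null_sets_def emeasure_distr emeasure_eq_measure)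
    have "AE w in M. w \<notin> X -` A \<inter> space M" using 0 by (subst AE_iff_measurable[OF _ refl]) (auto simp: emeasure_eq_measure Int_def vimage_def conj_commute)
    then have "AE w in M. P w * indicator A (X w) = 0" using AE_space by eventually_elim auto
    then have "expectation (\<lambda>w. P w * indicator A (X w)) = expectation (\<lambda>w. 0)" by (intro integral_cong_AE) auto
    then show "A \<in> null_sets (weighted_law P X)" by (simp add: null_sets_def emeasure_weighted_law)
  qed
  then obtain f where f[measurable]: "f \<in> borel_measurable borel" and fN: "density (distr M borel X) f = weighted_law P X"
    using L.Radon_Nikodym[of "weighted_law P X"] by auto
  have "(\<integral>\<^sup>+x. f x \<partial>distr M borel X) = emeasure (weighted_law P X) UNIV"
    unfolding fN[symmetric] by (simp add: emeasure_density)
  also have "\<dots> \<noteq> \<infinity>" by (simp add: emeasure_weighted_law)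
  finally have fin: "AE x in distr M borel X. f x \<noteq> \<infinity>" by (intro nn_integral_PInf_AE) auto
  define k where "k x = enn2real (f x)" for x
  have km[measurable]: "k \<in> borel_measurable borel" unfolding k_def[abs_def] by measurable
  have k0: "0 \<le> k x" for x by (simp add: k_def enn2real_nonneg)
  have "expectation (\<lambda>w. P w * h (X w)) = expectation (\<lambda>w. h (X w) * k (X w))"
    if [measurable]: "h \<in> borel_measurable borel" and h: "\<And>x. 0 \<le> h x \<and> h x \<le> 1 \<and> h x * k x \<le> 1" for h
  proof -
    have "ennreal (expectation (\<lambda>w. P w * h (X w))) = (\<integral>\<^sup>+x. ennreal (h x) \<partial>weighted_law P X)"
      using h by (subst nn_integral_weighted_law) auto
    also have "\<dots> = (\<integral>\<^sup>+x. f x * ennreal (h x) \<partial>distr M borel X)"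
      unfolding fN[symmetric] by (subst nn_integral_density) auto
    also have "\<dots> = (\<integral>\<^sup>+x. ennreal (h x * k x) \<partial>distr M borel X)"
      by (rule nn_integral_cong_AE) (use fin in eventually_elim, use h k0 in \<open>auto simp: k_def ennreal_mult ennreal_enn2real less_top mult.commute\<close>)
    also have "\<dots> = (\<integral>\<^sup>+w. ennreal (h (X w) * k (X w)) \<partial>M)" by (subst nn_integral_distr) auto
    also have "\<dots> = ennreal (expectation (\<lambda>w. h (X w) * k (X w)))"
      by (rule nn_integral_eq_integral) (use h k0 in \<open>auto intro!: integrable_bounded_rv[where C=1]\<close>)
    finally show ?thesis
      using expectation_weighted_nonneg[of h] h k0
      by (subst (asm) ennreal_inj) (auto intro!: integral_nonneg_AE)
  qed
  then show ?thesis using km k0 by blast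
qed

lemma lebesgue_null_of_minorant:
  assumes ka: "0 < ka"
    and le: "\<And>ph J. cutoff ph \<Longrightarrow> (\<And>v. ph v \<noteq> 0 \<Longrightarrow> \<bar>v\<bar> < ep) \<Longrightarrow> 0 \<le> J \<Longrightarrow>
       (\<integral>\<^sup>+y. ennreal (ph y) \<partial>lborel) = ennreal J \<Longrightarrow> ka * J \<le> expectation (\<lambda>w. P w * ph (X w))"
    and A: "A \<in> sets borel" "A \<subseteq> {-ep<..<ep}" and 0: "expectation (\<lambda>w. P w * indicator A (X w)) = 0"
  shows "emeasure lborel A = 0"
proof -
  have "emeasure (density lborel (\<lambda>_. ennreal ka)) A \<le> emeasure (weighted_law P X) A"
  proof (rule measure_le_if_continuous_le[where l="-ep" and u=ep])
    fix ph :: "real \<Rightarrow> real"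
    assume ph: "continuous_on UNIV ph" "\<And>x. 0 \<le> ph x" "\<And>x. ph x \<le> 1" "\<And>x. x \<notin> {-ep<..<ep} \<Longrightarrow> ph x = 0"
    then have cf: "cutoff ph" by (simp add: cutoff_def)
    have supp: "\<bar>v\<bar> < ep" if "ph v \<noteq> 0" for v using ph(4)[of v] that by (metis abs_less_iff greaterThanLessThan_iff minus_less_iff)
    obtain J where J: "0 \<le> J" "(\<integral>\<^sup>+y. ennreal (ph y) \<partial>lborel) = ennreal J" using cutoff_integral[OF cf supp] by blast
    note [measurable] = cutoff_measurable[OF cf]
    have "(\<integral>\<^sup>+x. ennreal (ph x) \<partial>density lborel (\<lambda>_. ennreal ka)) = ennreal (ka * J)"
      using ka J by (simp add: nn_integral_density nn_integral_cmult ennreal_mult)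
    also have "\<dots> \<le> ennreal (expectation (\<lambda>w. P w * ph (X w)))" by (rule ennreal_leI[OF le[OF cf supp J]])
    also have "\<dots> = (\<integral>\<^sup>+x. ennreal (ph x) \<partial>weighted_law P X)" using ph by (subst nn_integral_weighted_law) auto
    finally show "(\<integral>\<^sup>+x. ennreal (ph x) \<partial>density lborel (\<lambda>_. ennreal ka)) \<le> (\<integral>\<^sup>+x. ennreal (ph x) \<partial>weighted_law P X)" .
  qed (use A finite_weighted_law in auto)
  then have "ennreal ka * emeasure lborel A = 0" using A 0 by (simp add: emeasure_weighted_law emeasure_density_const)
  then show ?thesis using ka by auto
qed

lemma null_of_majorant:
  assumes C: "0 \<le> C"
    and le: "\<And>ph J. cutoff ph \<Longrightarrow> (\<And>v. ph v \<noteq> 0 \<Longrightarrow> \<bar>v\<bar> < ep) \<Longrightarrow> 0 \<le> J \<Longrightarrow>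
       (\<integral>\<^sup>+y. ennreal (ph y) \<partial>lborel) = ennreal J \<Longrightarrow> expectation (\<lambda>w. P w * ph (X w)) \<le> C * J"
    and A: "A \<in> sets borel" "A \<subseteq> {-ep<..<ep}" and 0: "emeasure lborel A = 0"
  shows "expectation (\<lambda>w. P w * indicator A (X w)) = 0"
proof -
  let ?nu = "density lborel (\<lambda>x. ennreal C * indicator {-ep..ep} x)"
  have "emeasure (weighted_law P X) A \<le> emeasure ?nu A"
  proof (rule measure_le_if_continuous_le[where l="-ep" and u=ep])
    show "finite_measure ?nu"
    proof (rule finite_measureI)
      have "emeasure ?nu (space ?nu) = ennreal C * emeasure lborel {-ep..ep}"
        by (simp add: emeasure_density nn_integral_cmult_indicator)
      also have "\<dots> < \<infinity>" by (simp add: emeasure_lborel_Icc_eq ennreal_mult_less_top)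
      finally show "emeasure ?nu (space ?nu) \<noteq> \<infinity>" by simp
    qed
    fix ph :: "real \<Rightarrow> real"
    assume ph: "continuous_on UNIV ph" "\<And>x. 0 \<le> ph x" "\<And>x. ph x \<le> 1" "\<And>x. x \<notin> {-ep<..<ep} \<Longrightarrow> ph x = 0"
    then have cf: "cutoff ph" by (simp add: cutoff_def)
    have supp: "\<bar>v\<bar> < ep" if "ph v \<noteq> 0" for v using ph(4)[of v] that by (metis abs_less_iff greaterThanLessThan_iff minus_less_iff)
    obtain J where J: "0 \<le> J" "(\<integral>\<^sup>+y. ennreal (ph y) \<partial>lborel) = ennreal J" using cutoff_integral[OF cf supp] by blast
    note [measurable] = cutoff_measurable[OF cf]
    have "(\<integral>\<^sup>+x. ennreal (ph x) \<partial>weighted_law P X) = ennreal (expectation (\<lambda>w. P w * ph (X w)))"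
      using ph by (subst nn_integral_weighted_law) auto
    also have "\<dots> \<le> ennreal (C * J)" by (rule ennreal_leI[OF le[OF cf supp J]])
    also have "\<dots> = (\<integral>\<^sup>+x. ennreal C * ennreal (ph x) \<partial>lborel)"
      using C J by (simp add: nn_integral_cmult ennreal_mult)
    also have "\<dots> = (\<integral>\<^sup>+x. (ennreal C * indicator {-ep..ep} x) * ennreal (ph x) \<partial>lborel)"
    proof (rule nn_integral_cong)
      fix x show "ennreal C * ennreal (ph x) = (ennreal C * indicator {-ep..ep} x) * ennreal (ph x)"
        using ph(4)[of x] by (cases "x \<in> {-ep..ep}") auto
    qed
    also have "\<dots> = (\<integral>\<^sup>+x. ennreal (ph x) \<partial>?nu)" by (subst nn_integral_density) auto
    finally show "(\<integral>\<^sup>+x. ennreal (ph x) \<partial>weighted_law P X) \<le> (\<integral>\<^sup>+x. ennreal (ph x) \<partial>?nu)" .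
  qed (use A in auto)
  also have "emeasure ?nu A = 0"
  proof -
    have ae: "AE x in lborel. x \<notin> A" using 0 A by (subst AE_iff_measurable[OF _ refl]) auto
    have "AE x in lborel. (ennreal C * indicator {-ep..ep} x) * indicator A x = (0::ennreal)"
      using ae by eventually_elim simp
    then have "(\<integral>\<^sup>+x. (ennreal C * indicator {-ep..ep} x) * indicator A x \<partial>lborel) = 0"
      using A by (subst nn_integral_0_iff_AE) auto
    moreover have "emeasure ?nu A = (\<integral>\<^sup>+x. (ennreal C * indicator {-ep..ep} x) * indicator A x \<partial>lborel)"
      using A by (intro emeasure_density) auto
    ultimately show ?thesis by simp
  qed
  finally have "expectation (\<lambda>w. P w * indicator A (X w)) \<le> 0" using A by (simp add: emeasure_weighted_law ennreal_eq_0_iff)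
  then show ?thesis using expectation_weighted_nonneg[of "indicator A"] by auto
qed

end

text \<open>
  The inequality is lifted from continuous functions to Borel sets inside \<open>{-ep<..<ep}\<close>, that is, to the
  two weighted laws restricted to this interval, and from there to Borel functions.
\<close>

lemma weighted_expectation_le_borel:
  assumes P: "P \<in> borel_measurable M" "\<And>w. w \<in> space M \<Longrightarrow> 0 \<le> P w \<and> P w \<le> 1"
    and Q: "Q \<in> borel_measurable M" "\<And>w. w \<in> space M \<Longrightarrow> 0 \<le> Q w \<and> Q w \<le> 1" and X: "X \<in> borel_measurable M"
    and le: "\<And>ph. cutoff ph \<Longrightarrow> (\<And>v. ph v \<noteq> 0 \<Longrightarrow> \<bar>v\<bar> < ep) \<Longrightarrow>
      expectation (\<lambda>w. P w * ph (X w)) \<le> expectation (\<lambda>w. Q w * ph (X w))"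
    and hm[measurable]: "h \<in> borel_measurable borel" and h: "\<And>x. 0 \<le> h x \<and> h x \<le> 1" "\<And>x. h x \<noteq> 0 \<Longrightarrow> \<bar>x\<bar> < ep"
  shows "expectation (\<lambda>w. P w * h (X w)) \<le> expectation (\<lambda>w. Q w * h (X w))"
proof -
  let ?I = "{-ep<..<ep}"
  let ?mu = "density (weighted_law P X) (indicator ?I)" and ?nu = "density (weighted_law Q X) (indicator ?I)"
  note nnP = nn_integral_weighted_law[OF P X] and nnQ = nn_integral_weighted_law[OF Q X]
  have sP[simp]: "sets (weighted_law P X) = sets borel" and sQ[simp]: "sets (weighted_law Q X) = sets borel"
    by (simp_all add: weighted_law_def)
  have mm[simp]: "borel_measurable (weighted_law P X) = (borel_measurable borel :: (real \<Rightarrow> ennreal) set)"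
    "borel_measurable (weighted_law Q X) = (borel_measurable borel :: (real \<Rightarrow> ennreal) set)"
    by (rule measurable_cong_sets; simp)+
  have "?mu \<le> ?nu"
    unfolding le_measure_iff
  proof (simp add: sets_eq_imp_space_eq[OF sP] sets_eq_imp_space_eq[OF sQ], rule le_funI)
    fix A
    show "emeasure ?mu A \<le> emeasure ?nu A"
    proof (cases "A \<in> sets borel")
      case True
      have "emeasure (weighted_law P X) (A \<inter> ?I) \<le> emeasure (weighted_law Q X) (A \<inter> ?I)"
      proof (rule measure_le_if_continuous_le[where l="-ep" and u=ep])
        fix ph :: "real \<Rightarrow> real"
        assume ph: "continuous_on UNIV ph" "\<And>x. 0 \<le> ph x" "\<And>x. ph x \<le> 1" "\<And>x. x \<notin> ?I \<Longrightarrow> ph x = 0"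
        then have cf: "cutoff ph" by (simp add: cutoff_def)
        have supp: "\<bar>v\<bar> < ep" if "ph v \<noteq> 0" for v using ph(4)[of v] that by (metis abs_less_iff greaterThanLessThan_iff minus_less_iff)
        show "(\<integral>\<^sup>+x. ennreal (ph x) \<partial>weighted_law P X) \<le> (\<integral>\<^sup>+x. ennreal (ph x) \<partial>weighted_law Q X)"
          using le[OF cf supp] cutoff_measurable[OF cf] ph by (simp add: nnP nnQ ennreal_leI)
      qed (use True finite_weighted_law[OF Q X] in auto)
      then show ?thesis using True
        by (simp add: emeasure_density nn_integral_indicator indicator_inter_arith[symmetric] mult.commute Int_commute)
    next
      case False
      then show ?thesis by (simp add: emeasure_notin_sets)
    qed
  qed
  then have "(\<integral>\<^sup>+x. ennreal (h x) \<partial>?mu) \<le> (\<integral>\<^sup>+x. ennreal (h x) \<partial>?nu)"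
    by (intro nn_integral_mono_measure) simp_all
  moreover have ih: "(indicator ?I x :: ennreal) * ennreal (h x) = ennreal (h x)" for x
    using h(2)[of x] by (cases "h x = 0") (auto simp: abs_less_iff)
  have "(\<integral>\<^sup>+x. ennreal (h x) \<partial>?mu) = ennreal (expectation (\<lambda>w. P w * h (X w)))"
    using h(1) by (subst nn_integral_density) (auto simp: ih nnP)
  moreover have "(\<integral>\<^sup>+x. ennreal (h x) \<partial>?nu) = ennreal (expectation (\<lambda>w. Q w * h (X w)))"
    using h(1) by (subst nn_integral_density) (auto simp: ih nnQ)
  ultimately show ?thesis
    using expectation_weighted_nonneg[OF Q X, of h] h(1) by (simp add: ennreal_le_iff)
qed

lemma vimage_subalgebra: "X \<in> borel_measurable M \<Longrightarrow> subalgebra M (vimage_algebra (space M) X borel)"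
  unfolding subalgebra_def by (auto simp: sets_vimage_algebra2)

text \<open>
  The hypothesis says that the conditional expectation of \<open>Q\<close> given \<open>X\<close> vanishes.
\<close>

lemma orthogonal_to_vimage_algebra:
  fixes X Q Y :: "'a \<Rightarrow> real"
  assumes X: "X \<in> borel_measurable M" and Q[measurable]: "Q \<in> borel_measurable M" "\<And>w. w \<in> space M \<Longrightarrow> \<bar>Q w\<bar> \<le> C"
    and orth: "\<And>A. A \<in> sets borel \<Longrightarrow> expectation (\<lambda>w. Q w * indicator A (X w)) = 0"
    and Y: "Y \<in> borel_measurable (vimage_algebra (space M) X (borel :: real measure))" "integrable M Y"
  shows "expectation (\<lambda>w. Q w * Y w) = 0"
proof -
  let ?S = "vimage_algebra (space M) X (borel :: real measure)"
  interpret finite_measure_subalgebra M ?S by unfold_locales (rule vimage_subalgebra[OF X])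
  have iQ: "integrable M Q" by (rule integrable_bounded_rv[OF Q])
  have iYQ: "integrable M (\<lambda>w. Y w * Q w)"
  proof (rule Bochner_Integration.integrable_bound)
    show "integrable M (\<lambda>w. C * \<bar>Y w\<bar>)" using Y(2) by simp
    show "AE w in M. norm (Y w * Q w) \<le> norm (C * \<bar>Y w\<bar>)"
    proof (rule AE_I2)
      fix w assume "w \<in> space M"
      then have "\<bar>Q w\<bar> \<le> \<bar>C\<bar>" using Q(2)[of w] by linarith
      then show "norm (Y w * Q w) \<le> norm (C * \<bar>Y w\<bar>)"
        by (simp add: abs_mult mult.commute[of "\<bar>Y w\<bar>"] mult_right_mono)
    qed
  qed (use Y(2) in measurable)
  have "AE w in M. real_cond_exp M ?S Q w = 0"
  proof (rule real_cond_exp_charact)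
    fix F assume "F \<in> sets ?S"
    then obtain A where A: "A \<in> sets borel" "F = X -` A \<inter> space M" by (auto simp: sets_vimage_algebra2)
    have "(\<integral>w\<in>F. Q w \<partial>M) = expectation (\<lambda>w. Q w * indicator A (X w))"
      unfolding set_lebesgue_integral_def A(2)
      by (rule Bochner_Integration.integral_cong) (auto simp: indicator_def)
    then show "(\<integral>w\<in>F. Q w \<partial>M) = (\<integral>w\<in>F. 0 \<partial>M)" using orth[OF A(1)] by simp
  qed (use iQ in auto)
  then have "expectation (\<lambda>w. Y w * real_cond_exp M ?S Q w) = expectation (\<lambda>w. 0)"
    using Y(2) by (intro integral_cong_AE) auto
  then show ?thesis using real_cond_exp_intg(2)[OF iYQ Y(1) Q(1)] by (simp add: mult.commute)
qed

text \<open>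
  What is known up to time \<open>u\<close> and has vanishing conditional expectation given \<open>X u\<close> is also orthogonal to
  every later value: by the Markov property, only the part of \<open>X v\<close> that is a function of \<open>X u\<close> matters.
\<close>

lemma markov_orthogonality:
  fixes Q :: "'a \<Rightarrow> real" and g :: "real \<Rightarrow> real"
  assumes mk: "markov_process M TT F X" and uv: "u \<in> TT" "v \<in> TT" "u \<le> v"
    and Q: "Q \<in> borel_measurable (F u)" "\<And>w. w \<in> space M \<Longrightarrow> \<bar>Q w\<bar> \<le> C"
    and orth: "\<And>A. A \<in> sets borel \<Longrightarrow> expectation (\<lambda>w. Q w * indicator A (X u w)) = 0"
    and g: "g \<in> borel_measurable borel" "\<And>x. \<bar>g x\<bar> \<le> K"
  shows "expectation (\<lambda>w. Q w * g (X v w)) = 0"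
proof -
  have sub: "subalgebra M (F u)" and Xu: "X u \<in> borel_measurable M" and Xv[measurable]: "X v \<in> borel_measurable M"
    using mk uv unfolding markov_process_def by (auto intro: measurable_from_subalg)
  have Qm[measurable]: "Q \<in> borel_measurable M" by (rule measurable_from_subalg[OF sub Q(1)])
  interpret A: finite_measure_subalgebra M "F u" by unfold_locales (rule sub)
  interpret S: finite_measure_subalgebra M "vimage_algebra (space M) (X u) borel"
    by unfold_locales (rule vimage_subalgebra[OF Xu])
  have ind: "expectation (\<lambda>w. Q w * indicator A (X v w)) = 0" if [measurable]: "A \<in> sets borel" for A
  proof -
    have i1: "integrable M (\<lambda>w. indicator A (X v w) :: real)"
      by (rule integrable_bounded_rv[where C=1]) (auto simp: indicator_def)
    have iQ1: "integrable M (\<lambda>w. Q w * indicator A (X v w))"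
      by (rule integrable_bounded_rv[where C=C]) (use Q(2) in \<open>force simp: indicator_def\<close>)+
    have "expectation (\<lambda>w. Q w * indicator A (X v w)) = expectation (\<lambda>w. Q w * real_cond_exp M (F u) (\<lambda>w. indicator A (X v w)) w)"
      using A.real_cond_exp_intg(2)[OF iQ1 Q(1)] by simp
    also have "\<dots> = expectation (\<lambda>w. Q w * real_cond_exp M (vimage_algebra (space M) (X u) borel) (\<lambda>w. indicator A (X v w)) w)"
    proof (rule integral_cong_AE)
      have "AE w in M. real_cond_exp M (F u) (\<lambda>w. indicator A (X v w)) w =
           real_cond_exp M (vimage_algebra (space M) (X u) borel) (\<lambda>w. indicator A (X v w)) w"
        using mk uv that unfolding markov_process_def by blast
      then show "AE w in M. Q w * real_cond_exp M (F u) (\<lambda>w. indicator A (X v w)) w =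
        Q w * real_cond_exp M (vimage_algebra (space M) (X u) borel) (\<lambda>w. indicator A (X v w)) w"
        by eventually_elim simp
    qed measurable
    also have "\<dots> = 0"
      by (rule orthogonal_to_vimage_algebra[OF Xu Qm Q(2) orth]) (use S.real_cond_exp_int(1)[OF i1] in auto)
    finally show ?thesis .
  qed
  show ?thesis
  proof (rule orthogonal_to_vimage_algebra[OF Xv Qm Q(2) ind])
    have "X v \<in> measurable (vimage_algebra (space M) (X v) borel) borel"
      by (rule measurable_vimage_algebra1) simp
    then show "(\<lambda>w. g (X v w)) \<in> borel_measurable (vimage_algebra (space M) (X v) borel)"
      using g(1) by (rule measurable_compose)
    note [measurable] = g(1)
    show "integrable M (\<lambda>w. g (X v w))" by (rule integrable_bounded_rv[where C=K]) (use g(2) in auto)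
  qed
qed

text \<open>
  The past enters the joint expectation with two later values only through its regression \<open>k (X s)\<close>. The
  difference \<open>Q\<close> of the two sides is orthogonal to \<open>X s\<close>, hence to \<open>X t\<close>; so \<open>Q * g (X t)\<close> is orthogonal to
  \<open>X t\<close> as well, hence to \<open>X u\<close>.
\<close>

lemma markov_two_step:
  fixes P :: "'a \<Rightarrow> real" and k h g f :: "real \<Rightarrow> real"
  assumes mk: "markov_process M TT F X" and T: "s \<in> TT" "t \<in> TT" "u \<in> TT" "s \<le> t" "t \<le> u"
    and P: "P \<in> borel_measurable (F s)" "\<And>w. w \<in> space M \<Longrightarrow> 0 \<le> P w \<and> P w \<le> 1"
    and k[measurable]: "k \<in> borel_measurable borel" and k0: "\<And>x. 0 \<le> k x"
    and reg: "\<And>h. h \<in> borel_measurable borel \<Longrightarrow> (\<And>x. 0 \<le> h x \<and> h x \<le> 1 \<and> h x * k x \<le> 1) \<Longrightarrow>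
       expectation (\<lambda>w. P w * h (X s w)) = expectation (\<lambda>w. h (X s w) * k (X s w))"
    and h[measurable]: "h \<in> borel_measurable borel" and h01: "\<And>x. 0 \<le> h x \<and> h x \<le> 1 \<and> h x * k x \<le> 1"
    and g[measurable]: "g \<in> borel_measurable borel" and g01: "\<And>x. 0 \<le> g x \<and> g x \<le> 1"
    and f[measurable]: "f \<in> borel_measurable borel" and f01: "\<And>x. 0 \<le> f x \<and> f x \<le> 1"
  shows "expectation (\<lambda>w. P w * h (X s w) * g (X t w) * f (X u w)) =
    expectation (\<lambda>w. h (X s w) * k (X s w) * g (X t w) * f (X u w))"
proof -
  have sub: "subalgebra M (F x)" and XF: "X x \<in> borel_measurable (F x)" if "x \<in> TT" for x
    using mk that unfolding markov_process_def by auto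
  have XM: "X x \<in> borel_measurable M" if "x \<in> TT" for x using measurable_from_subalg[OF sub XF] that by auto
  have [measurable]: "X s \<in> borel_measurable M" "X t \<in> borel_measurable M" "X u \<in> borel_measurable M" using XM T by auto
  have [measurable]: "P \<in> borel_measurable M" by (rule measurable_from_subalg[OF sub P(1)]) (rule T)
  define Q where "Q w = P w * h (X s w) - h (X s w) * k (X s w)" for w
  have QF: "Q \<in> borel_measurable (F s)"
  proof -
    note [measurable] = P(1) XF[OF T(1)]
    show ?thesis unfolding Q_def by measurable
  qed
  have Ph: "0 \<le> P w * h (X s w)" "P w * h (X s w) \<le> 1" if "w \<in> space M" for w
    using P(2)[OF that] h01 by (auto intro!: mult_le_one)
  have hk: "0 \<le> h x * k x" for x using h01 k0 by simp
  have Q1: "\<bar>Q w\<bar> \<le> 1" if "w \<in> space M" for w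
    unfolding Q_def using Ph[OF that] hk[of "X s w"] h01[of "X s w"] by linarith
  have [measurable]: "Q \<in> borel_measurable M" by (rule measurable_from_subalg[OF sub QF]) (rule T)
  have orth: "expectation (\<lambda>w. Q w * indicator A (X s w)) = 0" if [measurable]: "A \<in> sets borel" for A
  proof -
    have "expectation (\<lambda>w. P w * (h (X s w) * indicator A (X s w))) = expectation (\<lambda>w. (h (X s w) * indicator A (X s w)) * k (X s w))"
      by (rule reg[of "\<lambda>x. h x * indicator A x"]) (use h01 in \<open>auto simp: indicator_def\<close>)
    moreover have "expectation (\<lambda>w. Q w * indicator A (X s w)) =
       expectation (\<lambda>w. P w * (h (X s w) * indicator A (X s w)) - (h (X s w) * indicator A (X s w)) * k (X s w))"
      by (simp add: Q_def algebra_simps)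
    moreover have "\<dots> = expectation (\<lambda>w. P w * (h (X s w) * indicator A (X s w))) - expectation (\<lambda>w. (h (X s w) * indicator A (X s w)) * k (X s w))"
      by (rule Bochner_Integration.integral_diff)
        (rule integrable_bounded_rv[where C=1], measurable, use Ph h01 hk in \<open>force simp: indicator_def\<close>)+
    ultimately show ?thesis by simp
  qed
  have s1: "expectation (\<lambda>w. Q w * r (X t w)) = 0" if "r \<in> borel_measurable borel" "\<And>x. \<bar>r x\<bar> \<le> 1" for r
    by (rule markov_orthogonality[OF mk T(1,2,4) QF Q1 orth that])
  define R where "R w = Q w * g (X t w)" for w
  have RF: "R \<in> borel_measurable (F t)"
  proof -
    have "subalgebra (F t) (F s)"
      using mk sub[OF T(1)] sub[OF T(2)] filtration.sets_F_mono[of "space M" F s t] T unfolding markov_process_def subalgebra_def by auto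
    then have [measurable]: "Q \<in> borel_measurable (F t)" using QF by (rule measurable_from_subalg)
    have [measurable]: "X t \<in> borel_measurable (F t)" using XF T by auto
    show ?thesis unfolding R_def by measurable
  qed
  have R1: "\<bar>R w\<bar> \<le> 1" if "w \<in> space M" for w
    unfolding R_def using Q1[OF that] g01[of "X t w"] by (simp add: abs_mult mult_le_one)
  have "expectation (\<lambda>w. R w * f (X u w)) = 0"
  proof (rule markov_orthogonality[OF mk T(2,3,5) RF R1])
    fix A :: "real set" assume [measurable]: "A \<in> sets borel"
    have "expectation (\<lambda>w. Q w * (g (X t w) * indicator A (X t w))) = 0"
      by (rule s1[of "\<lambda>x. g x * indicator A x"]) (use g01 in \<open>auto simp: indicator_def\<close>)
    then show "expectation (\<lambda>w. R w * indicator A (X t w)) = 0" by (simp add: R_def mult.assoc)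
  qed (use f01 in auto)
  also have "expectation (\<lambda>w. R w * f (X u w)) =
     expectation (\<lambda>w. P w * h (X s w) * g (X t w) * f (X u w) - h (X s w) * k (X s w) * g (X t w) * f (X u w))"
    by (simp add: R_def Q_def algebra_simps)
  also have "\<dots> = expectation (\<lambda>w. P w * h (X s w) * g (X t w) * f (X u w)) - expectation (\<lambda>w. h (X s w) * k (X s w) * g (X t w) * f (X u w))"
  proof (rule Bochner_Integration.integral_diff)
    have u: "\<bar>a * g (X t w) * f (X u w)\<bar> \<le> 1" if "0 \<le> a" "a \<le> 1" for a w
    proof -
      have "0 \<le> a * g (X t w) \<and> a * g (X t w) \<le> 1" using that g01 by (intro mult_unit_interval) auto
      then have "0 \<le> a * g (X t w) * f (X u w) \<and> a * g (X t w) * f (X u w) \<le> 1"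
        using f01 by (intro mult_unit_interval) auto
      then show ?thesis by simp
    qed
    show "integrable M (\<lambda>w. P w * h (X s w) * g (X t w) * f (X u w))"
      by (rule integrable_bounded_rv[where C=1]) (measurable, use u[OF Ph] in auto)
    show "integrable M (\<lambda>w. h (X s w) * k (X s w) * g (X t w) * f (X u w))"
      by (rule integrable_bounded_rv[where C=1]) (measurable, use u[OF hk] h01 in auto)
  qed
  finally show ?thesis by simp
qed

end

section \<open>Values near zero occur in both regimes\<close>

lemma clamp_unit: "0 \<le> min 1 (max 0 (x::real)) \<and> min 1 (max 0 x) \<le> 1" by auto

lemma cutoff_clamp:
  assumes "continuous_on UNIV g" shows "cutoff (\<lambda>x. min 1 (max 0 (g x)))"
  using assms clamp_unit unfolding cutoff_def by (auto intro!: continuous_intros)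

context vervaat_bridge
begin

text \<open>
  If \<open>V s\<close> does not charge \<open>A\<close> under the weight \<open>nu (V r)\<close>, then it is a Lebesgue null set by the lower
  bound on the density. The upper bound then excludes \<open>V s \<in> A\<close> on each of finitely many cells for \<open>tau\<close>.
\<close>

lemma null_transfer:
  assumes nu: "cutoff nu" "\<And>v. nu v \<noteq> 0 \<Longrightarrow> v < 0" and ze: "cutoff ze" "\<And>v. ze v \<noteq> 0 \<Longrightarrow> \<bar>v\<bar> \<le> - lam / 2"
    and times: "0 < r" "r < s - h" "0 < h" "s + h \<le> 1 - r" "0 < s" "2 * s < 1" and ep: "0 < ep" "ep \<le> - lam / 2"
    and good: "\<And>d. d \<in> {0..r} \<Longrightarrow> 1 / 2 \<le> prob {w \<in> space M. \<forall>u\<in>{s-h-d..s-d}. \<bar>dev (s-h-d) (s-d) u w\<bar> \<le> - lam / 8}"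
      "\<And>d. d \<in> {0..r} \<Longrightarrow> 1 / 2 \<le> prob {w \<in> space M. \<forall>u\<in>{s-d..s+h-d}. \<bar>dev (s-d) (s+h-d) u w\<bar> \<le> - lam / 8}"
    and pos: "0 < expectation (\<lambda>w. nu (V r w) * (ze (V (s - h) w) * ze (V (s + h) w)))"
    and A: "A \<in> sets borel" "A \<subseteq> {-ep<..<ep}" and null: "expectation (\<lambda>w. nu (V r w) * indicator A (V s w)) = 0"
  shows "prob {w \<in> space M. V s w \<in> A \<and> tau w \<le> 1 - 2 * s} = 0"
proof -
  have Vr[measurable]: "V r \<in> borel_measurable M" and Vs[measurable]: "V s \<in> borel_measurable M"
    using times by (auto intro!: V_measurable)
  note [measurable] = cutoff_measurable[OF nu(1)] A(1)
  have lebA: "emeasure lborel A = 0"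
  proof (rule lebesgue_null_of_minorant[of "\<lambda>w. nu (V r w)" "V s"])
    show "0 < normal_density 0 (sqrt (h / 2)) lam / 4 * expectation (\<lambda>w. nu (V r w) * (ze (V (s - h) w) * ze (V (s + h) w)))"
      using pos times by (intro mult_pos_pos divide_pos_pos normal_density_pos) auto
    fix ph J assume "cutoff ph" "\<And>v. ph v \<noteq> 0 \<Longrightarrow> \<bar>v\<bar> < ep" "0 \<le> J" "(\<integral>\<^sup>+y. ennreal (ph y) \<partial>lborel) = ennreal J"
    then have "normal_density 0 (sqrt (h / 2)) lam / 4 * J * expectation (\<lambda>w. nu (V r w) * (ze (V (s - h) w) * ze (V (s + h) w))) \<le>
      expectation (\<lambda>w. nu (V r w) * ph (V s w))"
      using ep by (intro density_minorant[OF nu(1) ze(1) _ nu(2) _ ze(2) times(1-4) good]) (auto intro: less_imp_le order_trans)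
    then show "normal_density 0 (sqrt (h / 2)) lam / 4 * expectation (\<lambda>w. nu (V r w) * (ze (V (s - h) w) * ze (V (s + h) w))) * J \<le>
      expectation (\<lambda>w. nu (V r w) * ph (V s w))"
      by (simp only: ac_simps)
  qed (use A null cutoff_nonneg[OF nu(1)] cutoff_le_1[OF nu(1)] in auto)
  \<comment> \<open>The number of cells makes each of them shorter than \<open>s / 4\<close>.\<close>
  obtain N :: nat where N: "4 / s < real N" using reals_Archimedean2 by blast
  have N0: "0 < real N" using N times by (meson divide_pos_pos less_trans zero_less_numeral)
  define c where "c i = (1 - 2 * s) * (real i / real N)" for i
  have cell: "prob {w \<in> space M. V s w \<in> A \<and> tau w \<in> {c i..c (Suc i)}} = 0" if i: "i < N" for i
  proof -
    let ?T = "{w \<in> space M. tau w \<in> {c i..c (Suc i)}}"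
    have [measurable]: "?T \<in> events" by measurable
    have len: "c (Suc i) - c i = (1 - 2 * s) / real N"
    proof -
      have "c (Suc i) - c i = (1 - 2 * s) * (real (Suc i) / real N - real i / real N)"
        by (simp only: c_def right_diff_distrib)
      also have "real (Suc i) / real N - real i / real N = 1 / real N" by (simp add: diff_divide_distrib[symmetric])
      finally show ?thesis by simp
    qed
    have "expectation (\<lambda>w. indicator ?T w * indicator A (V s w) :: real) = 0"
    proof (rule null_of_majorant[of "\<lambda>w. indicator ?T w" "V s" "1 / sqrt s"])
      fix ph J assume "cutoff ph" "0 \<le> J" "(\<integral>\<^sup>+y. ennreal (ph y) \<partial>lborel) = ennreal J"
      then show "expectation (\<lambda>w. indicator ?T w * ph (V s w)) \<le> 1 / sqrt s * J"
      proof (intro density_majorant_on_cell)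
        show "0 \<le> c i" using times N0 by (simp add: c_def)
        show "c i < c (Suc i)" using len times N0 by (metis diff_gt_0_iff_gt divide_pos_pos)
        have "(1 - 2 * s) / real N \<le> 1 / real N" using times N0 by (intro divide_right_mono) auto
        also have "1 / real N \<le> s / 4" using N N0 times by (simp add: field_simps)
        finally show "c (Suc i) - c i \<le> s / 4" unfolding len .
        have "real (Suc i) / real N \<le> 1" using i N0 by (simp add: field_simps)
        then have "(1 - 2 * s) * (real (Suc i) / real N) \<le> (1 - 2 * s) * 1" using times by (intro mult_left_mono) auto
        then show "c (Suc i) \<le> 1 - 2 * s" by (simp add: c_def)
      qed (use times in auto)
    qed (use times A lebA in \<open>auto simp: indicator_def\<close>)
    also have "(\<lambda>w. indicator ?T w * indicator A (V s w) :: real) = indicator {w \<in> space M. V s w \<in> A \<and> tau w \<in> {c i..c (Suc i)}}"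
      by (auto simp: indicator_def)
    finally show ?thesis by simp
  qed
  have "{w \<in> space M. V s w \<in> A \<and> tau w \<le> 1 - 2 * s} \<subseteq> (\<Union>i<N. {w \<in> space M. V s w \<in> A \<and> tau w \<in> {c i..c (Suc i)}})"
  proof
    fix w assume w: "w \<in> {w \<in> space M. V s w \<in> A \<and> tau w \<le> 1 - 2 * s}"
    define x where "x = tau w / (1 - 2 * s) * real N"
    have x: "0 \<le> x" "x \<le> real N"
    proof -
      have "0 \<le> tau w / (1 - 2 * s)" "tau w / (1 - 2 * s) \<le> 1" using w tau_range[of w] times by auto
      then have "0 * real N \<le> x" "x \<le> 1 * real N" unfolding x_def by (intro mult_right_mono; simp)+
      then show "0 \<le> x" "x \<le> real N" by simp_all
    qed
    have tx: "tau w = (1 - 2 * s) * (x / real N)" using times N0 by (simp add: x_def)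
    obtain i where i: "i < N" "real i \<le> x" "x \<le> real (Suc i)"
    proof (cases "x = real N")
      case True
      then show ?thesis using that[of "N - 1"] N0 by (auto simp: of_nat_diff Suc_leI)
    next
      case False
      then have "nat \<lfloor>x\<rfloor> < N" using x by linarith
      moreover have "real (nat \<lfloor>x\<rfloor>) \<le> x" "x \<le> real (Suc (nat \<lfloor>x\<rfloor>))" using x by linarith+
      ultimately show ?thesis by (rule that)
    qed
    have "c i \<le> tau w" "tau w \<le> c (Suc i)"
      unfolding tx c_def using i times N0 by (intro mult_left_mono divide_right_mono; simp)+
    then show "w \<in> (\<Union>i<N. {w \<in> space M. V s w \<in> A \<and> tau w \<in> {c i..c (Suc i)}})" using w i by auto
  qed
  then have "prob {w \<in> space M. V s w \<in> A \<and> tau w \<le> 1 - 2 * s} \<le> prob (\<Union>i<N. {w \<in> space M. V s w \<in> A \<and> tau w \<in> {c i..c (Suc i)}})"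
    by (rule finite_measure_mono) measurable
  also have "\<dots> \<le> (\<Sum>i<N. prob {w \<in> space M. V s w \<in> A \<and> tau w \<in> {c i..c (Suc i)}})"
    by (rule finite_measure_subadditive_finite) auto
  also have "\<dots> = 0" using cell by simp
  finally show ?thesis using measure_nonneg[of M] by (metis antisym)
qed

text \<open>
  With positive probability the bridge follows a path that falls to \<open>lam / 8\<close> by time \<open>r / 2\<close>, stays there, and
  falls to \<open>lam\<close> after \<open>1 - r / 2\<close>. Then the minimum lies in the last stretch and is at most \<open>- lam / 32\<close>
  below the final value, so that \<open>V\<close> is close to \<open>lam / 8\<close> at the times \<open>r\<close>, \<open>s - h\<close> and \<open>s + h\<close>.
\<close>

lemma early_excursion_end_possible:
  assumes times: "0 < r" "r < s - h" "0 < h" "s + h \<le> 1 - r"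
    and nu: "cutoff nu" "\<And>v. v < 0 \<Longrightarrow> 0 < nu v" and ze: "cutoff ze" "\<And>v. \<bar>v\<bar> < - lam / 2 \<Longrightarrow> 0 < ze v"
  shows "0 < expectation (\<lambda>w. nu (V r w) * (ze (V (s - h) w) * ze (V (s + h) w)))"
proof -
  define f where "f u = lam / 8 * min 1 (2 * u / r) + 7 * lam / 8 * max 0 ((u - (1 - r / 2)) / (r / 2))" for u
  define S where "S = {w \<in> space M. \<forall>u\<in>{0..1}. \<bar>B u w - f u\<bar> \<le> - lam / 32}"
  have r1: "r < 1 - r / 2" "r < 1" using times by auto
  have "0 < prob S"
    unfolding S_def
  proof (rule support_theorem)
    show "continuous_on {0..1} f" unfolding f_def using times by (intro continuous_intros) auto
    show "f 0 = 0" "f 1 = lam" using times r1 by (auto simp: f_def field_simps max_def min_def)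
  qed (use lam_neg in simp)
  have fm: "f u = lam / 8" if "r / 2 \<le> u" "u \<le> 1 - r / 2" for u
  proof -
    have "1 \<le> 2 * u / r" using that times by (simp add: field_simps)
    moreover have "(u - (1 - r / 2)) / (r / 2) \<le> 0" using that times by (simp add: divide_nonpos_pos)
    ultimately show ?thesis by (simp add: f_def)
  qed
  have fl: "lam / 8 \<le> f u" if "0 \<le> u" "u \<le> 1 - r / 2" for u
  proof -
    have m: "(u - (1 - r / 2)) / (r / 2) \<le> 0" using that times by (simp add: divide_nonpos_pos)
    have "lam / 8 * 1 \<le> lam / 8 * min 1 (2 * u / r)" using lam_neg by (intro mult_left_mono_neg) auto
    then show ?thesis using m by (simp add: f_def)
  qed
  have fg: "lam \<le> f u" if "0 \<le> u" "u \<le> 1" for u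
  proof -
    have "(u - (1 - r / 2)) / (r / 2) \<le> (r / 2) / (r / 2)" using that times by (intro divide_right_mono) auto
    then have "max 0 ((u - (1 - r / 2)) / (r / 2)) \<le> 1" using times by auto
    then have "7 * lam / 8 * 1 \<le> 7 * lam / 8 * max 0 ((u - (1 - r / 2)) / (r / 2))" using lam_neg by (intro mult_left_mono_neg) auto
    moreover have "lam / 8 * 1 \<le> lam / 8 * min 1 (2 * u / r)" using lam_neg by (intro mult_left_mono_neg) auto
    ultimately show ?thesis by (simp add: f_def)
  qed
  define I where "I w = nu (V r w) * (ze (V (s - h) w) * ze (V (s + h) w))" for w
  have I0: "0 \<le> I w" "I w \<le> 1" for w
    unfolding I_def using cutoff_nonneg[OF nu(1)] cutoff_le_1[OF nu(1)] cutoff_nonneg[OF ze(1)] cutoff_le_1[OF ze(1)]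
    by (auto intro!: mult_nonneg_nonneg mult_le_one)
  have [measurable]: "V r \<in> borel_measurable M" "V (s - h) \<in> borel_measurable M" "V (s + h) \<in> borel_measurable M"
    using times by (auto intro!: V_measurable)
  note [measurable] = cutoff_measurable[OF nu(1)] cutoff_measurable[OF ze(1)]
  have Im[measurable]: "I \<in> borel_measurable M" unfolding I_def by measurable
  have posI: "0 < I w" if w: "w \<in> S" "B 1 w = lam" for w
  proof -
    have ws: "w \<in> space M" using w(1) by (simp add: S_def)
    have Bf: "f u + lam / 32 \<le> B u w \<and> B u w \<le> f u - lam / 32" if "0 \<le> u" "u \<le> 1" for u
    proof -
      have "\<bar>B u w - f u\<bar> \<le> - lam / 32" using w(1) that by (auto simp: S_def)
      then show ?thesis by linarith
    qed
    have tr: "tau w \<in> {0..1}" by (rule tau_range[OF ws])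
    have t: "1 - r / 2 < tau w"
    proof (rule ccontr)
      assume "\<not> 1 - r / 2 < tau w"
      then have "lam / 8 \<le> f (tau w)" using tr by (intro fl) auto
      then have "lam < B (tau w) w" using Bf[of "tau w"] tr lam_neg by auto
      then show False using tau_le[OF ws, of 1] w(2) by simp
    qed
    define D where "D = B 1 w - B (tau w) w"
    have D: "0 \<le> D" "D \<le> - lam / 32"
      using tau_le[OF ws, of 1] Bf[of "tau w"] fg[of "tau w"] tr w(2) by (auto simp: D_def)
    have Vu: "V u w = B (u - (1 - tau w)) w + D" if "r \<le> u" "u < 1" for u
      using V_after[OF ws, of u] that t times by (simp add: D_def)
    have mid: "5 * lam / 32 \<le> V u w \<and> V u w \<le> 3 * lam / 32 - lam / 32" if u: "r \<le> u" "u \<le> 1 - r / 2" "u < 1" for u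
    proof -
      have "f (u - (1 - tau w)) = lam / 8" using u t tr by (intro fm) auto
      then show ?thesis using Vu[OF u(1,3)] Bf[of "u - (1 - tau w)"] D u t tr times by auto
    qed
    have "V r w < 0" using mid[of r] r1 lam_neg by auto
    moreover have "\<bar>V (s - h) w\<bar> < - lam / 2" "\<bar>V (s + h) w\<bar> < - lam / 2"
      using mid[of "s - h"] mid[of "s + h"] times lam_neg by (auto simp: abs_less_iff)
    ultimately show ?thesis unfolding I_def using nu(2) ze(2) by (intro mult_pos_pos) auto
  qed
  have "expectation I \<noteq> 0"
  proof
    assume "expectation I = 0"
    moreover have "integrable M I" by (rule integrable_bounded_rv[OF Im, where C=1]) (use I0 in auto)
    ultimately have "AE w in M. I w = 0" using I0 by (subst (asm) integral_nonneg_eq_0_iff_AE) auto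
    with B_1 have "AE w in M. w \<notin> S" by eventually_elim (use posI in force)
    then have "prob S = 0"
    proof -
      assume a: "AE w in M. w \<notin> S"
      have SM: "S \<in> events" using \<open>0 < prob S\<close> measure_notin_sets by fastforce
      show ?thesis using a SM by (subst (asm) AE_iff_measurable[OF SM]) (auto simp: S_def measure_def)
    qed
    then show False using \<open>0 < prob S\<close> by simp
  qed
  moreover have "0 \<le> expectation I" by (rule integral_nonneg_AE) (use I0 in auto)
  ultimately show ?thesis by (simp add: I_def[abs_def])
qed

end

section \<open>The contradiction\<close>

lemma eventually_inverse_less:
  assumes "0 < (h::real)" shows "\<forall>\<^sub>F n in sequentially. 1 / real (n + c) < h"
proof (rule eventually_sequentiallyI[of "Suc (nat \<lceil>1 / h\<rceil>)"])
  fix n assume n: "Suc (nat \<lceil>1 / h\<rceil>) \<le> n"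
  have "1 / h \<le> real (nat \<lceil>1 / h\<rceil>)" by (rule real_nat_ceiling_ge)
  also have "\<dots> < real (n + c)" using n by simp
  finally have "1 / h < real (n + c)" .
  moreover have "0 < real (n + c)" using n by simp
  ultimately show "1 / real (n + c) < h" using assms by (simp add: field_simps)
qed

context vervaat_bridge
begin

lemma eventually_V_small:
  assumes "w \<in> space M" "0 < e"
  shows "\<forall>\<^sub>F n in sequentially. \<bar>V (1 / real (n + c)) w\<bar> < e"
proof -
  obtain h where h: "0 < h" "\<And>u. 0 \<le> u \<Longrightarrow> u < h \<Longrightarrow> \<bar>V u w\<bar> < e" using V_small_near_0[OF assms] by blast
  show ?thesis using eventually_inverse_less[OF h(1), of c] by eventually_elim (rule h(2), auto)
qed

lemma V_measurable_inverse [measurable]: "V (1 / real (n + Suc c)) \<in> borel_measurable M"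
  by (rule V_measurable) (auto simp: field_simps)

lemma small_initial_path_event:
  assumes "0 \<le> T" "T \<le> 1"
  shows "{w \<in> space M. \<forall>u\<in>{0..T}. \<bar>B u w\<bar> \<le> e} \<in> events"
proof -
  have "{w \<in> space M. \<forall>u\<in>{0..T}. - e \<le> - \<bar>B u w\<bar>} \<in> events"
  proof (rule closed_path_event)
    fix u assume "u \<in> {0..T}"
    then have [measurable]: "B u \<in> borel_measurable M" using assms by (intro B_measurable) auto
    show "(\<lambda>w. - \<bar>B u w\<bar>) \<in> borel_measurable M" by measurable
  qed (use assms in \<open>auto intro!: continuous_intros B_cont_on\<close>)
  then show ?thesis by simp
qed

lemma choose_horizon:
  assumes "0 < e" "0 < e'"
  shows "\<exists>T. 0 < T \<and> T \<le> 1 / 4 \<and> prob {w \<in> space M. e < \<bar>V T w\<bar>} \<le> 1 / 8 \<and>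
    7 / 8 \<le> prob {w \<in> space M. \<forall>u\<in>{0..T}. \<bar>B u w\<bar> \<le> e'}"
proof -
  define T where "T n = 1 / real (n + Suc 3)" for n
  have T: "0 < T n" "T n \<le> 1 / 4" for n by (auto simp: T_def field_simps)
  have [measurable]: "V (T n) \<in> borel_measurable M" for n unfolding T_def by measurable
  define G where "G n = {w \<in> space M. \<forall>u\<in>{0..T n}. \<bar>B u w\<bar> \<le> e'}" for n
  have GM[measurable]: "G n \<in> events" for n
    unfolding G_def using T[of n] by (intro small_initial_path_event) auto
  have "\<forall>\<^sub>F n in sequentially. prob {w \<in> space M. e < \<bar>V (T n) w\<bar>} \<le> 1 / 8"
  proof (rule eventually_prob_le)
    fix w assume "w \<in> space M"
    from eventually_V_small[OF this assms(1), of "Suc 3"]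
    show "\<forall>\<^sub>F n in sequentially. w \<notin> {w \<in> space M. e < \<bar>V (T n) w\<bar>}"
      by eventually_elim (auto simp: T_def)
  qed auto
  moreover have "\<forall>\<^sub>F n in sequentially. prob (space M - G n) \<le> 1 / 8"
  proof (rule eventually_prob_le)
    fix w assume w: "w \<in> space M"
    obtain d where d: "0 < d" "\<And>u. u \<in> {0..1} \<Longrightarrow> \<bar>u\<bar> < d \<Longrightarrow> \<bar>B u w\<bar> < e'"
      using B_cont[OF w] assms(2) B_0[OF w] unfolding continuous_on_iff dist_real_def
      by (metis atLeastAtMost_iff diff_zero zero_le_one order_refl)
    from eventually_inverse_less[OF d(1), of "Suc 3"]
    show "\<forall>\<^sub>F n in sequentially. w \<notin> space M - G n"
    proof eventually_elim
      case (elim n)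
      have "\<bar>B u w\<bar> \<le> e'" if u: "u \<in> {0..T n}" for u
      proof -
        have "u < d" using elim u unfolding T_def by (meson atLeastAtMost_iff le_less_trans)
        then show ?thesis using d(2)[of u] u T(2)[of n] by auto
      qed
      then show ?case using w by (auto simp: G_def)
    qed
  qed auto
  ultimately have "\<forall>\<^sub>F n in sequentially. prob {w \<in> space M. e < \<bar>V (T n) w\<bar>} \<le> 1 / 8 \<and> prob (space M - G n) \<le> 1 / 8"
    by eventually_elim auto
  then obtain n where n: "prob {w \<in> space M. e < \<bar>V (T n) w\<bar>} \<le> 1 / 8" "prob (space M - G n) \<le> 1 / 8"
    by (auto simp: eventually_sequentially)
  have "7 / 8 \<le> prob (G n)" using n(2) prob_compl[OF GM[of n]] by simp
  then show ?thesis using T[of n] n(1) unfolding G_def by (intro exI[of _ "T n"] conjI)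
qed

lemma choose_probe_time:
  assumes "0 < e"
  shows "\<exists>t. 0 < t \<and> t < e \<and> t < 1 \<and> prob {w \<in> space M. 1 - t \<le> tau w} \<le> 1 / 16"
proof -
  define t where "t n = 1 / real (n + 2)" for n
  have "\<forall>\<^sub>F n in sequentially. prob {w \<in> space M. 1 - t n \<le> tau w \<and> tau w \<noteq> 1} \<le> 1 / 16"
  proof (rule eventually_prob_le)
    fix w assume w: "w \<in> space M"
    show "\<forall>\<^sub>F n in sequentially. w \<notin> {w \<in> space M. 1 - t n \<le> tau w \<and> tau w \<noteq> 1}"
    proof (cases "tau w = 1")
      case False
      then have "0 < 1 - tau w" using tau_range[OF w] by auto
      from eventually_inverse_less[OF this, of 2] show ?thesis
        by eventually_elim (auto simp: t_def)
    qed simp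
  qed auto
  then have "\<forall>\<^sub>F n in sequentially. prob {w \<in> space M. 1 - t n \<le> tau w \<and> tau w \<noteq> 1} \<le> 1 / 16 \<and> t n < e"
    using eventually_inverse_less[OF assms, of 2] unfolding t_def by eventually_elim auto
  then obtain n where n: "prob {w \<in> space M. 1 - t n \<le> tau w \<and> tau w \<noteq> 1} \<le> 1 / 16" "t n < e"
    by (auto simp: eventually_sequentially)
  have "prob {w \<in> space M. 1 - t n \<le> tau w} \<le> prob ({w \<in> space M. 1 - t n \<le> tau w \<and> tau w \<noteq> 1} \<union> {w \<in> space M. tau w = 1})"
    by (rule finite_measure_mono) auto
  also have "\<dots> \<le> prob {w \<in> space M. 1 - t n \<le> tau w \<and> tau w \<noteq> 1} + prob {w \<in> space M. tau w = 1}"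
    by (rule measure_Un_le) auto
  finally have "prob {w \<in> space M. 1 - t n \<le> tau w} \<le> 1 / 16" using n(1) tau_less_1 by simp
  moreover have "0 < t n" "t n < 1" by (auto simp: t_def field_simps)
  ultimately show ?thesis using n(2) by blast
qed

lemma choose_start_time:
  assumes "0 < e" "0 < y"
  shows "\<exists>s. 0 < s \<and> s < y \<and> prob {w \<in> space M. e \<le> \<bar>V s w\<bar>} \<le> 1 / 16"
proof -
  define s where "s n = 1 / real (n + Suc 0)" for n
  have [measurable]: "V (s n) \<in> borel_measurable M" for n unfolding s_def by measurable
  have "\<forall>\<^sub>F n in sequentially. prob {w \<in> space M. e \<le> \<bar>V (s n) w\<bar>} \<le> 1 / 16"
  proof (rule eventually_prob_le)
    fix w assume "w \<in> space M"
    from eventually_V_small[OF this assms(1), of "Suc 0"]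
    show "\<forall>\<^sub>F n in sequentially. w \<notin> {w \<in> space M. e \<le> \<bar>V (s n) w\<bar>}"
      by eventually_elim (auto simp: s_def)
  qed auto
  then have "\<forall>\<^sub>F n in sequentially. prob {w \<in> space M. e \<le> \<bar>V (s n) w\<bar>} \<le> 1 / 16 \<and> s n < y"
    using eventually_inverse_less[OF assms(2), of "Suc 0"] unfolding s_def by eventually_elim auto
  then obtain n where "prob {w \<in> space M. e \<le> \<bar>V (s n) w\<bar>} \<le> 1 / 16" "s n < y"
    by (auto simp: eventually_sequentially)
  moreover have "0 < s n" by (auto simp: s_def)
  ultimately show ?thesis by blast
qed

lemma small_dev_probable:
  assumes T: "T \<le> 1" and p: "7 / 8 \<le> prob {w \<in> space M. \<forall>u\<in>{0..T}. \<bar>B u w\<bar> \<le> c}"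
    and ab: "0 \<le> a" "a < b" "b \<le> T"
  shows "7 / 8 \<le> prob {w \<in> space M. \<forall>u\<in>{a..b}. \<bar>dev a b u w\<bar> \<le> 2 * c}"
proof -
  have "{w \<in> space M. \<forall>u\<in>{0..T}. \<bar>B u w\<bar> \<le> c} \<subseteq> {w \<in> space M. \<forall>u\<in>{a..b}. \<bar>dev a b u w\<bar> \<le> 2 * c}"
    using ab by (auto intro!: dev_le_two_sup)
  moreover have "{w \<in> space M. \<forall>u\<in>{a..b}. \<bar>dev a b u w\<bar> \<le> 2 * c} \<in> events"
    using small_dev_event[of a b "2 * c"] inner_subalgebra[of a b] ab T unfolding subalgebra_def by auto
  ultimately have "prob {w \<in> space M. \<forall>u\<in>{0..T}. \<bar>B u w\<bar> \<le> c} \<le> prob {w \<in> space M. \<forall>u\<in>{a..b}. \<bar>dev a b u w\<bar> \<le> 2 * c}"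
    by (rule finite_measure_mono)
  then show ?thesis using p by simp
qed

text \<open>
  The standard deviation at time \<open>t - d\<close> is at least \<open>sqrt t / 2\<close>, so that \<open>x\<close> is at most an eighth of it and
  the deviation is below \<open>- x\<close> with probability at least \<open>3 / 8\<close>. The event of large deviations in the window
  takes away at most \<open>1 / 8\<close>.
\<close>

lemma negative_probe_probable:
  assumes T: "0 < T" "T \<le> 1" and p: "7 / 8 \<le> prob {w \<in> space M. \<forall>u\<in>{0..T}. \<bar>B u w\<bar> \<le> c}"
    and t: "0 < s" "2 * s \<le> t" "2 * t \<le> T" "d \<in> {0..s / 2}" and x: "0 \<le> x" "16 * x \<le> sqrt t"
  shows "1 / 4 \<le> prob {w \<in> space M. dev (s-d) (T-d) (t-d) w \<le> - x \<and> (\<forall>u\<in>{s-d..T-d}. \<bar>dev (s-d) (T-d) u w\<bar> \<le> 2 * c)}"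
proof -
  define a b where "a = s - d" and "b = T - d"
  have ab: "0 \<le> a" "a < t - d" "t - d < b" "b \<le> T" "a < b" "b \<le> 1" using t T by (auto simp: a_def b_def)
  define sg where "sg = sqrt ((t - d - a) * (b - (t - d)) / (b - a))"
  have var: "t / 4 \<le> (t - d - a) * (b - (t - d)) / (b - a)"
  proof -
    have "t / 2 * ((T - s) / 2) \<le> (t - s) * (T - t)" using t by (intro mult_mono) auto
    then have "t / 4 * (T - s) \<le> (t - s) * (T - t)" by simp
    then have "t / 4 \<le> (t - s) * (T - t) / (T - s)" using t by (simp add: pos_le_divide_eq)
    then show ?thesis by (simp add: a_def b_def)
  qed
  then have "sqrt (t / 4) \<le> sg" unfolding sg_def by (rule real_sqrt_le_mono)
  then have sg: "sqrt t / 2 \<le> sg" by (simp add: real_sqrt_divide)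
  have st: "0 < sqrt t" using t by simp
  have sg0: "0 < sg" using sg st by linarith
  have D: "distributed M lborel (dev a b (t - d)) (normal_density 0 sg)"
    unfolding sg_def using ab by (intro dev_normal) auto
  have "x / sg \<le> 1 / 8"
  proof -
    have "8 * x \<le> sg" using x sg by linarith
    then show ?thesis using sg0 by (simp add: pos_divide_le_eq)
  qed
  then have q: "3 / 8 \<le> prob {w \<in> space M. dev a b (t - d) w \<le> - x}"
    using normal_left_tail[OF D sg0 x(1)] by simp
  let ?A = "{w \<in> space M. dev a b (t - d) w \<le> - x}" and ?G = "{w \<in> space M. \<forall>u\<in>{a..b}. \<bar>dev a b u w\<bar> \<le> 2 * c}"
  have [measurable]: "dev a b (t - d) \<in> borel_measurable M" using ab by (intro dev_measurable) auto
  have GM: "?G \<in> events"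
    using small_dev_event[of a b "2 * c"] inner_subalgebra[of a b] ab by (auto simp: subalgebra_def)
  have AM: "?A \<in> events" by measurable
  have "7 / 8 \<le> prob ?G" using small_dev_probable[OF T(2) p] ab by simp
  then have "prob (space M - ?G) \<le> 1 / 8" using prob_compl[OF GM] by simp
  moreover have "prob ?A \<le> prob ((?A \<inter> ?G) \<union> (space M - ?G))"
    by (rule finite_measure_mono) (use AM GM in auto)
  moreover have "prob ((?A \<inter> ?G) \<union> (space M - ?G)) \<le> prob (?A \<inter> ?G) + prob (space M - ?G)"
    by (rule measure_Un_le) (use AM GM in auto)
  ultimately have "1 / 4 \<le> prob (?A \<inter> ?G)" using q by linarith
  also have "?A \<inter> ?G = {w \<in> space M. dev a b (t-d) w \<le> - x \<and> (\<forall>u\<in>{a..b}. \<bar>dev a b u w\<bar> \<le> 2 * c)}" by auto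
  finally show ?thesis by (simp add: a_def b_def)
qed

text \<open>
  The regression \<open>k\<close> of the weight \<open>nu (V r)\<close> on \<open>V s\<close> is divided out with the test function \<open>hh\<close>, which is
  \<open>q / k\<close> where \<open>k \<ge> q\<close>. This turns \<open>negative_after_restart\<close>, which speaks about the event \<open>V r < 0\<close>, into a
  lower bound for the probability of \<open>V t < 0\<close> on the event \<open>V s \<in> D\<close>, where \<open>D\<close> consists of all points near
  \<open>0\<close> with \<open>k \<ge> q\<close>. Since \<open>k\<close> vanishes almost nowhere, this event is likely for small \<open>q\<close>.
\<close>

theorem vervaat_not_markov:
  assumes mk: "markov_process M {0..1} F V"
  shows False
proof -
  define L where "L = - lam"
  have L: "0 < L" using lam_neg by (simp add: L_def)
  obtain T where T: "0 < T" "T \<le> 1 / 4" and VT: "prob {w \<in> space M. L / 8 < \<bar>V T w\<bar>} \<le> 1 / 8"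
    and BT: "7 / 8 \<le> prob {w \<in> space M. \<forall>u\<in>{0..T}. \<bar>B u w\<bar> \<le> L / 16}"
    using choose_horizon[of "L / 8" "L / 16"] L by auto
  \<comment> \<open>The square terms bound \<open>sqrt t\<close>: by the first, the chord towards \<open>V T\<close> rises by at most \<open>sqrt t / 64\<close> until time \<open>t\<close>; by the second, \<open>ep \<le> L / 4\<close>.\<close>
  define e0 where "e0 = min (T / 2) (min ((T / (32 * L))\<^sup>2) ((16 * L)\<^sup>2))"
  have e0: "0 < e0" using T L by (simp add: e0_def)
  obtain t where t: "0 < t" "t < e0" "t < 1" and pt: "prob {w \<in> space M. 1 - t \<le> tau w} \<le> 1 / 16"
    using choose_probe_time[OF e0] by auto
  have tT: "2 * t \<le> T" using t by (simp add: e0_def)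
  have st1: "sqrt t \<le> T / (32 * L)" by (rule real_le_lsqrt) (use t T L in \<open>auto simp: e0_def\<close>)
  have st2: "sqrt t \<le> 16 * L" by (rule real_le_lsqrt) (use t L in \<open>auto simp: e0_def\<close>)
  define ep where "ep = sqrt t / 64"
  have ep: "0 < ep" "ep \<le> L / 4" using t st2 by (auto simp: ep_def)
  obtain s where s: "0 < s" "s < t / 2" and ps: "prob {w \<in> space M. ep \<le> \<bar>V s w\<bar>} \<le> 1 / 16"
    using choose_start_time[OF ep(1), of "t / 2"] t by auto
  define r h where "r = s / 2" and "h = s / 4"
  have rh: "0 < r" "r < s - h" "0 < h" "s + h \<le> 1 - r" "2 * s < 1" "r < s" "T \<le> 1 - r" "s < t" "t < T" "s + h \<le> T" "0 \<le> s - h - r"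
    using s t tT T by (auto simp: r_def h_def)
  define nu where "nu v = min 1 (max 0 (- v))" for v :: real
  define ze where "ze v = min 1 (max 0 (2 - 4 * \<bar>v\<bar> / L))" for v :: real
  define gam where "gam v = min 1 (max 0 (2 - 8 * \<bar>v\<bar> / L))" for v :: real
  define psi where "psi v = min 1 (max 0 (- v / ep))" for v :: real
  have cf: "cutoff nu" "cutoff ze" "cutoff gam" "cutoff psi"
    unfolding nu_def[abs_def] ze_def[abs_def] gam_def[abs_def] psi_def[abs_def]
    using L ep by (auto intro!: cutoff_clamp continuous_intros)
  note unit = cutoff_nonneg[OF cf(1)] cutoff_nonneg[OF cf(2)] cutoff_nonneg[OF cf(3)] cutoff_nonneg[OF cf(4)]
    cutoff_le_1[OF cf(1)] cutoff_le_1[OF cf(2)] cutoff_le_1[OF cf(3)] cutoff_le_1[OF cf(4)]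
  note [measurable] = cutoff_measurable[OF cf(1)] cutoff_measurable[OF cf(2)] cutoff_measurable[OF cf(3)] cutoff_measurable[OF cf(4)]
  have nu: "v < 0" if "nu v \<noteq> 0" for v using that by (auto simp: nu_def max_def split: if_splits)
  have nu': "0 < nu v" if "v < 0" for v using that by (auto simp: nu_def)
  have ze: "\<bar>v\<bar> \<le> - lam / 2" if "ze v \<noteq> 0" for v
    using that L by (auto simp: ze_def L_def[symmetric] field_simps max_def split: if_splits)
  have ze': "0 < ze v" if "\<bar>v\<bar> < - lam / 2" for v
    using that L by (auto simp: ze_def L_def[symmetric] field_simps)
  have gam: "\<bar>v\<bar> \<le> L / 4" if "gam v \<noteq> 0" for v
    using that L by (auto simp: gam_def field_simps max_def split: if_splits)
  have gam1: "gam v = 1" if "\<bar>v\<bar> \<le> L / 8" for v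
    using that L by (auto simp: gam_def field_simps min_def max_def)
  have psi: "psi v = 1" if "v \<le> - ep" for v
    using that ep by (auto simp: psi_def field_simps min_def max_def)
  have psi0: "v < 0" if "psi v \<noteq> 0" for v
  proof (rule ccontr)
    assume "\<not> v < 0"
    then have "- v / ep \<le> 0" using ep by simp
    then have "psi v = 0" by (simp add: psi_def)
    then show False using that by simp
  qed
  have Vm[measurable]: "V r \<in> borel_measurable M" "V s \<in> borel_measurable M" "V t \<in> borel_measurable M" "V T \<in> borel_measurable M"
    using rh s t T by (auto intro!: V_measurable)
  have probe: "1 / 4 \<le> prob {w \<in> space M. dev (s-d) (T-d) (t-d) w \<le> - (ep + ep + L / 4 * ((t - s) / (T - s))) \<and>
        (\<forall>u\<in>{s-d..T-d}. \<bar>dev (s-d) (T-d) u w\<bar> \<le> - lam / 8)}" if d: "d \<in> {0..r}" for d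
  proof -
    have "(t - s) / (T - s) \<le> t / (T / 2)" using s t T rh tT by (intro frac_le) auto
    then have "L / 4 * ((t - s) / (T - s)) \<le> L / 4 * (t / (T / 2))" using L by (intro mult_left_mono) auto
    also have "\<dots> = L / (2 * T) * (sqrt t * sqrt t)" using t by simp
    also have "\<dots> \<le> L / (2 * T) * (T / (32 * L) * sqrt t)" using st1 L T t by (intro mult_left_mono mult_right_mono) auto
    also have "\<dots> = sqrt t / 64" using L T by simp
    finally have c0: "L / 4 * ((t - s) / (T - s)) \<le> sqrt t / 64" .
    have c1: "0 \<le> L / 4 * ((t - s) / (T - s))" using L rh by (intro mult_nonneg_nonneg divide_nonneg_nonneg) auto
    have "1 / 4 \<le> prob {w \<in> space M. dev (s-d) (T-d) (t-d) w \<le> - (ep + ep + L / 4 * ((t - s) / (T - s))) \<and>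
        (\<forall>u\<in>{s-d..T-d}. \<bar>dev (s-d) (T-d) u w\<bar> \<le> 2 * (L / 16))}"
    proof (rule negative_probe_probable[OF T(1) _ BT s(1) _ tT])
      have "16 * (y / 64 + y / 64 + x) \<le> y" if "x \<le> y / 64" "0 \<le> y" for x y :: real using that by simp
      from this[OF c0] show "16 * (ep + ep + L / 4 * ((t - s) / (T - s))) \<le> sqrt t" using t unfolding ep_def by simp
      show "0 \<le> ep + ep + L / 4 * ((t - s) / (T - s))" using c1 ep(1) by (intro add_nonneg_nonneg) auto
    qed (use T s d in \<open>auto simp: r_def\<close>)
    then show ?thesis by (simp add: L_def)
  qed
  have good: "1 / 2 \<le> prob {w \<in> space M. \<forall>u\<in>{a..b}. \<bar>dev a b u w\<bar> \<le> - lam / 8}" if "0 \<le> a" "a < b" "b \<le> T" for a b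
    using small_dev_probable[OF _ BT that] T by (simp add: L_def)
  have PF: "(\<lambda>w. nu (V r w)) \<in> borel_measurable (F s)"
  proof -
    have sub: "subalgebra M (F r)" "subalgebra M (F s)" "V r \<in> borel_measurable (F r)" and fi: "filtration (space M) F"
      using mk rh s unfolding markov_process_def by auto
    have "subalgebra (F s) (F r)" using sub filtration.sets_F_mono[OF fi, of r s] rh by (simp add: subalgebra_def)
    then have [measurable]: "V r \<in> borel_measurable (F s)" using sub(3) by (rule measurable_from_subalg)
    show ?thesis by measurable
  qed
  obtain k where km[measurable]: "k \<in> borel_measurable borel" and k0: "\<And>x. 0 \<le> k x" and
    reg: "\<And>h. h \<in> borel_measurable borel \<Longrightarrow> (\<And>x. 0 \<le> h x \<and> h x \<le> 1 \<and> h x * k x \<le> 1) \<Longrightarrow>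
        expectation (\<lambda>w. nu (V r w) * h (V s w)) = expectation (\<lambda>w. h (V s w) * k (V s w))"
    using regression_function[of "\<lambda>w. nu (V r w)" "V s"] unit by auto
  define Z where "Z = {x. \<bar>x\<bar> < ep \<and> k x = 0}"
  have Zm[measurable]: "Z \<in> sets borel" unfolding Z_def by measurable
  have "expectation (\<lambda>w. nu (V r w) * indicator Z (V s w)) = 0"
  proof -
    have "expectation (\<lambda>w. nu (V r w) * indicator Z (V s w)) = expectation (\<lambda>w. indicator Z (V s w) * k (V s w))"
      by (rule reg) (auto simp: indicator_def Z_def)
    also have "\<dots> = expectation (\<lambda>w. 0)" by (rule Bochner_Integration.integral_cong) (auto simp: indicator_def Z_def)
    finally show ?thesis by simp
  qed
  moreover have "Z \<subseteq> {-ep<..<ep}" by (auto simp: Z_def abs_less_iff)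
  moreover have "0 < expectation (\<lambda>w. nu (V r w) * (ze (V (s - h) w) * ze (V (s + h) w)))"
    by (rule early_excursion_end_possible[OF rh(1-4) cf(1) nu' cf(2) ze'])
  moreover have "ep \<le> - lam / 2" using ep L by (simp add: L_def)
  ultimately have pZ: "prob {w \<in> space M. V s w \<in> Z \<and> tau w \<le> 1 - 2 * s} = 0"
    by (intro null_transfer[OF cf(1) nu cf(2) ze rh(1-4) s(1) rh(5) ep(1) _ good good _ Zm]) (use rh in auto)
  have "\<forall>\<^sub>F j in sequentially. prob {w \<in> space M. 0 < k (V s w) \<and> k (V s w) < 1 / real (j + 1)} \<le> 1 / 16"
  proof (rule eventually_prob_le)
    fix w
    show "\<forall>\<^sub>F j in sequentially. w \<notin> {w \<in> space M. 0 < k (V s w) \<and> k (V s w) < 1 / real (j + 1)}"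
    proof (cases "0 < k (V s w)")
      case True
      from eventually_inverse_less[OF this, of 1] show ?thesis by eventually_elim auto
    qed auto
  qed auto
  then obtain j where pj: "prob {w \<in> space M. 0 < k (V s w) \<and> k (V s w) < 1 / real (j + 1)} \<le> 1 / 16"
    by (auto simp: eventually_sequentially)
  define q where "q = 1 / real (j + 1)"
  have q: "0 < q" "q \<le> 1" by (auto simp: q_def)
  define D where "D = {x. \<bar>x\<bar> < ep \<and> q \<le> k x}"
  have Dm[measurable]: "D \<in> sets borel" unfolding D_def by measurable
  \<comment> \<open>The product of \<open>hh\<close> and \<open>k\<close> is the constant \<open>q\<close> on \<open>D\<close>, which removes the unknown function \<open>k\<close>.\<close>
  define hh where "hh x = indicator D x * (q / k x)" for x
  have hm[measurable]: "hh \<in> borel_measurable borel" unfolding hh_def[abs_def] by measurable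
  have hk: "hh x * k x = indicator D x * q" for x using q by (auto simp: hh_def indicator_def D_def)
  have h01: "0 \<le> hh x \<and> hh x \<le> 1 \<and> hh x * k x \<le> 1" for x
  proof -
    have "q / k x \<le> 1" if "x \<in> D" using that q by (simp add: D_def divide_le_eq_1)
    moreover have "hh x * k x \<le> 1" unfolding hk using q by (auto simp: indicator_def)
    ultimately show ?thesis using q k0[of x] by (auto simp: hh_def indicator_def)
  qed
  have step1: "expectation (\<lambda>w. (1 / 4 * nu (V r w) * gam (V T w)) * hh (V s w)) \<le>
      expectation (\<lambda>w. (nu (V r w) * gam (V T w) * psi (V t w)) * hh (V s w))"
  proof (rule weighted_expectation_le_borel[where ep=ep and X="V s" and h=hh and
        P="\<lambda>w. 1 / 4 * nu (V r w) * gam (V T w)" and Q="\<lambda>w. nu (V r w) * gam (V T w) * psi (V t w)"])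
    fix ph assume ph: "cutoff ph" "\<And>v. ph v \<noteq> 0 \<Longrightarrow> \<bar>v\<bar> < ep"
    have "1 / 4 * expectation (\<lambda>w. nu (V r w) * (ph (V s w) * gam (V T w))) \<le>
       expectation (\<lambda>w. nu (V r w) * (ph (V s w) * gam (V T w) * psi (V t w)))"
      by (rule negative_after_restart[OF cf(1) ph(1) cf(3,4) nu ph(2) gam psi _ _ _ _ _ _ _ _ _ _ _ probe])
        (use rh L ep in \<open>auto simp: L_def\<close>)
    then show "expectation (\<lambda>w. (1 / 4 * nu (V r w) * gam (V T w)) * ph (V s w)) \<le>
      expectation (\<lambda>w. (nu (V r w) * gam (V T w) * psi (V t w)) * ph (V s w))"
      by (simp add: ac_simps)
  next
    fix w
    have 1: "0 \<le> nu (V r w) * gam (V T w)" "nu (V r w) * gam (V T w) \<le> 1" using unit by (auto intro: mult_le_one)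
    then show "0 \<le> 1 / 4 * nu (V r w) * gam (V T w) \<and> 1 / 4 * nu (V r w) * gam (V T w) \<le> 1" by auto
    show "0 \<le> nu (V r w) * gam (V T w) * psi (V t w) \<and> nu (V r w) * gam (V T w) * psi (V t w) \<le> 1"
      using 1 unit by (intro mult_unit_interval) auto
  next
    show "\<bar>x\<bar> < ep" if "hh x \<noteq> 0" for x using that by (auto simp: hh_def D_def indicator_def split: if_splits)
  qed (use h01 in auto)
  have two: "expectation (\<lambda>w. nu (V r w) * hh (V s w) * g (V t w) * gam (V T w)) =
    expectation (\<lambda>w. hh (V s w) * k (V s w) * g (V t w) * gam (V T w))"
    if "g \<in> borel_measurable borel" "\<And>x. 0 \<le> g x \<and> g x \<le> 1" for g
    by (rule markov_two_step[OF mk _ _ _ _ _ PF _ km k0 reg hm h01 that]) (use rh s t T unit in auto)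
  have "1 / 4 * (q * expectation (\<lambda>w. indicator D (V s w) * gam (V T w))) =
      1 / 4 * expectation (\<lambda>w. hh (V s w) * k (V s w) * 1 * gam (V T w))"
    unfolding hk by (simp add: ac_simps)
  also have "\<dots> = 1 / 4 * expectation (\<lambda>w. nu (V r w) * hh (V s w) * 1 * gam (V T w))"
    using two[of "\<lambda>_. 1"] by simp
  also have "\<dots> = expectation (\<lambda>w. (1 / 4 * nu (V r w) * gam (V T w)) * hh (V s w))"
    by (subst integral_mult_right_zero[symmetric]) (simp add: ac_simps)
  also note step1
  also have "expectation (\<lambda>w. (nu (V r w) * gam (V T w) * psi (V t w)) * hh (V s w)) =
      expectation (\<lambda>w. nu (V r w) * hh (V s w) * psi (V t w) * gam (V T w))"
    by (simp add: ac_simps)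
  also have "\<dots> = expectation (\<lambda>w. hh (V s w) * k (V s w) * psi (V t w) * gam (V T w))"
    using unit by (intro two) auto
  also have "\<dots> \<le> expectation (\<lambda>w. q * indicator {w \<in> space M. 1 - t \<le> tau w} w)"
  proof (rule integral_mono)
    have b: "0 \<le> hh (V s w) * k (V s w) * psi (V t w) * gam (V T w) \<and> hh (V s w) * k (V s w) * psi (V t w) * gam (V T w) \<le> q" for w
    proof -
      have "0 \<le> indicator D (V s w) * psi (V t w) * gam (V T w) \<and> indicator D (V s w) * psi (V t w) * gam (V T w) \<le> (1::real)"
        using unit by (intro mult_unit_interval) (auto simp: indicator_def)
      then have "0 \<le> q * (indicator D (V s w) * psi (V t w) * gam (V T w)) \<and> q * (indicator D (V s w) * psi (V t w) * gam (V T w)) \<le> q * 1"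
        using q unit by (intro conjI mult_left_mono mult_nonneg_nonneg) auto
      then show ?thesis unfolding hk by (simp add: ac_simps)
    qed
    show "integrable M (\<lambda>w. hh (V s w) * k (V s w) * psi (V t w) * gam (V T w))"
      by (rule integrable_bounded_rv[where C=q]) (measurable, use b in auto)
    show "integrable M (\<lambda>w. q * indicator {w \<in> space M. 1 - t \<le> tau w} w)"
      by (rule integrable_bounded_rv[where C=q]) (measurable, use q in \<open>auto simp: indicator_def\<close>)
    fix w assume w: "w \<in> space M"
    show "hh (V s w) * k (V s w) * psi (V t w) * gam (V T w) \<le> q * indicator {w \<in> space M. 1 - t \<le> tau w} w"
    proof (cases "1 - t \<le> tau w")
      case False
      then have "0 \<le> V t w" using t by (intro V_nonneg_before[OF w]) auto
      then have "psi (V t w) = 0" using psi0 by fastforce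
      then show ?thesis using q by (simp add: indicator_def)
    qed (use b w in \<open>auto simp: indicator_def\<close>)
  qed
  also have "\<dots> = q * prob {w \<in> space M. 1 - t \<le> tau w}" by simp
  also have "\<dots> \<le> q * (1 / 16)" using pt q by (intro mult_left_mono) auto
  finally have upper: "expectation (\<lambda>w. indicator D (V s w) * gam (V T w)) \<le> 1 / 4" using q by simp
  \<comment> \<open>The bound \<open>1 / 4\<close> contradicts the fact that the exceptional events have total probability at most \<open>5 / 16\<close>.\<close>
  define S where "S = {w \<in> space M. V s w \<in> D \<and> \<bar>V T w\<bar> \<le> L / 8}"
  have SM[measurable]: "S \<in> events" unfolding S_def by measurable
  have "prob S \<le> expectation (\<lambda>w. indicator D (V s w) * gam (V T w))"
  proof -
    have "expectation (indicator S) \<le> expectation (\<lambda>w. indicator D (V s w) * gam (V T w))"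
    proof (rule integral_mono)
      show "integrable M (indicator S :: 'a \<Rightarrow> real)" by (rule integrable_bounded_rv[where C=1]) (auto simp: indicator_def)
      show "integrable M (\<lambda>w. indicator D (V s w) * gam (V T w))"
        by (rule integrable_bounded_rv[where C=1]) (measurable, use unit in \<open>auto simp: indicator_def\<close>)
      show "indicator S w \<le> indicator D (V s w) * gam (V T w)" for w
        using unit gam1[of "V T w"] by (auto simp: S_def indicator_def)
    qed
    then show ?thesis using SM by simp
  qed
  moreover have "1 \<le> prob S + 1 / 8 + 1 / 16 + 1 / 16 + 1 / 16"
  proof -
    let ?A1 = "{w \<in> space M. L / 8 < \<bar>V T w\<bar>}" and ?A2 = "{w \<in> space M. ep \<le> \<bar>V s w\<bar>}"
      and ?A3 = "{w \<in> space M. 1 - t \<le> tau w}" and ?A4 = "{w \<in> space M. V s w \<in> Z \<and> tau w \<le> 1 - 2 * s}"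
      and ?A5 = "{w \<in> space M. 0 < k (V s w) \<and> k (V s w) < q}"
    have "space M \<subseteq> S \<union> ?A1 \<union> ?A2 \<union> ?A3 \<union> ?A4 \<union> ?A5"
    proof
      fix w assume "w \<in> space M"
      moreover have "tau w \<le> 1 - 2 * s" if "\<not> 1 - t \<le> tau w" using that s by linarith
      ultimately show "w \<in> S \<union> ?A1 \<union> ?A2 \<union> ?A3 \<union> ?A4 \<union> ?A5"
        using k0[of "V s w"] by (force simp: S_def D_def Z_def not_less not_le)
    qed
    then have "prob (space M) \<le> prob (S \<union> ?A1 \<union> ?A2 \<union> ?A3 \<union> ?A4 \<union> ?A5)" by (rule finite_measure_mono) measurable
    also have "\<dots> \<le> prob (S \<union> ?A1 \<union> ?A2 \<union> ?A3 \<union> ?A4) + prob ?A5" by (rule measure_Un_le) measurable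
    also have "prob (S \<union> ?A1 \<union> ?A2 \<union> ?A3 \<union> ?A4) \<le> prob (S \<union> ?A1 \<union> ?A2 \<union> ?A3) + prob ?A4" by (rule measure_Un_le) measurable
    also have "prob (S \<union> ?A1 \<union> ?A2 \<union> ?A3) \<le> prob (S \<union> ?A1 \<union> ?A2) + prob ?A3" by (rule measure_Un_le) measurable
    also have "prob (S \<union> ?A1 \<union> ?A2) \<le> prob (S \<union> ?A1) + prob ?A2" by (rule measure_Un_le) measurable
    also have "prob (S \<union> ?A1) \<le> prob S + prob ?A1" by (rule measure_Un_le) measurable
    finally show ?thesis using VT ps pt pZ pj by (simp add: prob_space q_def)
  qed
  ultimately show False using upper by linarith
qed

end

theorem proposition3p2:
  fixes M :: "'a measure" and B :: "real \<Rightarrow> 'a \<Rightarrow> real" and lam :: real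
  assumes "lam < 0"
    and "brownian_bridge M lam B"
  defines "V \<equiv> \<lambda>t w. vervaat (\<lambda>u. B u w) t"
  shows "\<not> markov_process M {0..1} (natural_filtration M {0..1} V) V"
proof
  interpret b: bridge M B lam using assms by unfold_locales
  have V: "V = b.V" by (auto simp: V_def b.V_def[abs_def])
  assume mk: "markov_process M {0..1} (natural_filtration M {0..1} V) V"
  interpret vervaat_bridge M B lam
  proof
    fix u :: real assume "u \<in> {0..1}"
    then show "b.V u \<in> borel_measurable M"
      using mk unfolding markov_process_def V by (auto intro: measurable_from_subalg)
  qed
  show False using vervaat_not_markov mk unfolding V by blast
qed

end
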